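(* Let $r\ge1$ and $\boldsymbol\omega=(\omega_1,\dots,\omega_r)$ with $\mathrm{Re}(\omega_j)>0$. Define $$\Lambda(s,\boldsymbol\omega):=\hat Z(s,\boldsymbol\omega)\cdot\hat Z(1+\omega_1+\cdots+\omega_r-s,\boldsymbol\omega)^{(-1)^{r+1}},$$ and likewise $\Lambda(s,(\omega_1,\dots,\omega_{r-1}))$ using the $(r-1)$-tuple (for $r=1$, $\Lambda(s,())=\hat Z(s,())\hat Z(1-s,())^{-1}$). Then, as meromorphic functions of $s$, $$\Lambda(s,(\omega_1,\dots,\omega_{r-1},\omega_r))=\Lambda(s,(\omega_1,\dots,\omega_{r-1}))\cdot\Lambda(s+\omega_r,(\omega_1,\dots,\omega_{r-1},\omega_r)),$$ and $\Lambda$ satisfies the functional equation $$\Lambda(s,\boldsymbol\omega)\times\prod_{j=1}^{r}\ \prod_{1\le k_1<\cdots<k_j\le r}\Lambda(s+\omega_{k_1}+\cdots+\omega_{k_j},\boldsymbol\omega)^{(-1)^j}=1.$$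
   Context: For $m\ge0$ and $\boldsymbol\omega=(\omega_1,\dots,\omega_m)$ with $\mathrm{Re}(\omega_j)>0$ (the empty tuple allowed when $m=0$), define $$\hat Z(s,\boldsymbol\omega):=\exp\Big\{\Big(-\frac{B_m(s,\boldsymbol\omega)}{m!}-\frac{B_m(s-1,\boldsymbol\omega)}{m!}+\frac{B_{m+1}(s,(2,\omega_1,\dots,\omega_m))}{(m+1)!}\Big)\log(2\pi)\Big\}\,\Gamma(s,\boldsymbol\omega)^{-1}\Gamma(s-1,\boldsymbol\omega)^{-1}\Gamma(s,(2,\omega_1,\dots,\omega_m))\,Z(s,\boldsymbol\omega),$$ where $Z(s,\boldsymbol\omega):=\prod_{n_1,\dots,n_m\ge0}\zeta(s+n_1\omega_1+\cdots+n_m\omega_m)$ ($\zeta$ the Riemann zeta function; $Z(s,())=\zeta(s)$), meromorphically continued to $s\in\mathbb{C}$. Here the Barnes zeta function is $\zeta(w,z,\boldsymbol\omega):=\sum_{n_1,\dots,n_m\ge0}(z+n_1\omega_1+\cdots+n_m\omega_m)^{-w}$ for $\mathrm{Re}(z)>0$ (meromorphically continued in $w$, holomorphic at $w=0$); the multiple gamma function is $\Gamma(z,\boldsymbol\omega):=\exp\{\partial_w\zeta(w,z,\boldsymbol\omega)|_{w=0}\}$, continued meromorphically in $z$ (for $m=0$: $\Gamma(z,())=1/z$); the multiple Bernoulli polynomials are defined by $\frac{x^me^{-zx}}{\prod_{j=1}^m(1-e^{-\omega_jx})}=\sum_{n\ge0}\frac{B_n(z,\boldsymbol\omega)}{n!}x^n$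 (for $m=0$: $B_0=1$). In particular $\hat Z(s,())=2^{-1/2}(2\pi)^{-2}s(s-1)\pi^{-s/2}\Gamma(s/2)\zeta(s)$. *)

theory Defs
  imports "HOL-Complex_Analysis.Complex_Analysis" "HOL-Computational_Algebra.Formal_Power_Series"
begin

text \<open>Meromorphic continuation to the whole plane of a function given on a set A
  (A will always be a nonempty open half plane). The continuation is normalised
  (no removable singularities, value 0 at poles) so that it is uniquely determined.\<close>
definition mero_cont :: "(complex \<Rightarrow> complex) \<Rightarrow> complex set \<Rightarrow> complex \<Rightarrow> complex" where
  "mero_cont f A = (THE g. g nicely_meromorphic_on UNIV \<and> (\<forall>z\<in>A. g z = f z))"

definition rzeta :: "complex \<Rightarrow> complex" where
  "rzeta = mero_cont (\<lambda>s. \<Sum>n. of_nat (Suc n) powr (- s)) {s. Re s > 1}"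

definition lin :: "nat list \<Rightarrow> complex list \<Rightarrow> complex" where
  "lin n \<omega> = (\<Sum>i<length \<omega>. of_nat (n ! i) * \<omega> ! i)"

definition barnes_zeta :: "complex \<Rightarrow> complex \<Rightarrow> complex list \<Rightarrow> complex" where
  "barnes_zeta w z \<omega> = mero_cont
     (\<lambda>w. infsum (\<lambda>n. (z + lin n \<omega>) powr (- w)) {n. length n = length \<omega>})
     {w. Re w > of_nat (length \<omega>)} w"

definition mgamma :: "complex \<Rightarrow> complex list \<Rightarrow> complex" where
  "mgamma z \<omega> = mero_cont (\<lambda>z. exp (deriv (\<lambda>w. barnes_zeta w z \<omega>) 0)) {z. Re z > 0} z"

text \<open>Multiple Bernoulli polynomials: the generating function
  x^m e^{-zx} / prod_j (1 - e^{-w_j x}) = e^{-zx} prod_j (x / (1 - e^{-w_j x})).\<close>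
definition mbernoulli :: "nat \<Rightarrow> complex \<Rightarrow> complex list \<Rightarrow> complex" where
  "mbernoulli k z \<omega> = fact k * fps_nth
     (fps_exp (- z) * (\<Prod>w\<leftarrow>\<omega>. inverse (fps_shift 1 (1 - fps_exp (- w))))) k"

definition Zprod :: "complex \<Rightarrow> complex list \<Rightarrow> complex" where
  "Zprod s \<omega> = mero_cont
     (\<lambda>s. lim (\<lambda>N. \<Prod>n\<in>{n. length n = length \<omega> \<and> (\<forall>i\<in>set n. i \<le> N)}. rzeta (s + lin n \<omega>)))
     {s. Re s > 1} s"

definition Zhat :: "complex \<Rightarrow> complex list \<Rightarrow> complex" where
  "Zhat s \<omega> = (let m = length \<omega> in
     exp ((- mbernoulli m s \<omega> / fact m - mbernoulli m (s - 1) \<omega> / fact m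
           + mbernoulli (m + 1) s (2 # \<omega>) / fact (m + 1)) * Ln (2 * of_real pi))
     * inverse (mgamma s \<omega>) * inverse (mgamma (s - 1) \<omega>) * mgamma s (2 # \<omega>) * Zprod s \<omega>)"

definition Lambda :: "complex \<Rightarrow> complex list \<Rightarrow> complex" where
  "Lambda s \<omega> = Zhat s \<omega> * Zhat (1 + sum_list \<omega> - s) \<omega> powi ((-1) ^ (length \<omega> + 1))"

end

theory Submission
  imports Defs
begin

text \<open>
  Every factor of \<^term>\<open>Zhat s \<omega>\<close> obeys the same ladder relation
  F(s, \<omega> @ [v]) = F(s, \<omega>) F(s + v, \<omega> @ [v]). It holds termwise for the Barnes zeta series and
  for the product of zeta values, and it extends both of them step by step from a half plane to
  the whole plane. The ladder of \<^const>\<open>Zhat\<close> at s and at its reflected argument gives the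
  ladder of \<^const>\<open>Lambda\<close>. Peeling off the periods one at a time, the alternating product over
  all subsets collapses to \<^term>\<open>Lambda s []\<close>, which is 1 by the functional equation of the
  Riemann zeta function.

  The Barnes zeta function is continued through its Mellin integral, with Taylor polynomials of
  the product of the factors t / (1 - exp (-w t)) subtracted. The functional equation of zeta comes
  from the same integral for -1 < s < 0 and the partial fraction expansion of
  1 / (1 - exp (-t)) (Titchmarsh's proof).
\<close>

section \<open>Meromorphic continuation from half planes\<close>

text \<open>Outside the half plane of definition, \<open>mgamma\<close> and \<open>Zprod\<close> are
  known only as normalised continuations. Their value at a pole is 0, so a product identity may fail
  at isolated points. Identities are therefore stated for \<open>cosparse UNIV\<close>, and a factor
  is cancelled only after it is known to be nonzero off a sparse set. Periods are appended at the
  end of the list while the extra period 2 of \<open>Zhat\<close> stands at its head, so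
  \<open>(2 # \<omega>) @ [v]\<close> is \<open>2 # (\<omega> @ [v])\<close> and every factor climbs
  by the same v. Appending v enlarges the reflection constant by v and reverses the sign of the
  exponent \<open>(-1) ^ (length \<omega> + 1)\<close>. The ladder of the reflected factor runs
  backwards in s, and the sign reversal compensates exactly for this. The period 2 is what produces
  Gamma(s/2): with no periods, \<open>Zhat\<close> becomes s (s - 1) times the completed zeta
  function, up to a constant.\<close>

lemma meromorphic_identity:
  assumes "f meromorphic_on A" "g meromorphic_on A" "open A" "connected A" "z0 \<in> A"
    and "\<exists>\<^sub>F z in at z0. f z = g z"
  shows "\<forall>\<^sub>F z in cosparse A. f z = g z"
proof -
  have "(\<lambda>z. f z - g z) meromorphic_on A"
    by (intro meromorphic_intros assms)
  from meromorphic_imp_constant_or_avoid[OF this assms(3,4), of 0]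
  show ?thesis
  proof
    assume "\<forall>\<^sub>\<approx>z\<in>A. f z - g z \<noteq> 0"
    hence "\<forall>\<^sub>F z in at z0. f z \<noteq> g z"
      using assms by (auto simp: eventually_cosparse_open_eq)
    with assms(6) show ?thesis by (simp add: frequently_def)
  qed auto
qed

text \<open>The normalisation fixes every value from the punctured neighbourhood: 0 at a pole, the
  limit elsewhere. Agreement off a sparse set therefore leaves no freedom at any point.\<close>

lemma nicely_meromorphic_eq:
  assumes f: "f nicely_meromorphic_on A" and g: "g nicely_meromorphic_on A"
    and A: "open A" "z \<in> A" and ev: "\<forall>\<^sub>F z in cosparse A. f z = g z"
  shows "f z = g z"
proof -
  have ev: "\<forall>\<^sub>F w in at z. f w = g w" using ev A by (auto simp: eventually_cosparse_open_eq)
  have pole: "is_pole f z \<longleftrightarrow> is_pole g z" by (rule is_pole_cong[OF ev]) simp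
  show ?thesis
  proof (cases "is_pole f z")
    case True
    have "\<not> (f \<midarrow>z\<rightarrow> f z)" "\<not> (g \<midarrow>z\<rightarrow> g z)"
      using True pole is_pole_def not_tendsto_and_filterlim_at_infinity trivial_limit_at by metis+
    thus ?thesis using f g A unfolding nicely_meromorphic_on_def by metis
  next
    case False
    hence "f \<midarrow>z\<rightarrow> f z" "g \<midarrow>z\<rightarrow> g z"
      using f g A pole unfolding nicely_meromorphic_on_def by blast+
    moreover from this(1) have "g \<midarrow>z\<rightarrow> f z" using tendsto_cong[OF ev] by blast
    ultimately show ?thesis by (metis LIM_unique)
  qed
qed

lemma nicely_meromorphic_unique:
  assumes "f nicely_meromorphic_on A" "g nicely_meromorphic_on A" "open A" "connected A"
    and "open B" "B \<noteq> {}" "B \<subseteq> A" "\<And>z. z \<in> B \<Longrightarrow> f z = g z" "z \<in> A"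
  shows "f z = g z"
proof -
  obtain z0 where z0: "z0 \<in> B" using assms(6) by blast
  have "\<forall>\<^sub>F z in at z0. z \<in> B" using assms z0 by (intro eventually_at_in_open') auto
  hence "\<forall>\<^sub>F z in at z0. f z = g z" by eventually_elim (use assms in auto)
  hence "\<exists>\<^sub>F z in at z0. f z = g z" by (intro eventually_frequently) auto
  hence "\<forall>\<^sub>F z in cosparse A. f z = g z"
    using assms z0 by (intro meromorphic_identity[of _ _ _ z0]) (auto simp: nicely_meromorphic_on_def)
  thus ?thesis using nicely_meromorphic_eq[OF assms(1,2,3)] assms(9) by blast
qed

text \<open>Evaluates the definite description in \<open>mero_cont\<close>: an open nonempty set
  determines a normalised meromorphic function on the connected plane.\<close>

lemma mero_cont_eqI:
  assumes "g nicely_meromorphic_on UNIV" "\<And>z. z \<in> A \<Longrightarrow> g z = f z" "open A" "A \<noteq> {}"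
  shows "mero_cont f A = g"
  unfolding mero_cont_def
proof (rule the_equality)
  fix h assume h: "h nicely_meromorphic_on UNIV \<and> (\<forall>z\<in>A. h z = f z)"
  show "h = g"
  proof
    fix z show "h z = g z"
      by (rule nicely_meromorphic_unique[of h UNIV g A]) (use assms h in auto)
  qed
qed (use assms in auto)

lemma mero_cont_props:
  assumes "\<exists>g. g nicely_meromorphic_on UNIV \<and> (\<forall>z\<in>A. g z = f z)" "open A" "A \<noteq> {}"
  shows "mero_cont f A nicely_meromorphic_on UNIV" "\<And>z. z \<in> A \<Longrightarrow> mero_cont f A z = f z"
proof -
  obtain g where g: "g nicely_meromorphic_on UNIV" "\<And>z. z \<in> A \<Longrightarrow> g z = f z" using assms by blast
  have "mero_cont f A = g" by (rule mero_cont_eqI) (use g assms in auto)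
  thus "mero_cont f A nicely_meromorphic_on UNIV" "\<And>z. z \<in> A \<Longrightarrow> mero_cont f A z = f z"
    using g by auto
qed

lemma mero_cont_cong:
  assumes "\<And>z. z \<in> A \<Longrightarrow> f z = g z"
  shows "mero_cont f A = mero_cont g A"
  unfolding mero_cont_def using assms by (auto cong: conj_cong)

lemma open_Re_gt: "open {z. Re z > a}"
  by (rule open_halfspace_Re_gt)

lemma connected_Re_gt: "connected {z. Re z > a}"
  by (intro convex_connected convex_halfspace_Re_gt)

lemma ex_Re_gt: "\<exists>z. Re z > a"
  by (intro exI[of _ "of_real (a + 1)"]) simp

lemma Re_gt_nonempty: "{z. Re z > a} \<noteq> {}"
  using ex_Re_gt by auto

text \<open>The continuations to the various half planes may come from unrelated formulas. Removing
  their singularities makes them agree exactly on overlaps, and holomorphy of f keeps the original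
  values intact, so they can be glued pointwise.\<close>

lemma meromorphic_glue:
  assumes hol: "f holomorphic_on {z. Re z > a}"
    and ex: "\<And>N::nat. \<exists>g. g meromorphic_on {z. Re z > a - real N} \<and> (\<forall>z. Re z > a \<longrightarrow> g z = f z)"
  shows "\<exists>g. g nicely_meromorphic_on UNIV \<and> (\<forall>z\<in>{z. Re z > a}. g z = f z)"
proof -
  define D where "D = (\<lambda>N::nat. {z. Re z > a - real N})"
  have oD: "open (D N)" for N unfolding D_def by (rule open_Re_gt)
  obtain g0 where g0: "\<And>N. g0 N meromorphic_on D N" "\<And>N z. Re z > a \<Longrightarrow> g0 N z = f z"
    using ex unfolding D_def by metis
  define g where "g = (\<lambda>N. remove_sings (g0 N))"
  have gn: "g N nicely_meromorphic_on D N" for N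
    unfolding g_def by (intro remove_sings_nicely_meromorphic g0)
  have gf: "g N z = f z" if "Re z > a" for N z
  proof -
    have "f analytic_on {z}"
      using hol that by (metis analytic_on_open analytic_on_subset empty_subsetI insert_subset mem_Collect_eq open_Re_gt)
    moreover have "\<forall>\<^sub>F w in nhds z. g0 N w = f w"
      using that by (intro eventually_mono[OF eventually_nhds_in_open[OF open_Re_gt[of a]]]) (auto simp: g0)
    ultimately have "g0 N analytic_on {z}" using analytic_at_cong by metis
    thus ?thesis using g0 that by (simp add: g_def)
  qed
  have agree: "g N z = g M z" if "z \<in> D N" "N \<le> M" for N M z
  proof (rule nicely_meromorphic_unique[of "g N" "D N" "g M" "{z. Re z > a}"])
    show "g M nicely_meromorphic_on D N"
      by (rule nicely_meromorphic_on_subset[OF gn[of M]]) (use that in \<open>auto simp: D_def\<close>)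
    show "{z. a < Re z} \<subseteq> D N" by (auto simp: D_def)
  qed (use that gn gf oD connected_Re_gt Re_gt_nonempty open_Re_gt in \<open>auto simp: D_def\<close>)
  \<comment> \<open>A half plane containing z, chosen as a function of z alone.\<close>
  define K where "K = (\<lambda>z. nat \<lceil>a - Re z\<rceil> + 1)"
  have K: "z \<in> D (K z)" for z
    unfolding D_def K_def by simp linarith
  define G where "G = (\<lambda>z. g (K z) z)"
  have G: "G z = g N z" if "z \<in> D N" for z N
    using agree[of z N "K z"] agree[of z "K z" N] K[of z] that unfolding G_def
    by (metis linorder_linear)
  have nice: "(\<lambda>z. G z) meromorphic_on {z} \<and> (is_pole G z \<and> G z = 0 \<or> G \<midarrow>z\<rightarrow> G z)" for z
  proof -
    let ?N = "K z"
    have ev: "\<forall>\<^sub>F w in at z. G w = g ?N w"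
      using eventually_at_in_open'[OF oD K[of z]] by eventually_elim (rule G)
    have "g ?N meromorphic_on {z}"
      using gn[of ?N] K[of z] unfolding nicely_meromorphic_on_def by (meson meromorphic_on_subset empty_subsetI insert_subset)
    hence "G meromorphic_on {z}" using ev
      by (subst meromorphic_on_cong[of "{z}" G "g ?N" "{z}"]) auto
    moreover have "is_pole (g ?N) z \<and> g ?N z = 0 \<or> (g ?N) \<midarrow>z\<rightarrow> g ?N z"
      using gn[of ?N] K[of z] unfolding nicely_meromorphic_on_def by blast
    hence "is_pole G z \<and> G z = 0 \<or> G \<midarrow>z\<rightarrow> G z"
      using is_pole_cong[OF ev refl] tendsto_cong[OF ev] G[OF K[of z]] by simp
    ultimately show ?thesis by simp
  qed
  have "G nicely_meromorphic_on UNIV"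
    unfolding nicely_meromorphic_on_def
    using nice meromorphic_on_meromorphic_at[of G UNIV] by auto
  moreover have "\<forall>z\<in>{z. Re z > a}. G z = f z"
    using gf unfolding G_def by simp
  ultimately show ?thesis by blast
qed

lemma meromorphic_on_shift:
  assumes "f meromorphic_on UNIV"
  shows "(\<lambda>z. f (z + c)) meromorphic_on A" "(\<lambda>z. f (c - z)) meromorphic_on A"
        "(\<lambda>z. f (z - c)) meromorphic_on A"
  by (rule meromorphic_on_compose[OF assms], auto intro!: analytic_intros)+

text \<open>Iterating the relation expresses f by finitely many values of h and one value of f far
  to the right. Since Re w is positive, enough steps cross any distance.\<close>

lemma meromorphic_ladder:
  assumes hol: "f holomorphic_on {z. Re z > a}" and h: "h meromorphic_on UNIV" and w: "Re w > 0"
    and eq: "\<And>z. Re z > a \<Longrightarrow> f z = h z * f (z + w)"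
  shows "\<exists>g. g nicely_meromorphic_on UNIV \<and> (\<forall>z\<in>{z. Re z > a}. g z = f z)"
proof (rule meromorphic_glue[OF hol])
  fix N :: nat
  obtain K :: nat where K: "real K * Re w > real N"
    using w ex_less_of_nat_mult[of "Re w" "real N"] by auto
  \<comment> \<open>For Re z > a - N the last argument has real part above a, because
    \<open>K * Re w\<close> exceeds N.\<close>
  define g where "g = (\<lambda>z. (\<Prod>k<K. h (z + of_nat k * w)) * f (z + of_nat K * w))"
  have "(\<lambda>z. f (z + of_nat K * w)) holomorphic_on {z. Re z > a - real N}"
    by (rule holomorphic_on_compose_gen[OF _ hol, unfolded o_def])
       (use K in \<open>auto intro!: holomorphic_intros\<close>)
  hence "g meromorphic_on {z. Re z > a - real N}"
    unfolding g_def
    by (intro meromorphic_intros meromorphic_on_shift h analytic_on_imp_meromorphic_on)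
       (simp add: analytic_on_open open_Re_gt)
  moreover have "f z = (\<Prod>k<n. h (z + of_nat k * w)) * f (z + of_nat n * w)" if "Re z > a" for z n
  proof (induction n)
    case (Suc n)
    have "Re (z + of_nat n * w) > a" 
      using that w mult_nonneg_nonneg[of "real n" "Re w"] by (simp; linarith)
    from eq[OF this] show ?case using Suc by (simp add: algebra_simps)
  qed auto
  ultimately show "\<exists>g. g meromorphic_on {z. Re z > a - real N} \<and> (\<forall>z. Re z > a \<longrightarrow> g z = f z)"
    unfolding g_def by (metis (no_types, lifting))
qed

text \<open>Translations and reflections are injective and continuous, so they carry punctured
  neighbourhoods into punctured neighbourhoods.\<close>

lemma eventually_cosparse_shift:
  fixes c :: complex
  assumes "\<forall>\<^sub>F s in cosparse UNIV. P s"
  shows "\<forall>\<^sub>F s in cosparse UNIV. P (s + c)" "\<forall>\<^sub>F s in cosparse UNIV. P (c - s)"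
        "\<forall>\<^sub>F s in cosparse UNIV. P (s - c)"
proof -
  have *: "\<forall>\<^sub>F s in cosparse UNIV. P (h s)" if "inj h" "continuous_on UNIV h" for h :: "complex \<Rightarrow> complex"
  proof -
    have "\<forall>\<^sub>F s in at z. P (h s)" for z
    proof -
      have "filterlim h (at (h z)) (at z)"
      proof (rule filterlim_atI)
        show "h \<midarrow>z\<rightarrow> h z"
          using that by (simp add: continuous_on_eq_continuous_at isCont_def)
        show "\<forall>\<^sub>F x in at z. h x \<noteq> h z"
          using that(1) by (auto simp: eventually_at_filter inj_eq)
      qed
      moreover have "\<forall>\<^sub>F s in at (h z). P s" using assms by (auto simp: eventually_cosparse_open_eq)
      ultimately show ?thesis by (auto simp: filterlim_iff)
    qed
    thus ?thesis by (auto simp: eventually_cosparse_open_eq)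
  qed
  show "\<forall>\<^sub>F s in cosparse UNIV. P (s + c)" "\<forall>\<^sub>F s in cosparse UNIV. P (c - s)" "\<forall>\<^sub>F s in cosparse UNIV. P (s - c)"
    by (rule *; auto simp: inj_def intro!: continuous_intros)+
qed

text \<open>Reduces nonvanishing to a region where the function is an exponential or a product close
  to 1.\<close>

lemma nonzero_cosparse:
  assumes "f meromorphic_on UNIV" "open A" "z0 \<in> A" "\<And>z. z \<in> A \<Longrightarrow> f z \<noteq> 0"
  shows "\<forall>\<^sub>F z in cosparse UNIV. f z \<noteq> 0"
  using meromorphic_imp_constant_or_avoid[OF assms(1), of 0]
proof
  assume "\<forall>\<^sub>\<approx>z. f z = 0"
  hence "\<forall>\<^sub>F z in at z0. f z = 0" by (auto simp: eventually_cosparse_open_eq)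
  moreover have "\<forall>\<^sub>F z in at z0. z \<in> A" using assms by (intro eventually_at_in_open')
  ultimately have "\<forall>\<^sub>F z in at z0. False" by eventually_elim (use assms in auto)
  thus ?thesis by simp
qed auto

lemma eq_cosparse:
  assumes "f meromorphic_on UNIV" "g meromorphic_on UNIV" "\<And>z. Re z > a \<Longrightarrow> f z = g z"
  shows "\<forall>\<^sub>F z in cosparse UNIV. f z = g z"
proof (rule meromorphic_identity[of _ _ _ "of_real (a+1)"])
  have "\<forall>\<^sub>F z in at (of_real (a+1)). z \<in> {z. Re z > a}"
    by (rule eventually_at_in_open'[OF open_Re_gt]) auto
  hence "\<forall>\<^sub>F z in at (of_real (a+1)). f z = g z" by eventually_elim (use assms in auto)
  thus "\<exists>\<^sub>F z in at (of_real (a+1)). f z = g z" by (intro eventually_frequently) auto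
qed (use assms in auto)

section \<open>Mellin integrals\<close>

text \<open>Differentiation under the integral sign without a bound on the derivative: Cauchy's
  estimate turns the local majorant of f into one for the difference quotients, and dominated
  convergence applies.\<close>

lemma holomorphic_lebesgue_integral:
  fixes f :: "complex \<Rightarrow> 'a \<Rightarrow> complex"
  assumes S: "open S"
    and hol: "\<And>t. t \<in> space M \<Longrightarrow> (\<lambda>z. f z t) holomorphic_on S"
    and meas: "\<And>z. z \<in> S \<Longrightarrow> f z \<in> borel_measurable M"
    and dom: "\<And>z0. z0 \<in> S \<Longrightarrow> \<exists>d>0. \<exists>g. ball z0 d \<subseteq> S \<and> integrable M g \<and>
                (\<forall>z\<in>ball z0 d. \<forall>t\<in>space M. norm (f z t) \<le> g t)"
  shows "(\<lambda>z. \<integral>t. f z t \<partial>M) holomorphic_on S"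
proof -
  have int: "integrable M (f z)" if z: "z \<in> S" for z
  proof -
    obtain d g where "d > 0" "integrable M g" "\<forall>z\<in>ball z d. \<forall>t\<in>space M. norm (f z t) \<le> g t"
      using dom[OF z] by blast
    thus ?thesis
      by (intro Bochner_Integration.integrable_bound[OF _ meas[OF z], of g]) (auto intro!: AE_I2 order.trans[OF _ abs_ge_self])
  qed
  have "\<exists>D. ((\<lambda>z. \<integral>t. f z t \<partial>M) has_field_derivative D) (at z0)" if z0: "z0 \<in> S" for z0
  proof -
    obtain d g where d: "d > 0" "ball z0 d \<subseteq> S" and g: "integrable M g"
      and bd: "\<And>z t. z \<in> ball z0 d \<Longrightarrow> t \<in> space M \<Longrightarrow> norm (f z t) \<le> g t"
      using dom[OF z0] by blast
    define D where "D = (\<integral>t. deriv (\<lambda>z. f z t) z0 \<partial>M)"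
    have der: "((\<lambda>z. f z t) has_field_derivative deriv (\<lambda>z. f z t) z) (at z)"
      if "t \<in> space M" "z \<in> S" for t z
      using hol[OF that(1)] S that(2) by (meson DERIV_deriv_iff_field_differentiable holomorphic_on_imp_differentiable_at)
    \<comment> \<open>A disc of radius d/4 around a point within d/2 of z0 stays inside the ball
      where g dominates; Cauchy's estimate on it gives the factor 4/d.\<close>
    have Lip: "norm (f z t - f z0 t) \<le> (4 * g t / d) * norm (z - z0)"
      if "t \<in> space M" "z \<in> ball z0 (d/2)" for t z
    proof (rule field_differentiable_bound[of "ball z0 (d/2)" "\<lambda>z. f z t" "\<lambda>z. deriv (\<lambda>z. f z t) z"])
      fix w assume w: "w \<in> ball z0 (d/2)"
      have sub: "cball w (d/4) \<subseteq> ball z0 d"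
      proof
        fix x assume "x \<in> cball w (d/4)"
        thus "x \<in> ball z0 d" using w d dist_triangle[of z0 x w] by simp
      qed
      have "w \<in> cball w (d/4)" using d by simp
      hence "w \<in> S" using sub d by blast
      show "((\<lambda>z. f z t) has_field_derivative deriv (\<lambda>z. f z t) w) (at w within ball z0 (d/2))"
        using der[OF \<open>t \<in> space M\<close> \<open>w \<in> S\<close>] by (rule has_field_derivative_at_within)
      have hol': "(\<lambda>z. f z t) holomorphic_on cball w (d/4)"
        using hol[OF \<open>t \<in> space M\<close>] sub d by (meson holomorphic_on_subset order.trans)
      have "norm ((deriv ^^ 1) (\<lambda>z. f z t) w) \<le> fact 1 * g t / (d/4)^1"
      proof (rule Cauchy_inequality)
        show "(\<lambda>z. f z t) holomorphic_on ball w (d/4)"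
          using hol' by (rule holomorphic_on_subset) auto
        show "continuous_on (cball w (d/4)) (\<lambda>z. f z t)"
          using hol' by (rule holomorphic_on_imp_continuous_on)
        show "norm (f x t) \<le> g t" if "norm (w - x) = d / 4" for x
          using that sub \<open>t \<in> space M\<close> by (intro bd) (auto simp: dist_norm)
      qed (use d in auto)
      thus "norm (deriv (\<lambda>z. f z t) w) \<le> 4 * g t / d" by (simp add: mult.commute)
    qed (use that d in auto)
    \<comment> \<open>Dominated convergence works along sequences, so the limit is tested on
      sequences tending to z0; dropping the first n0 terms puts them into the smaller ball.\<close>
    have "((\<lambda>z. ((\<integral>t. f z t \<partial>M) - (\<integral>t. f z0 t \<partial>M)) / (z - z0)) \<longlongrightarrow> D) (at z0)"
      unfolding tendsto_at_iff_sequentially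
    proof (intro allI impI)
      fix X :: "nat \<Rightarrow> complex" assume X: "\<forall>i. X i \<in> UNIV - {z0}" "X \<longlonglongrightarrow> z0"
      have "\<forall>\<^sub>F n in sequentially. X n \<in> ball z0 (d/2)"
        using topological_tendstoD[OF X(2), of "ball z0 (d/2)"] d by simp
      then obtain n0 where n0: "\<And>n. n \<ge> n0 \<Longrightarrow> X n \<in> ball z0 (d/2)"
        by (auto simp: eventually_sequentially)
      define Y where "Y = (\<lambda>n. X (n + n0))"
      have Y: "Y n \<noteq> z0" "Y n \<in> ball z0 (d/2)" "Y n \<in> S" for n
        using X(1) n0[of "n + n0"] d by (auto simp: Y_def)
      have "Y \<longlonglongrightarrow> z0" unfolding Y_def using X(2) by (rule LIMSEQ_ignore_initial_segment)
      hence Yf: "filterlim Y (at z0) sequentially"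
        using Y by (intro filterlim_atI) auto
      let ?q = "\<lambda>n t. (f (Y n) t - f z0 t) / (Y n - z0)"
      have lim: "(\<lambda>n. ?q n t) \<longlonglongrightarrow> deriv (\<lambda>z. f z t) z0" if "t \<in> space M" for t
        using filterlim_compose[OF der[OF that z0, unfolded has_field_derivative_iff] Yf] .
      have mq: "?q n \<in> borel_measurable M" for n
        using meas[OF z0] meas[OF Y(3)] by (intro borel_measurable_divide borel_measurable_diff) auto
      have "(\<lambda>n. \<integral>t. ?q n t \<partial>M) \<longlonglongrightarrow> D"
        unfolding D_def
      proof (rule integral_dominated_convergence[where w = "\<lambda>t. 4 * g t / d"])
        show "(\<lambda>t. deriv (\<lambda>z. f z t) z0) \<in> borel_measurable M"
          by (rule borel_measurable_LIMSEQ_metric[where f = ?q]) (use mq lim in auto)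
        show "integrable M (\<lambda>t. 4 * g t / d)" using g by simp
        show "AE t in M. norm (?q n t) \<le> 4 * g t / d" for n
        proof (rule AE_I2)
          fix t assume t: "t \<in> space M"
          show "norm (?q n t) \<le> 4 * g t / d"
            using Lip[OF t Y(2)[of n]] Y(1)[of n] d by (simp add: norm_divide divide_simps)
        qed
      qed (use lim mq in auto)
      moreover have "(\<lambda>n. \<integral>t. ?q n t \<partial>M) = (\<lambda>n. ((\<integral>t. f (Y n) t \<partial>M) - (\<integral>t. f z0 t \<partial>M)) / (Y n - z0))"
        using int[OF z0] int[OF Y(3)] by (intro ext) simp
      ultimately have "(\<lambda>n. ((\<integral>t. f (X (n + n0)) t \<partial>M) - (\<integral>t. f z0 t \<partial>M)) / (X (n + n0) - z0)) \<longlonglongrightarrow> D"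
        unfolding Y_def by argo
      thus "((\<lambda>z. ((\<integral>t. f z t \<partial>M) - (\<integral>t. f z0 t \<partial>M)) / (z - z0)) \<circ> X) \<longlonglongrightarrow> D"
        unfolding o_def by (rule LIMSEQ_offset)
    qed
    thus ?thesis unfolding has_field_derivative_iff by blast
  qed
  thus ?thesis unfolding holomorphic_on_def field_differentiable_def
    using has_field_derivative_at_within by blast
qed

section \<open>Integrals over the positive half line\<close>

text \<open>Restricting the space instead of the integrand makes t > 0 available at every point of
  the space, as pointwise domination requires.\<close>

abbreviation pos_lborel :: "real measure" where
  "pos_lborel \<equiv> restrict_space lborel {0<..}"

lemma space_pos_lborel [simp]: "space pos_lborel = {0<..}"
  by (simp add: space_restrict_space)

lemma measurable_pos_lborel: "f \<in> borel_measurable borel \<Longrightarrow> f \<in> borel_measurable pos_lborel"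
  by (rule measurable_restrict_space1) simp

lemma integrable_pos_lborel_iff:
  fixes f :: "real \<Rightarrow> 'a::{banach,second_countable_topology}"
  shows "integrable pos_lborel f \<longleftrightarrow> integrable lborel (\<lambda>t. indicator {0<..} t *\<^sub>R f t)"
  by (simp add: integrable_restrict_space)

lemma integral_pos_lborel:
  fixes f :: "real \<Rightarrow> 'a::{banach,second_countable_topology}"
  shows "(\<integral>t. f t \<partial>pos_lborel) = (\<integral>t. indicator {0<..} t *\<^sub>R f t \<partial>lborel)"
  by (simp add: integral_restrict_space)

lemma pos_lborel_scale:
  fixes f :: "real \<Rightarrow> 'a::{banach,second_countable_topology}"
  assumes c: "c > 0" and int: "integrable pos_lborel f"
  shows "integrable pos_lborel (\<lambda>t. f (c * t))"
        "(\<integral>t. f (c * t) \<partial>pos_lborel) = (\<integral>t. f t \<partial>pos_lborel) /\<^sub>R c"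
proof -
  have ind: "indicator {0<..} (c * t) = (indicator {0<..} t :: real)" for t
    using c by (simp add: indicator_def zero_less_mult_iff)
  show "integrable pos_lborel (\<lambda>t. f (c * t))"
    using lborel_integrable_real_affine[of "\<lambda>t. indicator {0<..} t *\<^sub>R f t" c 0] int c
    by (simp add: integrable_pos_lborel_iff ind)
  show "(\<integral>t. f (c * t) \<partial>pos_lborel) = (\<integral>t. f t \<partial>pos_lborel) /\<^sub>R c"
    using lborel_integral_real_affine[of c "\<lambda>t. indicator {0<..} t *\<^sub>R f t" 0] c
    by (simp add: integral_pos_lborel ind)
qed

lemma Gamma_integral_pos_1:
  assumes "Re u > 0"
  shows "integrable pos_lborel (\<lambda>t. of_real t powr (u - 1) * exp (- of_real t))"
        "(\<integral>t. of_real t powr (u - 1) * exp (- of_real t) \<partial>pos_lborel) = Gamma u"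
proof -
  let ?f = "\<lambda>t. of_real t powr (u - 1) * exp (- complex_of_real t)"
  have eq: "?f t = of_real t powr (u - 1) / of_real (exp t)" for t
    by (simp add: exp_minus field_simps flip: exp_of_real)
  have "integrable lebesgue (\<lambda>t. indicator {0<..} t *\<^sub>R ?f t)"
    using absolutely_integrable_Gamma_integral'[OF assms] unfolding set_integrable_def eq .
  hence int: "integrable lborel (\<lambda>t. indicator {0<..} t *\<^sub>R ?f t)"
    by (subst (asm) integrable_completion) measurable
  thus "integrable pos_lborel ?f" by (simp add: integrable_pos_lborel_iff)
  have "(LINT t:{0<..}|lborel. ?f t) = integral {0<..} ?f"
    by (rule set_borel_integral_eq_integral) (use int in \<open>simp add: set_integrable_def\<close>)
  also have "\<dots> = Gamma u"
    using Gamma_integral_complex'[OF assms] unfolding eq by (rule integral_unique)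
  finally show "(\<integral>t. ?f t \<partial>pos_lborel) = Gamma u"
    by (simp add: integral_pos_lborel set_lebesgue_integral_def)
qed

lemma integrable_powr_exp:
  assumes "c > 0" "x > 0"
  shows "integrable pos_lborel (\<lambda>t. t powr (c - 1) * exp (- x * t))"
proof -
  have "integrable pos_lborel (\<lambda>t. norm (of_real t powr (of_real c - 1) * exp (- complex_of_real t)))"
    by (intro integrable_norm Gamma_integral_pos_1) (use assms in auto)
  also have "?this \<longleftrightarrow> integrable pos_lborel (\<lambda>t. t powr (c - 1) * exp (- t))"
    by (rule Bochner_Integration.integrable_cong) (auto simp: norm_mult norm_powr_real_powr)
  finally have "integrable pos_lborel (\<lambda>t. (x * t) powr (c - 1) * exp (- (x * t)))"
    by (rule pos_lborel_scale[OF assms(2)])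
  also have "?this \<longleftrightarrow> integrable pos_lborel (\<lambda>t. x powr (c - 1) * (t powr (c - 1) * exp (- x * t)))"
    using assms by (intro Bochner_Integration.integrable_cong) (auto simp: powr_mult)
  finally show ?thesis using assms by simp
qed

text \<open>Bounds a whole interval of exponents by its two ends: the lower end wins for t up to 1,
  the upper end beyond. This makes the Mellin majorants uniform in u.\<close>

lemma powr_le_sum:
  fixes t a b c :: real
  assumes "t > 0" "a \<le> b" "b \<le> c"
  shows "t powr b \<le> t powr a + t powr c"
proof (cases "t \<le> 1")
  case True
  hence "t powr b \<le> t powr a" using assms by (intro powr_mono') auto
  thus ?thesis by (simp add: add_increasing2)
next
  case False
  hence "t powr b \<le> t powr c" using assms by (intro powr_mono) auto
  thus ?thesis by (simp add: add_increasing)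
qed

text \<open>The exponent a describes h near 0 and so determines the half plane Re u > -a. The
  exponent b describes growth at infinity, which the exponential absorbs.\<close>

locale mellin =
  fixes h :: "real \<Rightarrow> complex" and a b C :: real
  assumes meas [measurable]: "h \<in> borel_measurable borel"
    and ab: "a \<le> b"
    and bound: "\<And>t. t > 0 \<Longrightarrow> norm (h t) \<le> C * (t powr a + t powr b)"
begin

definition M :: "complex \<Rightarrow> complex \<Rightarrow> complex" where
  "M u z = (\<integral>t. of_real t powr (u - 1) * h t * exp (- z * of_real t) \<partial>pos_lborel)"

lemma C_nonneg: "C \<ge> 0"
proof -
  have "C * 2 \<ge> 0" using bound[of 1] norm_ge_zero[of "h 1"] by (simp del: norm_ge_zero)
  thus ?thesis by simp
qed

text \<open>A single majorant for u in a vertical strip and z in a half plane, so that it serves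
  holomorphy in either variable.\<close>

lemma dominated:
  assumes "p > - a" "p \<le> q" "x > 0"
  obtains g where "integrable pos_lborel g"
    "\<And>u z t. t > 0 \<Longrightarrow> p \<le> Re u \<Longrightarrow> Re u \<le> q \<Longrightarrow> Re z \<ge> x \<Longrightarrow>
       norm (of_real t powr (u - 1) * h t * exp (- z * of_real t)) \<le> g t"
proof
  let ?g = "\<lambda>t. 2 * C * (t powr ((p + a) - 1) * exp (- x * t) + t powr ((q + b) - 1) * exp (- x * t))"
  show "integrable pos_lborel ?g"
    by (intro integrable_mult_right Bochner_Integration.integrable_add integrable_powr_exp) (use assms ab in auto)
  fix u z :: complex and t :: real assume *: "t > 0" "p \<le> Re u" "Re u \<le> q" "Re z \<ge> x"
  have "norm (of_real t powr (u - 1) * h t * exp (- z * of_real t)) =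
          t powr (Re u - 1) * norm (h t) * exp (- (Re z * t))"
    using * by (simp add: norm_mult norm_powr_real_powr)
  also have "\<dots> \<le> t powr (Re u - 1) * (C * (t powr a + t powr b)) * exp (- (x * t))"
    using * C_nonneg by (intro mult_mono bound) auto
  also have "\<dots> = C * (t powr (Re u + a - 1) + t powr (Re u + b - 1)) * exp (- (x * t))"
    using * by (simp add: algebra_simps powr_add powr_diff)
  also have "\<dots> \<le> C * ((t powr (p + a - 1) + t powr (q + b - 1)) + (t powr (p + a - 1) + t powr (q + b - 1))) * exp (- (x * t))"
    using * C_nonneg ab by (intro mult_left_mono mult_right_mono add_mono powr_le_sum) auto
  also have "\<dots> = ?g t" by (simp add: algebra_simps)
  finally show "norm (of_real t powr (u - 1) * h t * exp (- z * of_real t)) \<le> ?g t" .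
qed

lemma integrable:
  assumes "Re u > - a" "Re z > 0"
  shows "integrable pos_lborel (\<lambda>t. of_real t powr (u - 1) * h t * exp (- z * of_real t))"
proof -
  obtain g where g: "integrable pos_lborel g"
    "\<And>t. t > 0 \<Longrightarrow> norm (of_real t powr (u - 1) * h t * exp (- z * of_real t)) \<le> g t"
    by (rule dominated[of "Re u" "Re u" "Re z"]) (use assms in auto)
  show ?thesis
    by (rule Bochner_Integration.integrable_bound[OF g(1)])
       (use g(2) in \<open>auto intro!: AE_I2 order.trans[OF _ abs_ge_self] measurable_pos_lborel\<close>)
qed

lemma holomorphic_u:
  assumes z: "Re z > 0"
  shows "(\<lambda>u. M u z) holomorphic_on {u. Re u > - a}"
  unfolding M_def
proof (rule holomorphic_lebesgue_integral)
  show "(\<lambda>u. of_real t powr (u - 1) * h t * exp (- z * of_real t)) holomorphic_on {u. Re u > - a}"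
    if "t \<in> space pos_lborel" for t
    using that by (intro holomorphic_intros) auto
  fix u0 assume u0: "u0 \<in> {u. Re u > - a}"
  define d where "d = (Re u0 + a) / 2"
  have d: "d > 0" using u0 by (simp add: d_def)
  obtain g where g: "integrable pos_lborel g"
    "\<And>u z' t. t > 0 \<Longrightarrow> Re u0 - d \<le> Re u \<Longrightarrow> Re u \<le> Re u0 + d \<Longrightarrow> Re z' \<ge> Re z \<Longrightarrow>
       norm (of_real t powr (u - 1) * h t * exp (- z' * of_real t)) \<le> g t"
    by (rule dominated[of "Re u0 - d" "Re u0 + d" "Re z"]) (use d z in \<open>auto simp: d_def field_simps\<close>)
  have ball: "Re u0 - d \<le> Re u \<and> Re u \<le> Re u0 + d" if "u \<in> ball u0 d" for u
    using that abs_Re_le_cmod[of "u0 - u"] by (auto simp: dist_norm)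
  have "ball u0 d \<subseteq> {u. Re u > - a}"
    using ball d by (force simp: d_def field_simps)
  thus "\<exists>d>0. \<exists>g. ball u0 d \<subseteq> {u. - a < Re u} \<and> Bochner_Integration.integrable pos_lborel g \<and>
     (\<forall>u\<in>ball u0 d. \<forall>t\<in>space pos_lborel. norm (of_real t powr (u - 1) * h t * exp (- z * of_real t)) \<le> g t)"
    using d g ball by (intro exI[of _ d] conjI exI[of _ g]) auto
qed (auto intro!: measurable_pos_lborel open_Re_gt)

lemma holomorphic_z:
  assumes u: "Re u > - a"
  shows "(\<lambda>z. M u z) holomorphic_on {z. Re z > 0}"
  unfolding M_def
proof (rule holomorphic_lebesgue_integral)
  fix z0 :: complex assume z0: "z0 \<in> {z. Re z > 0}"
  define d where "d = Re z0 / 2"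
  have d: "d > 0" using z0 by (simp add: d_def)
  obtain g where g: "integrable pos_lborel g"
    "\<And>z t. t > 0 \<Longrightarrow> Re z \<ge> d \<Longrightarrow>
       norm (of_real t powr (u - 1) * h t * exp (- z * of_real t)) \<le> g t"
    by (rule dominated[of "Re u" "Re u" d]) (use d u in auto)
  have ball: "Re z \<ge> d" if "z \<in> ball z0 d" for z
    using that abs_Re_le_cmod[of "z0 - z"] by (auto simp: dist_norm d_def field_simps)
  have "ball z0 d \<subseteq> {z. Re z > 0}"
    using ball d by force
  thus "\<exists>d>0. \<exists>g. ball z0 d \<subseteq> {z. 0 < Re z} \<and> Bochner_Integration.integrable pos_lborel g \<and>
     (\<forall>z\<in>ball z0 d. \<forall>t\<in>space pos_lborel. norm (of_real t powr (u - 1) * h t * exp (- z * of_real t)) \<le> g t)"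
    using d g ball by (intro exI[of _ d] conjI exI[of _ g]) auto
qed (auto intro!: measurable_pos_lborel open_Re_gt holomorphic_intros)

end

text \<open>Scaling proves it for real z. Both sides are holomorphic in the right half plane, so the
  identity theorem gives complex z without moving a contour.\<close>

lemma Gamma_integral_pos:
  assumes u: "Re u > 0" and z: "Re z > 0"
  shows "integrable pos_lborel (\<lambda>t. of_real t powr (u - 1) * exp (- z * of_real t))"
        "(\<integral>t. of_real t powr (u - 1) * exp (- z * of_real t) \<partial>pos_lborel) = Gamma u * z powr (- u)"
proof -
  interpret mellin "\<lambda>_. 1" 0 0 1 by unfold_locales auto
  show "integrable pos_lborel (\<lambda>t. of_real t powr (u - 1) * exp (- z * of_real t))"
    using integrable[of u z] u z by simp
  have real: "M u (of_real x) = Gamma u * of_real x powr (- u)" if x: "x > 0" for x :: real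
  proof -
    let ?f = "\<lambda>t. of_real t powr (u - 1) * exp (- complex_of_real t)"
    have "(\<integral>t. ?f (x * t) \<partial>pos_lborel) = Gamma u /\<^sub>R x"
      using pos_lborel_scale(2)[OF x Gamma_integral_pos_1(1)[OF u]] Gamma_integral_pos_1(2)[OF u] by simp
    also have "(\<integral>t. ?f (x * t) \<partial>pos_lborel) =
        (\<integral>t. of_real x powr (u - 1) * (of_real t powr (u - 1) * exp (- of_real x * of_real t)) \<partial>pos_lborel)"
      using x by (intro Bochner_Integration.integral_cong) (auto simp: powr_times_real mult_ac)
    also have "\<dots> = of_real x powr (u - 1) * M u (of_real x)"
      unfolding M_def by (subst integral_mult_right_zero) simp
    finally show ?thesis using x
      by (simp add: powr_diff powr_minus field_simps scaleR_conv_of_real)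
  qed
  have "M u z - Gamma u * z powr (- u) = 0"
  proof (rule analytic_continuation[of "\<lambda>z. M u z - Gamma u * z powr (- u)" "{z. Re z > 0}"])
    show "(\<lambda>z. M u z - Gamma u * z powr (- u)) holomorphic_on {z. Re z > 0}"
      using u by (intro holomorphic_intros holomorphic_z) (auto simp: complex_nonpos_Reals_iff)
    show "complex_of_real 1 islimpt of_real ` {0<..}"
    proof -
      have "(1::real) islimpt {0<..}" by (rule open_imp_islimpt) auto
      thus ?thesis by (rule islimpt_isCont_image) (auto simp: eventually_at_filter)
    qed
  qed (use z real in \<open>auto simp: open_Re_gt connected_Re_gt\<close>)
  thus "(\<integral>t. of_real t powr (u - 1) * exp (- z * of_real t) \<partial>pos_lborel) = Gamma u * z powr (- u)"
    by (simp add: M_def)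
qed

section \<open>The Barnes zeta function\<close>

definition nlists :: "nat \<Rightarrow> nat list set" where "nlists m = {n. length n = m}"

lemma countable_nlists: "countable (nlists m)"
  by (rule countableI_type)

lemma nlists_0 [simp]: "nlists 0 = {[]}"
  by (auto simp: nlists_def)

lemma bij_nlists_Suc: "bij_betw (\<lambda>(k,n). k # n) (UNIV \<times> nlists m) (nlists (Suc m))"
  by (rule bij_betwI[where g = "\<lambda>n. (hd n, tl n)"])
     (auto simp: nlists_def length_Suc_conv)

lemma lin_Nil [simp]: "lin n [] = 0"
  by (simp add: lin_def)

lemma lin_Cons [simp]: "lin (k # n) (w # \<omega>) = of_nat k * w + lin n \<omega>"
  by (simp add: lin_def sum.lessThan_Suc_shift del: sum.lessThan_Suc)

lemma Re_lin_nonneg: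
  assumes "\<forall>w\<in>set \<omega>. Re w > 0"
  shows "Re (lin n \<omega>) \<ge> 0"
  unfolding lin_def Re_sum using assms by (intro sum_nonneg) (auto simp: less_imp_le)

text \<open>The exponential of \<open>lin\<close> factors over the periods, so the multiple series
  is a product of geometric series.\<close>

lemma geometric_nlists:
  assumes "\<forall>w\<in>set \<omega>. Re w > 0" "t > 0"
  shows "Infinite_Set_Sum.abs_summable_on (\<lambda>n. exp (- lin n \<omega> * of_real t)) (nlists (length \<omega>)) \<and>
     infsetsum (\<lambda>n. exp (- lin n \<omega> * of_real t)) (nlists (length \<omega>)) =
       (\<Prod>w\<leftarrow>\<omega>. 1 / (1 - exp (- w * of_real t)))"
  using assms(1)
proof (induction \<omega>)
  case Nil
  show ?case by simp
next
  case (Cons w \<omega>)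
  let ?e = "exp (- w * of_real t)"
  let ?f = "\<lambda>n. exp (- lin n \<omega> * of_real t)"
  have "norm ?e < 1" using Cons.prems assms(2) by simp
  hence s: "summable (\<lambda>k. norm (?e ^ k))" and S: "(\<lambda>k. ?e ^ k) sums (1 / (1 - ?e))"
    using geometric_sums[of ?e] by (simp_all add: norm_power summable_geometric)
  have e: "Infinite_Set_Sum.abs_summable_on (\<lambda>k. ?e ^ k) UNIV" "infsetsum (\<lambda>k. ?e ^ k) UNIV = 1 / (1 - ?e)"
  proof -
    show *: "Infinite_Set_Sum.abs_summable_on (\<lambda>k. ?e ^ k) UNIV" using s by (simp only: abs_summable_on_nat_iff')
    show "infsetsum (\<lambda>k. ?e ^ k) UNIV = 1 / (1 - ?e)"
      using infsetsum_nat'[OF *] sums_unique[OF S] by simp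
  qed
  have IH: "Infinite_Set_Sum.abs_summable_on ?f (nlists (length \<omega>))"
     "infsetsum ?f (nlists (length \<omega>)) = (\<Prod>w\<leftarrow>\<omega>. 1 / (1 - exp (- w * of_real t)))"
    using Cons by auto
  have eq: "exp (- lin (case kn of (k, n) \<Rightarrow> k # n) (w # \<omega>) * of_real t) = (case kn of (k, n) \<Rightarrow> ?e ^ k * ?f n)" for kn
    by (cases kn) (simp add: exp_of_nat_mult[symmetric] exp_add[symmetric] algebra_simps)
  note P = abs_summable_on_product[OF _ countable_nlists e(1) IH(1)]
    infsetsum_product[OF _ countable_nlists e(1) IH(1)]
  show ?case
    using abs_summable_on_reindex_bij_betw[OF bij_nlists_Suc, of "\<lambda>n. exp (- lin n (w # \<omega>) * of_real t)" "length \<omega>"]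
      infsetsum_reindex_bij_betw[OF bij_nlists_Suc, of "\<lambda>n. exp (- lin n (w # \<omega>) * of_real t)" "length \<omega>"] P e(2) IH(2)
    unfolding eq by simp
qed

section \<open>Taylor remainders of the Bernoulli generating function\<close>

text \<open>The generating function of the multiple Bernoulli polynomials without its factor exp(-z
  t). One power of t per period cancels the poles at 0.\<close>

definition bprod :: "complex list \<Rightarrow> real \<Rightarrow> complex" where
  "bprod \<omega> t = (\<Prod>w\<leftarrow>\<omega>. of_real t / (1 - exp (- w * of_real t)))"

lemma bprod_Nil [simp]: "bprod [] t = 1"
  by (simp add: bprod_def)

lemma bprod_altdef: "bprod \<omega> t = of_real t ^ length \<omega> * (\<Prod>w\<leftarrow>\<omega>. 1 / (1 - exp (- w * of_real t)))"
  unfolding bprod_def by (induction \<omega>) auto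

lemma borel_measurable_bprod [measurable]: "bprod \<omega> \<in> borel_measurable borel"
proof (induction \<omega>)
  case (Cons w \<omega>)
  have "bprod (w # \<omega>) = (\<lambda>t. of_real t / (1 - exp (- w * of_real t)) * bprod \<omega> t)"
    by (auto simp: bprod_def)
  moreover have "(\<lambda>t::real. of_real t / (1 - exp (- w * of_real t))) \<in> borel_measurable borel"
    by measurable
  ultimately show ?case using Cons by simp
qed (simp add: bprod_def)

text \<open>Dividing by t repeatedly, instead of using a power series, keeps the remainder
  holomorphic on all of S and not merely on a disc about 0.\<close>

lemma taylor_quotient:
  assumes "f holomorphic_on S" "open S" "(0::complex) \<in> S"
  shows "\<exists>p q. q holomorphic_on S \<and> (\<forall>t\<in>S. f t = (\<Sum>j<N. p j * t ^ j) + t ^ N * q t)"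
proof (induction N)
  case 0
  show ?case using assms by (intro exI[of _ "\<lambda>_. 0"] exI[of _ f]) auto
next
  case (Suc N)
  then obtain p q where pq: "q holomorphic_on S" "\<And>t. t \<in> S \<Longrightarrow> f t = (\<Sum>j<N. p j * t ^ j) + t ^ N * q t"
    by blast
  define q' where "q' = (\<lambda>t. if t = 0 then deriv q 0 else (q t - q 0) / (t - 0))"
  have "q' holomorphic_on S" unfolding q'_def by (rule pole_lemma_open) fact+
  moreover have qt: "q t = q 0 + t * q' t" for t by (simp add: q'_def)
  have "f t = (\<Sum>j<Suc N. (p(N := q 0)) j * t ^ j) + t ^ Suc N * q' t" if "t \<in> S" for t
  proof -
    have "(\<Sum>j<N. (p(N := q 0)) j * t ^ j) = (\<Sum>j<N. p j * t ^ j)" by (intro sum.cong) auto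
    moreover have "f t = (\<Sum>j<N. p j * t ^ j) + t ^ N * (q 0 + t * q' t)"
      using pq(2)[OF that] qt[of t] by simp
    ultimately show ?thesis by (simp add: algebra_simps)
  qed
  ultimately show ?case by (intro exI[of _ "p(N := q 0)"] exI[of _ q']) auto
qed

text \<open>For t at least 1 every denominator has modulus at least 1 - exp(-Re w), leaving one
  factor t per period.\<close>

lemma bprod_bound_large:
  assumes "\<forall>w\<in>set \<omega>. Re w > 0"
  shows "\<exists>C\<ge>0. \<forall>t\<ge>1. norm (bprod \<omega> t) \<le> C * t ^ length \<omega>"
  using assms
proof (induction \<omega>)
  case Nil
  show ?case by (intro exI[of _ 1]) auto
next
  case (Cons w \<omega>)
  then obtain C where C: "C \<ge> 0" "\<And>t. t \<ge> 1 \<Longrightarrow> norm (bprod \<omega> t) \<le> C * t ^ length \<omega>" by auto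
  define c where "c = 1 - exp (- Re w)"
  have w: "Re w > 0" using Cons.prems by simp
  have c: "c > 0" using w by (simp add: c_def)
  show ?case
  proof (intro exI[of _ "C / c"] conjI allI impI)
    fix t :: real assume t: "t \<ge> 1"
    have "c \<le> 1 - exp (- Re w * t)"
      using t w by (simp add: c_def mult_le_cancel_left1)
    also have "\<dots> = norm (1::complex) - norm (exp (- w * of_real t))" by simp
    also have "\<dots> \<le> norm (1 - exp (- w * of_real t))" by (rule norm_triangle_ineq2)
    finally have "norm (of_real t / (1 - exp (- w * of_real t))) \<le> t / c"
      using t c by (simp add: norm_divide frac_le)
    hence "norm (bprod (w # \<omega>) t) \<le> (t / c) * (C * t ^ length \<omega>)"
      using C(1) C(2)[OF t] t c
      unfolding bprod_def list.map prod_list.Cons norm_mult by (intro mult_mono) auto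
    thus "norm (bprod (w # \<omega>) t) \<le> C / c * t ^ length (w # \<omega>)"
      by (simp add: field_simps)
  qed (use C c in auto)
qed

text \<open>Up to t = 1 the Taylor remainder supplies the power N. Beyond 1 the product and the
  polynomial are bounded separately by the larger power. The sum of the two powers is the form that
  \<open>mellin\<close> expects.\<close>

lemma bprod_expansion:
  assumes \<omega>: "\<forall>w\<in>set \<omega>. Re w > 0"
  shows "\<exists>p C. \<forall>t>0. norm (bprod \<omega> t - (\<Sum>j<N. p j * of_real t ^ j)) \<le>
           C * (t powr real N + t powr real (N + length \<omega>))"
proof -
  \<comment> \<open>The entire function (1 - exp(-w t)) / t with its removable value at 0;
    \<open>bprod\<close> is the product of the reciprocals.\<close>
  define k where "k = (\<lambda>w t::complex. if t = 0 then w else (1 - exp (- w * t)) / t)"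
  have hk: "k w holomorphic_on UNIV" for w
  proof -
    have "(\<lambda>t. if t = 0 then deriv (\<lambda>t. - exp (- w * t)) 0 else (- exp (- w * t) - (- exp (- w * 0))) / (t - 0)) holomorphic_on UNIV"
      by (rule pole_lemma_open) (auto intro!: holomorphic_intros)
    also have "deriv (\<lambda>t. - exp (- w * t)) 0 = w"
      by (rule DERIV_imp_deriv) (auto intro!: derivative_eq_intros)
    finally show ?thesis unfolding k_def by (rule holomorphic_transform) auto
  qed
  \<comment> \<open>An open set on which all reciprocals are holomorphic. It contains the closed
    positive ray, since exp(-w t) has modulus below 1 for t > 0.\<close>
  define S where "S = {t. \<forall>w\<in>set \<omega>. k w t \<noteq> 0}"
  have "S = (\<Inter>w\<in>set \<omega>. k w -` (- {0}))" by (auto simp: S_def)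
  also have "open \<dots>"
    by (intro open_INT ballI open_vimage holomorphic_on_imp_continuous_on hk) auto
  finally have S: "open S" .
  have inS: "of_real t \<in> S" if "t \<ge> 0" for t
    unfolding S_def
  proof (intro CollectI ballI)
    fix w assume w: "w \<in> set \<omega>"
    show "k w (of_real t) \<noteq> 0"
    proof (cases "t = 0")
      case True thus ?thesis using \<omega> w by (auto simp: k_def)
    next
      case False
      hence "norm (exp (- w * of_real t)) < 1" using \<omega> w that by auto
      hence "exp (- w * of_real t) \<noteq> 1" by (metis less_irrefl norm_one)
      thus ?thesis using False by (simp add: k_def)
    qed
  qed
  define F where "F = (\<lambda>t. \<Prod>w\<leftarrow>\<omega>. 1 / k w t)"
  have "(\<lambda>t. \<Prod>w\<leftarrow>ws. 1 / k w t) holomorphic_on S" if "set ws \<subseteq> set \<omega>" for ws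
    using that
  proof (induction ws)
    case (Cons w ws)
    have "(\<lambda>t. 1 / k w t) holomorphic_on S"
      using Cons.prems by (intro holomorphic_intros holomorphic_on_subset[OF hk]) (auto simp: S_def)
    from holomorphic_on_mult[OF this Cons.IH] show ?case using Cons.prems by simp
  qed auto
  hence hF: "F holomorphic_on S" unfolding F_def by simp
  have F: "bprod \<omega> t = F (of_real t)" if "t > 0" for t
    using that unfolding bprod_def F_def k_def by (intro arg_cong[where f = prod_list] map_cong) auto
  obtain p q where q: "q holomorphic_on S"
    and pq: "\<And>t. t \<in> S \<Longrightarrow> F t = (\<Sum>j<N. p j * t ^ j) + t ^ N * q t"
    using taylor_quotient[OF hF S, of N] inS[of 0] by (metis of_real_0 order.refl)
  have "continuous_on (of_real ` {0..1}) q"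
    using q inS by (intro holomorphic_on_imp_continuous_on) (auto intro: holomorphic_on_subset)
  hence "compact (q ` of_real ` {0..1::real})"
    by (intro compact_continuous_image) (auto intro!: compact_continuous_image continuous_intros)
  then obtain C1 where C1: "\<And>t. t \<in> {0..1::real} \<Longrightarrow> norm (q (of_real t)) \<le> C1"
    using compact_imp_bounded bounded_iff by (metis imageI)
  have C1n: "C1 \<ge> 0" using C1[of 0] norm_ge_zero[of "q (of_real 0)"] by (simp del: norm_ge_zero)
  obtain C2 where C2: "C2 \<ge> 0" "\<And>t. t \<ge> 1 \<Longrightarrow> norm (bprod \<omega> t) \<le> C2 * t ^ length \<omega>"
    using bprod_bound_large[OF \<omega>] by blast
  define C3 where "C3 = (\<Sum>j<N. norm (p j))"
  have C3: "C3 \<ge> 0" unfolding C3_def by (intro sum_nonneg) auto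
  show ?thesis
  proof (intro exI[of _ p] exI[of _ "C1 + C2 + C3"] allI impI)
    fix t :: real assume t: "t > 0"
    let ?X = "bprod \<omega> t - (\<Sum>j<N. p j * of_real t ^ j)"
    show "norm ?X \<le> (C1 + C2 + C3) * (t powr real N + t powr real (N + length \<omega>))"
    proof (cases "t \<le> 1")
      case True
      have "norm ?X = t ^ N * norm (q (of_real t))"
        using F[OF t] pq[OF inS[of t]] t by (simp add: norm_mult norm_power)
      also have "\<dots> \<le> t ^ N * C1" using True t C1[of t] by (intro mult_left_mono) auto
      also have "\<dots> \<le> (C1 + C2 + C3) * (t ^ N + t ^ (N + length \<omega>))"
        using t C1n C2 C3 by (subst mult.commute) (intro mult_mono add_increasing2; simp)
      finally show ?thesis using t by (simp only: powr_realpow)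
    next
      case False
      have "norm ?X \<le> norm (bprod \<omega> t) + norm (\<Sum>j<N. p j * of_real t ^ j)" by (rule norm_triangle_ineq4)
      also have "norm (\<Sum>j<N. p j * of_real t ^ j) \<le> (\<Sum>j<N. norm (p j) * t ^ (N + length \<omega>))"
        using False by (intro sum_norm_le) (auto simp: norm_mult norm_power intro!: mult_left_mono power_increasing)
      also have "\<dots> = C3 * t ^ (N + length \<omega>)" by (simp add: C3_def sum_distrib_right)
      also have "norm (bprod \<omega> t) \<le> C2 * t ^ (N + length \<omega>)"
        using False C2(1) by (intro order.trans[OF C2(2)]) (auto intro!: mult_left_mono power_increasing)
      finally have "norm ?X \<le> (C2 + C3) * t ^ (N + length \<omega>)" by (simp add: algebra_simps)
      also have "\<dots> \<le> (C1 + C2 + C3) * (t ^ N + t ^ (N + length \<omega>))"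
        using t C1n C2 C3 by (intro mult_mono) auto
      finally show ?thesis using t by (simp only: powr_realpow)
    qed
  qed
qed

section \<open>Continuation of the Barnes zeta function in w\<close>

lemma meromorphic_Gamma: "(Gamma :: complex \<Rightarrow> complex) meromorphic_on A"
proof -
  have "(\<lambda>z. inverse (rGamma z :: complex)) meromorphic_on A"
    by (intro meromorphic_intros analytic_on_imp_meromorphic_on analytic_rGamma)
  moreover have "Gamma = (\<lambda>z. inverse (rGamma z :: complex))" by (simp add: Gamma_def fun_eq_iff)
  ultimately show ?thesis by simp
qed

text \<open>Each term is a Gamma integral, and summing the exponentials under the integral gives
  \<open>bprod\<close>. Fubini delivers the absolute summability of the series as well.\<close>

lemma barnes_sum_integral:
  assumes \<omega>: "\<forall>w\<in>set \<omega>. Re w > 0" and z: "Re z > 0" and w: "Re w > real (length \<omega>)"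
  shows "Infinite_Set_Sum.abs_summable_on (\<lambda>n. (z + lin n \<omega>) powr (- w)) (nlists (length \<omega>))"
    and "Gamma w * infsum (\<lambda>n. (z + lin n \<omega>) powr (- w)) (nlists (length \<omega>)) =
           (\<integral>t. of_real t powr (w - of_nat (length \<omega>) - 1) * bprod \<omega> t * exp (- z * of_real t) \<partial>pos_lborel)"
proof -
  let ?m = "length \<omega>" and ?A = "nlists (length \<omega>)"
  define f where "f = (\<lambda>(t::real, n). of_real t powr (w - 1) * exp (- (z + lin n \<omega>) * of_real t))"
  interpret pair_sigma_finite pos_lborel "count_space ?A"
    by (intro pair_sigma_finite.intro sigma_finite_measure_restrict_space lborel.sigma_finite_measure_axioms
          sigma_finite_measure_count_space_countable countable_nlists) auto
  have fsplit: "f (t, n) = of_real t powr (w - 1) * exp (- z * of_real t) * exp (- lin n \<omega> * of_real t)" for t n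
    by (simp add: f_def exp_add[symmetric] algebra_simps)
  have meas: "f \<in> borel_measurable (pos_lborel \<Otimes>\<^sub>M count_space ?A)"
  proof (subst measurable_pair_swap_iff, rule measurable_pair_measure_countable1[OF countable_nlists])
    fix n
    have "(\<lambda>t. f (t, n)) \<in> borel_measurable borel" unfolding f_def prod.case by measurable
    thus "(\<lambda>y. case (n, y) of (x, y) \<Rightarrow> f (y, x)) \<in> borel_measurable pos_lborel"
      by (simp add: measurable_pos_lborel)
  qed
  have powr: "of_real t powr (w - 1) * exp (- z * of_real t) * (\<Prod>w\<leftarrow>ws. 1 / (1 - exp (- w * of_real t))) =
        of_real t powr (w - of_nat (length ws) - 1) * bprod ws t * exp (- z * of_real t)" if "t > 0" for t ws z w
    using that unfolding bprod_altdef
    by (simp add: powr_diff powr_nat' powr_add field_simps)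
  \<comment> \<open>The modulus of exp(-lin n \<omega> t) is the same exponential with the real
    parts of the periods. The sum of the norms is thus again a geometric product, and its integral
    is of the kind already controlled.\<close>
  define \<omega>r where "\<omega>r = map (\<lambda>w. complex_of_real (Re w)) \<omega>"
  have \<omega>r: "\<forall>w\<in>set \<omega>r. Re w > 0" "length \<omega>r = ?m" using \<omega> by (auto simp: \<omega>r_def)
  have linr: "lin n \<omega>r = of_real (Re (lin n \<omega>))" for n
    unfolding lin_def \<omega>r_def by (simp add: Re_sum)
  have sumt: "Infinite_Set_Sum.abs_summable_on (\<lambda>n. f (t, n)) ?A"
     "infsetsum (\<lambda>n. f (t, n)) ?A = of_real t powr (w - of_nat ?m - 1) * bprod \<omega> t * exp (- z * of_real t)"
    if "t > 0" for t
    using geometric_nlists[OF \<omega> that] powr[OF that, of w z \<omega>]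
    by (auto simp: fsplit infsetsum_cmult_right intro!: abs_summable_on_cmult_right)
  have normf: "of_real (infsetsum (\<lambda>n. norm (f (t, n))) ?A) =
       of_real t powr (of_real (Re w) - of_nat ?m - 1) * bprod \<omega>r t * exp (- of_real (Re z) * of_real t)"
    if t: "t > 0" for t
  proof -
    have "complex_of_real (infsetsum (\<lambda>n. norm (f (t, n))) ?A) = infsetsum (\<lambda>n. of_real (norm (f (t, n)))) ?A"
      using sumt(1)[OF t] unfolding infsetsum_def abs_summable_on_def
      by (intro integral_of_real[symmetric] integrable_norm)
    also have "\<dots> = infsetsum (\<lambda>n. of_real t powr (of_real (Re w) - 1) * exp (- of_real (Re z) * of_real t) *
                              exp (- lin n \<omega>r * of_real t)) ?A"
    proof (intro infsetsum_cong refl)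
      fix n
      have "of_real t powr (of_real (Re w) - 1) = complex_of_real (t powr (Re w - 1))"
        using t powr_of_real[of t "Re w - 1"] by simp
      thus "complex_of_real (norm (f (t, n))) = of_real t powr (of_real (Re w) - 1) * exp (- of_real (Re z) * of_real t) *
                              exp (- lin n \<omega>r * of_real t)"
        using t by (simp add: fsplit norm_mult norm_powr_real_powr linr exp_of_real[symmetric])
    qed
    also have "\<dots> = of_real t powr (of_real (Re w) - of_nat ?m - 1) * bprod \<omega>r t * exp (- of_real (Re z) * of_real t)"
      using geometric_nlists[OF \<omega>r(1) t] powr[OF t, of "of_real (Re w)" "of_real (Re z)" \<omega>r] \<omega>r(2)
      by (simp add: infsetsum_cmult_right)
    finally show ?thesis .
  qed
  obtain p C where C: "\<And>t. t > 0 \<Longrightarrow> norm (bprod \<omega>r t) \<le> C * (t powr 0 + t powr real ?m)"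
    using bprod_expansion[OF \<omega>r(1), of 0] \<omega>r(2) by auto
  interpret r: mellin "bprod \<omega>r" 0 "real ?m" C
    by unfold_locales (use C in auto)
  have intn: "integrable pos_lborel (\<lambda>t. complex_of_real (infsetsum (\<lambda>n. norm (f (t, n))) ?A))"
  proof -
    have "integrable pos_lborel (\<lambda>t. of_real t powr ((of_real (Re w) - of_nat ?m) - 1) * bprod \<omega>r t * exp (- of_real (Re z) * of_real t))"
      by (rule r.integrable) (use w z in auto)
    thus ?thesis
      by (rule Bochner_Integration.integrable_cong[THEN iffD2, rotated -1]) (auto simp: normf)
  qed
  have int: "integrable (pos_lborel \<Otimes>\<^sub>M count_space ?A) f"
  proof (rule Fubini_integrable[OF meas])
    have "integrable pos_lborel (\<lambda>t. Re (complex_of_real (infsetsum (\<lambda>n. norm (f (t, n))) ?A)))"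
      using intn by (rule integrable_Re)
    thus "integrable pos_lborel (\<lambda>t. \<integral>n. norm (f (t, n)) \<partial>count_space ?A)"
      by (simp add: infsetsum_def)
    show "AE t in pos_lborel. integrable (count_space ?A) (\<lambda>n. f (t, n))"
      using sumt(1) by (auto simp: abs_summable_on_def intro!: AE_I2)
  qed
  have lhs: "(\<integral>t. f (t, n) \<partial>pos_lborel) = Gamma w * (z + lin n \<omega>) powr (- w)" for n
  proof -
    have "Re (z + lin n \<omega>) > 0" using z Re_lin_nonneg[OF \<omega>, of n] by simp
    moreover have "Re w > 0" using w by simp
    ultimately show ?thesis unfolding f_def using Gamma_integral_pos(2)[of w "z + lin n \<omega>"] by simp
  qed
  have G: "Gamma w \<noteq> 0" using w by (intro Gamma_nonzero) (auto elim!: nonpos_Ints_cases)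
  have "integrable (count_space ?A) (\<lambda>n. Gamma w * (z + lin n \<omega>) powr (- w))"
  proof -
    have "integrable (count_space ?A) (\<lambda>n. \<integral>t. f (t, n) \<partial>pos_lborel)"
      by (rule integrable_snd[of "curry f", simplified]) (use int in \<open>simp add: case_prod_unfold\<close>)
    thus ?thesis by (simp add: lhs)
  qed
  thus sm: "Infinite_Set_Sum.abs_summable_on (\<lambda>n. (z + lin n \<omega>) powr (- w)) ?A"
    using integrable_mult_right[of "inverse (Gamma w)"] G by (fastforce simp: abs_summable_on_def field_simps)
  have "(\<integral>n. (\<integral>t. f (t, n) \<partial>pos_lborel) \<partial>count_space ?A) = (\<integral>t. (\<integral>n. f (t, n) \<partial>count_space ?A) \<partial>pos_lborel)"
    by (rule Fubini_integral[of "curry f", simplified]) (use int in \<open>simp add: case_prod_unfold\<close>)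
  also have "(\<integral>t. (\<integral>n. f (t, n) \<partial>count_space ?A) \<partial>pos_lborel) = 
     (\<integral>t. of_real t powr (w - of_nat ?m - 1) * bprod \<omega> t * exp (- z * of_real t) \<partial>pos_lborel)"
    using sumt(2) by (intro Bochner_Integration.integral_cong) (auto simp: infsetsum_def)
  also have "(\<integral>n. (\<integral>t. f (t, n) \<partial>pos_lborel) \<partial>count_space ?A) = Gamma w * infsetsum (\<lambda>n. (z + lin n \<omega>) powr (- w)) ?A"
    using sm unfolding lhs infsetsum_def by simp
  also have "infsetsum (\<lambda>n. (z + lin n \<omega>) powr (- w)) ?A = infsum (\<lambda>n. (z + lin n \<omega>) powr (- w)) ?A"
    by (rule infsetsum_infsum[OF sm])
  finally show "Gamma w * infsum (\<lambda>n. (z + lin n \<omega>) powr (- w)) ?A =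
           (\<integral>t. of_real t powr (w - of_nat ?m - 1) * bprod \<omega> t * exp (- z * of_real t) \<partial>pos_lborel)" .
qed

text \<open>Subtracting the first terms of the Taylor expansion of \<^term>\<open>bprod \<omega>\<close> only, and keeping the
  factor exp (-z t), every subtracted term is a complete Gamma integral.\<close>
locale barnes_remainder =
  fixes \<omega> :: "complex list" and N :: nat and p :: "nat \<Rightarrow> complex" and C :: real
  assumes \<omega>: "\<forall>w\<in>set \<omega>. Re w > 0"
    and expansion: "\<And>t. t > 0 \<Longrightarrow> norm (bprod \<omega> t - (\<Sum>j<N. p j * of_real t ^ j)) \<le>
           C * (t powr real N + t powr real (N + length \<omega>))"
begin

sublocale mellin "\<lambda>t. bprod \<omega> t - (\<Sum>j<N. p j * of_real t ^ j)" "real N" "real (N + length \<omega>)" C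
proof
  show "(\<lambda>t. bprod \<omega> t - (\<Sum>j<N. p j * complex_of_real t ^ j)) \<in> borel_measurable borel"
    by measurable
qed (use expansion in auto)

text \<open>The entire function \<open>rGamma\<close> stands for the reciprocal of Gamma, so
  dividing by Gamma w introduces no singularity.\<close>

definition Zc :: "complex \<Rightarrow> complex \<Rightarrow> complex" where
  "Zc w z = rGamma w * ((\<Sum>j<N. p j * Gamma (w - of_nat (length \<omega>) + of_nat j) * z powr (- (w - of_nat (length \<omega>) + of_nat j)))
              + M (w - of_nat (length \<omega>)) z)"

text \<open>Where the series converges, the subtracted Taylor terms are put back as complete Gamma
  integrals.\<close>

lemma Zc_eq_sum:
  assumes z: "Re z > 0" and w: "Re w > real (length \<omega>)"
  shows "Zc w z = infsum (\<lambda>n. (z + lin n \<omega>) powr (- w)) (nlists (length \<omega>))"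
proof -
  let ?u = "w - of_nat (length \<omega>)" and ?h = "\<lambda>t. bprod \<omega> t - (\<Sum>j<N. p j * complex_of_real t ^ j)"
  have u: "Re ?u > 0" using w by simp
  have i1: "integrable pos_lborel (\<lambda>t. p j * (of_real t powr (?u + of_nat j - 1) * exp (- z * of_real t)))" for j
    by (intro integrable_mult_right Gamma_integral_pos(1)) (use u z in auto)
  have i2: "integrable pos_lborel (\<lambda>t. of_real t powr (?u - 1) * ?h t * exp (- z * of_real t))"
    by (rule integrable) (use u z in auto)
  have "Gamma w * infsum (\<lambda>n. (z + lin n \<omega>) powr (- w)) (nlists (length \<omega>)) =
         (\<integral>t. of_real t powr (?u - 1) * bprod \<omega> t * exp (- z * of_real t) \<partial>pos_lborel)"
    by (rule barnes_sum_integral[OF \<omega> z w])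
  also have "\<dots> = (\<integral>t. (\<Sum>j<N. p j * (of_real t powr (?u + of_nat j - 1) * exp (- z * of_real t))) +
                     of_real t powr (?u - 1) * ?h t * exp (- z * of_real t) \<partial>pos_lborel)"
  proof (intro Bochner_Integration.integral_cong refl)
    fix t assume "t \<in> space pos_lborel"
    hence t: "t > 0" by simp
    have "of_real t powr (?u + of_nat j - 1) = of_real t powr (?u - 1) * complex_of_real t ^ j" for j
    proof -
      have "?u + of_nat j - 1 = (?u - 1) + of_nat j" by simp
      thus ?thesis using t by (simp only: powr_add) (simp add: powr_nat')
    qed
    hence "(\<Sum>j<N. p j * (of_real t powr (?u + of_nat j - 1) * exp (- z * of_real t))) =
         of_real t powr (?u - 1) * exp (- z * of_real t) * (\<Sum>j<N. p j * complex_of_real t ^ j)"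
      by (simp only: sum_distrib_left) (simp add: mult_ac)
    thus "of_real t powr (?u - 1) * bprod \<omega> t * exp (- z * of_real t) = 
        (\<Sum>j<N. p j * (of_real t powr (?u + of_nat j - 1) * exp (- z * of_real t))) +
                     of_real t powr (?u - 1) * ?h t * exp (- z * of_real t)"
      by (simp only:) (simp add: algebra_simps)
  qed
  also have "\<dots> = (\<integral>t. (\<Sum>j<N. p j * (of_real t powr (?u + of_nat j - 1) * exp (- z * of_real t))) \<partial>pos_lborel) + M ?u z"
    unfolding M_def by (intro Bochner_Integration.integral_add Bochner_Integration.integrable_sum i1 i2)
  also have "(\<integral>t. (\<Sum>j<N. p j * (of_real t powr (?u + of_nat j - 1) * exp (- z * of_real t))) \<partial>pos_lborel) =
       (\<Sum>j<N. \<integral>t. p j * (of_real t powr (?u + of_nat j - 1) * exp (- z * of_real t)) \<partial>pos_lborel)"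
    by (intro Bochner_Integration.integral_sum i1)
  also have "\<dots> = (\<Sum>j<N. p j * (Gamma (?u + of_nat j) * z powr (- (?u + of_nat j))))"
    using u z by (intro sum.cong refl, subst integral_mult_right_zero, subst Gamma_integral_pos(2)) auto
  finally have *: "Gamma w * infsum (\<lambda>n. (z + lin n \<omega>) powr (- w)) (nlists (length \<omega>)) =
     (\<Sum>j<N. p j * Gamma (?u + of_nat j) * z powr (- (?u + of_nat j))) + M ?u z"
    by (simp only: mult.assoc)
  have "w \<notin> \<int>\<^sub>\<le>\<^sub>0" using w by (auto elim!: nonpos_Ints_cases)
  hence "rGamma w * Gamma w = 1" by (simp add: rGamma_inverse_Gamma Gamma_eq_zero_iff)
  thus ?thesis unfolding Zc_def *[symmetric] by (simp add: mult.assoc[symmetric])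
qed

lemma Zc_meromorphic:
  assumes z: "Re z > 0"
  shows "(\<lambda>w. Zc w z) meromorphic_on {w. Re w > real (length \<omega>) - real N}"
proof -
  have z0: "z \<noteq> 0" using z by auto
  have "(\<lambda>w. M (w - of_nat (length \<omega>)) z) holomorphic_on {w. Re w > real (length \<omega>) - real N}"
    by (rule holomorphic_on_compose_gen[OF _ holomorphic_u[OF z], unfolded o_def]) (auto intro!: holomorphic_intros)
  hence "(\<lambda>w. M (w - of_nat (length \<omega>)) z) meromorphic_on {w. Re w > real (length \<omega>) - real N}"
    by (simp add: analytic_on_imp_meromorphic_on analytic_on_open open_Re_gt)
  moreover have "(\<lambda>w. Gamma (w - of_nat (length \<omega>) + of_nat j)) meromorphic_on A" for j A
    using meromorphic_on_shift(1)[OF meromorphic_Gamma, of "of_nat j - of_nat (length \<omega>)" A]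
    by (simp add: algebra_simps)
  moreover have "(\<lambda>w. z powr (- (w - of_nat (length \<omega>) + of_nat j))) meromorphic_on A" for j A
    using z0 by (intro analytic_on_imp_meromorphic_on) (auto simp: powr_def intro!: analytic_intros)
  moreover have "rGamma meromorphic_on A" for A
    by (intro analytic_on_imp_meromorphic_on analytic_rGamma)
  ultimately show ?thesis unfolding Zc_def
    by (intro meromorphic_intros)
qed

end

lemma barnes_remainder_exists:
  assumes "\<forall>w\<in>set \<omega>. Re w > 0"
  obtains p C where "barnes_remainder \<omega> N p C"
  using bprod_expansion[OF assms, of N] assms by (auto simp: barnes_remainder_def)

lemma barnes_zeta_nlists:
  "barnes_zeta w z \<omega> = mero_cont (\<lambda>w. infsum (\<lambda>n. (z + lin n \<omega>) powr (- w)) (nlists (length \<omega>)))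
     {w. Re w > real (length \<omega>)} w"
  by (simp add: barnes_zeta_def nlists_def)

text \<open>A remainder of order N reaches N units to the left of the abscissa of convergence. Order
  0 subtracts nothing and gives holomorphy on the original half plane.\<close>

lemma barnes_zeta_continuation:
  assumes \<omega>: "\<forall>w\<in>set \<omega>. Re w > 0" and z: "Re z > 0"
  shows "(\<lambda>w. barnes_zeta w z \<omega>) nicely_meromorphic_on UNIV"
    and "\<And>w. Re w > real (length \<omega>) \<Longrightarrow>
           barnes_zeta w z \<omega> = infsum (\<lambda>n. (z + lin n \<omega>) powr (- w)) (nlists (length \<omega>))"
    and "(\<lambda>w. barnes_zeta w z \<omega>) holomorphic_on {w. Re w > real (length \<omega>)}"
proof -
  let ?f = "\<lambda>w. infsum (\<lambda>n. (z + lin n \<omega>) powr (- w)) (nlists (length \<omega>))"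
  let ?A = "{w. Re w > real (length \<omega>)}"
  have hol: "?f holomorphic_on ?A"
  proof -
    obtain p C where "barnes_remainder \<omega> 0 p C" using barnes_remainder_exists[OF \<omega>] .
    then interpret barnes_remainder \<omega> 0 p C .
    have "(\<lambda>w. M (w - of_nat (length \<omega>)) z) holomorphic_on ?A"
      by (rule holomorphic_on_compose_gen[OF _ holomorphic_u[OF z], unfolded o_def]) (auto intro!: holomorphic_intros)
    hence "(\<lambda>w. Zc w z) holomorphic_on ?A"
      unfolding Zc_def by (auto intro!: holomorphic_intros)
    thus ?thesis
      by (rule holomorphic_transform) (use z in \<open>auto simp: Zc_eq_sum\<close>)
  qed
  have "\<exists>g. g nicely_meromorphic_on UNIV \<and> (\<forall>w\<in>?A. g w = ?f w)"
  proof (rule meromorphic_glue[OF hol])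
    fix N
    obtain p C where "barnes_remainder \<omega> N p C" using barnes_remainder_exists[OF \<omega>] .
    then interpret barnes_remainder \<omega> N p C .
    show "\<exists>g. g meromorphic_on {w. Re w > real (length \<omega>) - real N} \<and> (\<forall>w. Re w > real (length \<omega>) \<longrightarrow> g w = ?f w)"
      using Zc_meromorphic[OF z] Zc_eq_sum[OF z] by blast
  qed
  note * = mero_cont_props[OF this open_Re_gt Re_gt_nonempty]
  show "(\<lambda>w. barnes_zeta w z \<omega>) nicely_meromorphic_on UNIV"
    using *(1) by (simp add: barnes_zeta_nlists[abs_def])
  show eq: "barnes_zeta w z \<omega> = ?f w" if "Re w > real (length \<omega>)" for w
    using *(2)[of w] that by (simp add: barnes_zeta_nlists)
  show "(\<lambda>w. barnes_zeta w z \<omega>) holomorphic_on ?A"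
    using hol by (rule holomorphic_transform) (simp add: eq)
qed

context barnes_remainder
begin

lemma barnes_zeta_eq_Zc:
  assumes z: "Re z > 0"
  shows "\<forall>\<^sub>F w in cosparse {w. Re w > real (length \<omega>) - real N}. barnes_zeta w z \<omega> = Zc w z"
proof (rule meromorphic_identity)
  let ?c = "of_real (real (length \<omega>) + 1) :: complex"
  show "(\<lambda>w. barnes_zeta w z \<omega>) meromorphic_on {w. Re w > real (length \<omega>) - real N}"
    using barnes_zeta_continuation(1)[OF \<omega> z] by (auto simp: nicely_meromorphic_on_def intro: meromorphic_on_subset)
  have "\<forall>\<^sub>F w in at ?c. w \<in> {w. Re w > real (length \<omega>)}"
    by (rule eventually_at_in_open'[OF open_Re_gt]) auto
  hence "\<forall>\<^sub>F w in at ?c. barnes_zeta w z \<omega> = Zc w z"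
    by eventually_elim (simp add: barnes_zeta_continuation(2)[OF \<omega> z] Zc_eq_sum[OF z])
  thus "\<exists>\<^sub>F w in at ?c. barnes_zeta w z \<omega> = Zc w z"
    by (intro eventually_frequently) auto
qed (use z in \<open>auto simp: Zc_meromorphic open_Re_gt connected_Re_gt\<close>)

text \<open>At integers the Gamma factors of \<open>Zc\<close> may sit at poles and its value there
  says nothing. A holomorphic g that agrees with it elsewhere recovers the values at integers, in
  particular at w = 0.\<close>

lemma barnes_zeta_eqI:
  assumes z: "Re z > 0" and D: "open D" "D \<subseteq> {w. Re w > real (length \<omega>) - real N}"
    and g: "g holomorphic_on D" "\<And>w. w \<in> D \<Longrightarrow> w \<notin> \<int> \<Longrightarrow> g w = Zc w z" and w: "w \<in> D"
  shows "barnes_zeta w z \<omega> = g w"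
proof (rule nicely_meromorphic_eq[OF _ _ D(1) w])
  show "(\<lambda>w. barnes_zeta w z \<omega>) nicely_meromorphic_on D"
    using barnes_zeta_continuation(1)[OF \<omega> z] by (auto intro: nicely_meromorphic_on_subset)
  show "g nicely_meromorphic_on D"
    using g D by (simp add: analytic_on_imp_nicely_meromorphic_on analytic_on_open)
  have "\<forall>\<^sub>F w in cosparse D. barnes_zeta w z \<omega> = Zc w z"
    using barnes_zeta_eq_Zc[OF z] D by (auto simp: eventually_cosparse_open_eq open_Re_gt)
  moreover have "\<forall>\<^sub>F w in cosparse D. w \<notin> \<int>"
  proof -
    have "\<int> sparse_in (UNIV :: complex set)"
      unfolding sparse_in_open[OF open_UNIV]
    proof safe
      fix z :: complex assume "z islimpt \<int>"
      hence "z islimpt \<int> - {z}" using islimpt_punctured by blast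
      moreover have "closed (\<int> - {z})" by (rule closed_subset_Ints) auto
      ultimately show False by (auto simp: closed_limpt)
    qed
    hence "\<int> sparse_in D" by (rule sparse_in_subset) auto
    thus ?thesis by (simp add: eventually_cosparse)
  qed
  moreover have "\<forall>\<^sub>F w in cosparse D. w \<in> D" by (rule eventually_in_cosparse) (use D in auto)
  ultimately show "\<forall>\<^sub>F w in cosparse D. barnes_zeta w z \<omega> = g w"
    by eventually_elim (use g in auto)
qed

end

section \<open>The Barnes zeta function near w = 0\<close>

text \<open>The rational function equal to Gamma(w - k) / Gamma(w). It is regular at w = 0, where
  both Gamma values are singular.\<close>

definition gamma_ratio :: "nat \<Rightarrow> complex \<Rightarrow> complex" where
  "gamma_ratio k w = (\<Prod>i\<in>{1..k}. 1 / (w - of_nat i))"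

lemma gamma_ratio:
  assumes "w \<notin> \<int>"
  shows "rGamma w * Gamma (w - of_nat k) = gamma_ratio k w"
proof (induction k)
  case 0
  have "w \<notin> \<int>\<^sub>\<le>\<^sub>0" using assms nonpos_Ints_Int by blast
  thus ?case by (simp add: gamma_ratio_def rGamma_inverse_Gamma Gamma_eq_zero_iff)
next
  case (Suc k)
  have ni: "w - of_nat j \<notin> \<int>" for j using assms by simp
  have "Gamma (w - of_nat (Suc k) + 1) = (w - of_nat (Suc k)) * Gamma (w - of_nat (Suc k))"
    using ni[of "Suc k"] by (intro Gamma_plus1) (auto dest: nonpos_Ints_Int)
  hence "Gamma (w - of_nat k) = (w - of_nat (Suc k)) * Gamma (w - of_nat (Suc k))" by simp
  moreover have "w - of_nat (Suc k) \<noteq> 0" using ni[of "Suc k"] Ints_0 by metis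
  ultimately have "rGamma w * Gamma (w - of_nat (Suc k)) = gamma_ratio k w / (w - of_nat (Suc k))"
    unfolding Suc[symmetric] by (simp del: of_nat_Suc)
  thus ?case by (simp add: gamma_ratio_def)
qed

lemma holomorphic_gamma_ratio: "gamma_ratio k holomorphic_on ball 0 1"
proof -
  have "w - of_nat i \<noteq> 0" if "w \<in> ball 0 1" "i \<in> {1..k}" for i and w :: complex
    using that by auto
  thus ?thesis unfolding gamma_ratio_def[abs_def] by (intro holomorphic_intros) auto
qed

text \<open>Order m + 1 is the least one whose half plane contains 0: it is Re w > -1, and so the
  unit disc lies inside.\<close>

locale barnes_at_0 = barnes_remainder \<omega> "length \<omega> + 1" p C for \<omega> p C
begin

text \<open>For j up to m the Gamma quotients are rational. As \<open>rGamma\<close> vanishes at 0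
  with derivative 1, the Mellin part contributes its value, not its derivative, to the derivative at
  0.\<close>

lemma barnes_zeta_near_0:
  assumes z: "Re z > 0"
  defines "g \<equiv> \<lambda>w. (\<Sum>j\<le>length \<omega>. p j * gamma_ratio (length \<omega> - j) w * z powr (of_nat (length \<omega> - j) - w))
             + rGamma w * M (w - of_nat (length \<omega>)) z"
  shows "g holomorphic_on ball 0 1" "\<And>w. w \<in> ball 0 1 \<Longrightarrow> barnes_zeta w z \<omega> = g w"
    and "deriv (\<lambda>w. barnes_zeta w z \<omega>) 0 =
          (\<Sum>j\<le>length \<omega>. p j * (deriv (gamma_ratio (length \<omega> - j)) 0 - gamma_ratio (length \<omega> - j) 0 * Ln z) * z ^ (length \<omega> - j))
             + M (- of_nat (length \<omega>)) z"
    and "(\<lambda>w. barnes_zeta w z \<omega>) holomorphic_on ball 0 1"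
proof -
  let ?m = "length \<omega>"
  have z0: "z \<noteq> 0" using z by auto
  have D: "ball 0 1 \<subseteq> {w. Re w > real ?m - real (?m + 1)}"
  proof
    fix w :: complex assume "w \<in> ball 0 1"
    thus "w \<in> {w. Re w > real ?m - real (?m + 1)}" using abs_Re_le_cmod[of w] by simp
  qed
  have hM: "(\<lambda>w. M (w - of_nat ?m) z) holomorphic_on ball 0 1"
    by (rule holomorphic_on_compose_gen[OF _ holomorphic_u[OF z], unfolded o_def])
       (use D in \<open>auto intro!: holomorphic_intros\<close>)
  show hg: "g holomorphic_on ball 0 1"
    unfolding g_def using z0
    by (intro holomorphic_intros hM holomorphic_gamma_ratio)
  show eq: "barnes_zeta w z \<omega> = g w" if "w \<in> ball 0 1" for w
  proof (rule barnes_zeta_eqI[OF z _ D hg _ that])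
    fix w :: complex assume w: "w \<in> ball 0 1" "w \<notin> \<int>"
    have "Zc w z = (\<Sum>j\<le>?m. p j * (rGamma w * Gamma (w - of_nat ?m + of_nat j)) * z powr (- (w - of_nat ?m + of_nat j)))
                  + rGamma w * M (w - of_nat ?m) z"
      unfolding Zc_def by (simp add: ring_distribs sum_distrib_left mult_ac lessThan_Suc_atMost)
    also have "(\<Sum>j\<le>?m. p j * (rGamma w * Gamma (w - of_nat ?m + of_nat j)) * z powr (- (w - of_nat ?m + of_nat j))) =
       (\<Sum>j\<le>?m. p j * gamma_ratio (?m - j) w * z powr (of_nat (?m - j) - w))"
    proof (intro sum.cong refl)
      fix j assume "j \<in> {..?m}"
      hence *: "w - of_nat ?m + of_nat j = w - of_nat (?m - j)" by (simp add: of_nat_diff)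
      show "p j * (rGamma w * Gamma (w - of_nat ?m + of_nat j)) * z powr (- (w - of_nat ?m + of_nat j)) =
        p j * gamma_ratio (?m - j) w * z powr (of_nat (?m - j) - w)"
        unfolding * gamma_ratio[OF w(2)] by simp
    qed
    finally show "g w = Zc w z" by (simp add: g_def)
  qed auto
  show "(\<lambda>w. barnes_zeta w z \<omega>) holomorphic_on ball 0 1"
    using hg by (rule holomorphic_transform) (simp add: eq)
  have dr: "(gamma_ratio k has_field_derivative deriv (gamma_ratio k) 0) (at 0)" for k
    by (rule holomorphic_derivI[OF holomorphic_gamma_ratio]) auto
  have dM: "((\<lambda>w. M (w - of_nat ?m) z) has_field_derivative deriv (\<lambda>w. M (w - of_nat ?m) z) 0) (at 0)"
    by (rule holomorphic_derivI[OF hM]) auto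
  have dG: "(rGamma has_field_derivative (1::complex)) (at 0)"
    using has_field_derivative_rGamma_nonpos_int[where n = 0, where ?'a = complex] by simp
  have "(g has_field_derivative
      (\<Sum>j\<le>?m. p j * (deriv (gamma_ratio (?m - j)) 0 - gamma_ratio (?m - j) 0 * Ln z) * z ^ (?m - j))
             + M (- of_nat ?m) z) (at 0)"
    unfolding g_def
  proof (intro DERIV_add DERIV_sum)
    fix j
    let ?k = "?m - j"
    have "((\<lambda>w. exp ((of_nat ?k - w) * Ln z)) has_field_derivative - Ln z * exp (of_nat ?k * Ln z)) (at 0)"
      by (rule derivative_eq_intros refl | simp)+
    hence "((\<lambda>w. z powr (of_nat ?k - w)) has_field_derivative - Ln z * z ^ ?k) (at 0)"
      using z0 by (simp add: powr_def exp_of_nat_mult del: of_nat_diff)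
    from DERIV_mult[OF DERIV_cmult[OF dr, of "p j" ?k] this]
    show "((\<lambda>w. p j * gamma_ratio ?k w * z powr (of_nat ?k - w)) has_field_derivative
             p j * (deriv (gamma_ratio ?k) 0 - gamma_ratio ?k 0 * Ln z) * z ^ ?k) (at 0)"
      using z0 by (simp add: powr_nat' algebra_simps del: of_nat_diff)
    show "((\<lambda>w. rGamma w * M (w - of_nat ?m) z) has_field_derivative M (- of_nat ?m) z) (at 0)"
      using DERIV_mult[OF dG dM] by simp
  qed
  hence "deriv g 0 = (\<Sum>j\<le>?m. p j * (deriv (gamma_ratio (?m - j)) 0 - gamma_ratio (?m - j) 0 * Ln z) * z ^ (?m - j))
             + M (- of_nat ?m) z"
    by (rule DERIV_imp_deriv)
  moreover have "deriv (\<lambda>w. barnes_zeta w z \<omega>) 0 = deriv g 0"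
  proof (rule deriv_cong_ev)
    have "\<forall>\<^sub>F w in nhds 0. w \<in> ball (0::complex) 1" by (rule eventually_nhds_in_open) auto
    thus "\<forall>\<^sub>F w in nhds 0. barnes_zeta w z \<omega> = g w" by eventually_elim (rule eq)
  qed simp
  ultimately show "deriv (\<lambda>w. barnes_zeta w z \<omega>) 0 =
          (\<Sum>j\<le>?m. p j * (deriv (gamma_ratio (?m - j)) 0 - gamma_ratio (?m - j) 0 * Ln z) * z ^ (?m - j))
             + M (- of_nat ?m) z" by simp
qed

lemma holomorphic_deriv_barnes_zeta:
  "(\<lambda>z. deriv (\<lambda>w. barnes_zeta w z \<omega>) 0) holomorphic_on {z. Re z > 0}"
proof -
  have "(\<lambda>z. (\<Sum>j\<le>length \<omega>. p j * (deriv (gamma_ratio (length \<omega> - j)) 0 - gamma_ratio (length \<omega> - j) 0 * Ln z) * z ^ (length \<omega> - j))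
             + M (- of_nat (length \<omega>)) z) holomorphic_on {z. Re z > 0}"
    by (intro holomorphic_intros holomorphic_z) (auto simp: complex_nonpos_Reals_iff)
  thus ?thesis by (rule holomorphic_transform) (simp add: barnes_zeta_near_0)
qed

end

lemma barnes_at_0_exists:
  assumes "\<forall>w\<in>set \<omega>. Re w > 0"
  obtains p C where "barnes_at_0 \<omega> p C"
  using barnes_remainder_exists[OF assms, of "length \<omega> + 1"] by (metis barnes_at_0_def)

section \<open>The multiple gamma function\<close>

lemma lin_snoc:
  assumes "length n = length \<omega>"
  shows "lin (n @ [k]) (\<omega> @ [v]) = lin n \<omega> + of_nat k * v"
  unfolding lin_def using assms by (simp add: nth_append)

text \<open>Split by the last index: zero leaves the sum over the shorter tuple, and a positive
  index lowered by one is absorbed into z as a shift by v.\<close>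

lemma barnes_sum_ladder:
  assumes \<omega>: "\<forall>w\<in>set (\<omega> @ [v]). Re w > 0" and z: "Re z > 0" and w: "Re w > real (length (\<omega> @ [v]))"
  shows "barnes_zeta w z (\<omega> @ [v]) = barnes_zeta w z \<omega> + barnes_zeta w (z + v) (\<omega> @ [v])"
proof -
  let ?m = "length \<omega>"
  let ?f = "\<lambda>n. (z + lin n (\<omega> @ [v])) powr (- w)"
  define B0 where "B0 = {n \<in> nlists (Suc ?m). last n = 0}"
  define B1 where "B1 = {n \<in> nlists (Suc ?m). last n \<noteq> 0}"
  have sm: "Infinite_Set_Sum.abs_summable_on ?f (nlists (Suc ?m))"
    using barnes_sum_integral(1)[OF \<omega> z w] by simp
  have sub: "Infinite_Set_Sum.abs_summable_on ?f B0" "Infinite_Set_Sum.abs_summable_on ?f B1"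
    by (rule abs_summable_on_subset[OF sm]; auto simp: B0_def B1_def)+
  have bij0: "bij_betw (\<lambda>n. n @ [0]) (nlists ?m) B0"
    by (rule bij_betwI[where g = butlast])
       (auto simp: B0_def nlists_def length_Suc_conv_rev)
  have bij1: "bij_betw (\<lambda>n. butlast n @ [Suc (last n)]) (nlists (Suc ?m)) B1"
    by (rule bij_betwI[where g = "\<lambda>n. butlast n @ [last n - 1]"])
       (auto simp: B1_def nlists_def length_Suc_conv_rev)
  have zv: "Re (z + v) > 0" and \<omega>': "\<forall>w\<in>set \<omega>. Re w > 0" using \<omega> z by auto
  have "barnes_zeta w z (\<omega> @ [v]) = infsetsum ?f (nlists (Suc ?m))"
    using barnes_zeta_continuation(2)[OF \<omega> z w] infsetsum_infsum[OF sm] by simp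
  also have "nlists (Suc ?m) = B0 \<union> B1" by (auto simp: B0_def B1_def)
  also have "infsetsum ?f (B0 \<union> B1) = infsetsum ?f B0 + infsetsum ?f B1"
    by (intro infsetsum_Un_disjoint sub) (auto simp: B0_def B1_def)
  also have "infsetsum ?f B0 = infsetsum (\<lambda>n. (z + lin n \<omega>) powr (- w)) (nlists ?m)"
    by (subst infsetsum_reindex_bij_betw[OF bij0, symmetric], intro infsetsum_cong)
       (auto simp: nlists_def lin_snoc)
  also have "\<dots> = barnes_zeta w z \<omega>"
    using barnes_zeta_continuation(2)[OF \<omega>' z, of w] barnes_sum_integral(1)[OF \<omega>' z, of w] w
    by (simp add: infsetsum_infsum)
  also have "infsetsum ?f B1 = infsetsum (\<lambda>n. (z + v + lin n (\<omega> @ [v])) powr (- w)) (nlists (Suc ?m))"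
  proof (subst infsetsum_reindex_bij_betw[OF bij1, symmetric], intro infsetsum_cong refl)
    fix n assume "n \<in> nlists (Suc ?m)"
    then obtain n' k where n: "n = n' @ [k]" "length n' = ?m" by (auto simp: nlists_def length_Suc_conv_rev)
    show "(z + lin (butlast n @ [Suc (last n)]) (\<omega> @ [v])) powr - w = (z + v + lin n (\<omega> @ [v])) powr - w"
      unfolding n by (simp add: lin_snoc n(2) algebra_simps)
  qed
  also have "\<dots> = barnes_zeta w (z + v) (\<omega> @ [v])"
    using barnes_zeta_continuation(2)[OF \<omega> zv w] barnes_sum_integral(1)[OF \<omega> zv w]
    by (simp add: infsetsum_infsum)
  finally show ?thesis .
qed

text \<open>The identity theorem carries the ladder of the series to w near 0. All three terms are
  holomorphic in the disc, so it holds there at every point and can be differentiated at 0.\<close>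

lemma deriv_barnes_ladder:
  assumes \<omega>: "\<forall>w\<in>set (\<omega> @ [v]). Re w > 0" and z: "Re z > 0"
  shows "deriv (\<lambda>w. barnes_zeta w z (\<omega> @ [v])) 0 =
           deriv (\<lambda>w. barnes_zeta w z \<omega>) 0 + deriv (\<lambda>w. barnes_zeta w (z + v) (\<omega> @ [v])) 0"
    and "w \<in> ball 0 1 \<Longrightarrow> barnes_zeta w z (\<omega> @ [v]) = barnes_zeta w z \<omega> + barnes_zeta w (z + v) (\<omega> @ [v])"
proof -
  have zv: "Re (z + v) > 0" and \<omega>': "\<forall>w\<in>set \<omega>. Re w > 0" using \<omega> z by auto
  have hol: "(\<lambda>w. barnes_zeta w z ws) holomorphic_on ball 0 1"
    if ws: "\<forall>w\<in>set ws. Re w > 0" and "Re z > 0" for z ws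
  proof -
    obtain p C where "barnes_at_0 ws p C" by (rule barnes_at_0_exists[OF ws])
    thus ?thesis using barnes_at_0.barnes_zeta_near_0(4) that by blast
  qed
  let ?g = "\<lambda>w. barnes_zeta w z \<omega> + barnes_zeta w (z + v) (\<omega> @ [v])"
  have "\<forall>\<^sub>F w in cosparse UNIV. barnes_zeta w z (\<omega> @ [v]) = ?g w"
    by (rule eq_cosparse[where a = "real (length (\<omega> @ [v]))"])
       (use barnes_sum_ladder[OF \<omega> z] barnes_zeta_continuation(1) \<omega> \<omega>' z zv
         in \<open>auto simp: nicely_meromorphic_on_def intro!: meromorphic_intros\<close>)
  hence "\<forall>\<^sub>F w in cosparse (ball 0 1). barnes_zeta w z (\<omega> @ [v]) = ?g w"
    by (auto simp: eventually_cosparse_open_eq)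
  moreover have "(\<lambda>w. barnes_zeta w z (\<omega> @ [v])) nicely_meromorphic_on ball 0 1" "?g nicely_meromorphic_on ball 0 1"
    by (intro analytic_on_imp_nicely_meromorphic_on analytic_intros,
        use hol[OF \<omega> z] hol[OF \<omega>' z] hol[OF \<omega> zv] in \<open>simp_all add: analytic_on_open\<close>)+
  ultimately show eq: "barnes_zeta w z (\<omega> @ [v]) = ?g w" if "w \<in> ball 0 1" for w
    using nicely_meromorphic_eq[of "\<lambda>w. barnes_zeta w z (\<omega> @ [v])" "ball 0 1" ?g w] that by simp
  have "\<forall>\<^sub>F w in nhds 0. w \<in> ball (0::complex) 1" by (rule eventually_nhds_in_open) auto
  hence "\<forall>\<^sub>F w in nhds 0. barnes_zeta w z (\<omega> @ [v]) = ?g w" by eventually_elim (rule eq)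
  hence "deriv (\<lambda>w. barnes_zeta w z (\<omega> @ [v])) 0 = deriv ?g 0" by (rule deriv_cong_ev) simp
  also have "\<dots> = deriv (\<lambda>w. barnes_zeta w z \<omega>) 0 + deriv (\<lambda>w. barnes_zeta w (z + v) (\<omega> @ [v])) 0"
    using hol[OF \<omega>' z] hol[OF \<omega> zv]
    by (intro deriv_add holomorphic_on_imp_differentiable_at[of _ "ball 0 1"]) auto
  finally show "deriv (\<lambda>w. barnes_zeta w z (\<omega> @ [v])) 0 =
           deriv (\<lambda>w. barnes_zeta w z \<omega>) 0 + deriv (\<lambda>w. barnes_zeta w (z + v) (\<omega> @ [v])) 0" .
qed

section \<open>Continuation of the multiple gamma function in z\<close>

lemma barnes_zeta_Nil:
  assumes "Re z > 0"
  shows "barnes_zeta w z [] = z powr (- w)"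
proof -
  have "mero_cont (\<lambda>w. infsum (\<lambda>n. (z + lin n []) powr (- w)) (nlists 0)) {w. Re w > 0} = (\<lambda>w. z powr (- w))"
  proof (rule mero_cont_eqI)
    show "(\<lambda>w. z powr (- w)) nicely_meromorphic_on UNIV"
    proof (intro analytic_on_imp_nicely_meromorphic_on)
      have "z \<noteq> 0" using assms by auto
      thus "(\<lambda>w. z powr (- w)) analytic_on UNIV" by (simp add: powr_def) (intro analytic_intros)
    qed
  qed (auto simp: open_Re_gt ex_Re_gt)
  from fun_cong[OF this, of w] show ?thesis by (simp add: barnes_zeta_nlists)
qed

lemma exp_deriv_barnes_zeta_Nil:
  assumes "Re z > 0"
  shows "exp (deriv (\<lambda>w. barnes_zeta w z []) 0) = inverse z"
proof -
  have "z \<noteq> 0" using assms by auto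
  have "((\<lambda>w. exp (- w * Ln z)) has_field_derivative - Ln z) (at 0)"
    by (rule derivative_eq_intros refl | simp)+
  hence "((\<lambda>w. z powr (- w)) has_field_derivative - Ln z) (at 0)"
    using \<open>z \<noteq> 0\<close> by (simp add: powr_def)
  hence "deriv (\<lambda>w. z powr (- w)) 0 = - Ln z" by (rule DERIV_imp_deriv)
  thus ?thesis using \<open>z \<noteq> 0\<close> assms by (simp add: barnes_zeta_Nil exp_minus)
qed

lemma nicely_meromorphic_inverse: "(inverse :: complex \<Rightarrow> complex) nicely_meromorphic_on UNIV"
  using analytic_on_imp_nicely_meromorphic_on[of "\<lambda>z::complex. z" UNIV]
    nicely_meromorphic_on_inverse[of "\<lambda>z. z" UNIV] by auto

lemma mgamma_Nil: "mgamma z [] = inverse z"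
proof -
  have "mero_cont (\<lambda>z. exp (deriv (\<lambda>w. barnes_zeta w z []) 0)) {z. Re z > 0} = inverse"
    by (intro mero_cont_eqI)
       (auto simp: exp_deriv_barnes_zeta_Nil nicely_meromorphic_inverse open_Re_gt ex_Re_gt)
  thus ?thesis by (simp add: mgamma_def)
qed

text \<open>On the right half plane the exponential of the derivative obeys a ladder whose
  multiplier is the gamma function of the shorter tuple. By induction that multiplier is meromorphic
  on the plane, so \<open>meromorphic_ladder\<close> applies.\<close>

lemma mgamma_continuation:
  assumes "\<forall>w\<in>set \<omega>. Re w > 0"
  shows "(\<lambda>z. mgamma z \<omega>) nicely_meromorphic_on UNIV \<and>
         (\<forall>z. Re z > 0 \<longrightarrow> mgamma z \<omega> = exp (deriv (\<lambda>w. barnes_zeta w z \<omega>) 0))"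
  using assms
proof (induction \<omega> rule: rev_induct)
  case Nil
  show ?case
    using nicely_meromorphic_inverse by (simp add: mgamma_Nil[abs_def] exp_deriv_barnes_zeta_Nil)
next
  case (snoc v \<omega>)
  let ?f = "\<lambda>z. exp (deriv (\<lambda>w. barnes_zeta w z (\<omega> @ [v])) 0)"
  obtain p C where b: "barnes_at_0 (\<omega> @ [v]) p C" using barnes_at_0_exists[OF snoc.prems] .
  have IH: "(\<lambda>z. mgamma z \<omega>) nicely_meromorphic_on UNIV"
    "\<And>z. Re z > 0 \<Longrightarrow> mgamma z \<omega> = exp (deriv (\<lambda>w. barnes_zeta w z \<omega>) 0)"
    using snoc by auto
  have "\<exists>g. g nicely_meromorphic_on UNIV \<and> (\<forall>z\<in>{z. Re z > 0}. g z = ?f z)"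
  proof (rule meromorphic_ladder)
    show "?f holomorphic_on {z. Re z > 0}"
      by (intro holomorphic_intros barnes_at_0.holomorphic_deriv_barnes_zeta[OF b])
    show "(\<lambda>z. mgamma z \<omega>) meromorphic_on UNIV" using IH by (simp add: nicely_meromorphic_on_def)
    show "?f z = mgamma z \<omega> * ?f (z + v)" if "Re z > 0" for z
      using deriv_barnes_ladder(1)[OF snoc.prems that] IH(2)[OF that] by (simp add: exp_add)
  qed (use snoc in auto)
  from mero_cont_props[OF this open_Re_gt Re_gt_nonempty] show ?case
    by (auto simp: mgamma_def[abs_def])
qed

lemma
  assumes "\<forall>w\<in>set \<omega>. Re w > 0"
  shows mgamma_meromorphic: "(\<lambda>z. mgamma z \<omega>) meromorphic_on UNIV"
    and mgamma_eq_exp: "Re z > 0 \<Longrightarrow> mgamma z \<omega> = exp (deriv (\<lambda>w. barnes_zeta w z \<omega>) 0)"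
    and mgamma_nonzero: "\<forall>\<^sub>F z in cosparse UNIV. mgamma z \<omega> \<noteq> 0"
proof -
  show 2: "mgamma z \<omega> = exp (deriv (\<lambda>w. barnes_zeta w z \<omega>) 0)" if "Re z > 0" for z
    using mgamma_continuation[OF assms] that by auto
  show 3: "(\<lambda>z. mgamma z \<omega>) meromorphic_on UNIV"
    using mgamma_continuation[OF assms] by (simp add: nicely_meromorphic_on_def)
  show "\<forall>\<^sub>F z in cosparse UNIV. mgamma z \<omega> \<noteq> 0"
    by (rule nonzero_cosparse[OF 3 open_Re_gt[of 0], of 1]) (auto simp: 2)
qed

lemma mgamma_ladder:
  assumes \<omega>: "\<forall>w\<in>set (\<omega> @ [v]). Re w > 0"
  shows "Re z > 0 \<Longrightarrow> mgamma z (\<omega> @ [v]) = mgamma z \<omega> * mgamma (z + v) (\<omega> @ [v])"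
    and "\<forall>\<^sub>F z in cosparse UNIV. mgamma z (\<omega> @ [v]) = mgamma z \<omega> * mgamma (z + v) (\<omega> @ [v])"
proof -
  have \<omega>': "\<forall>w\<in>set \<omega>. Re w > 0" using \<omega> by auto
  show 1: "mgamma z (\<omega> @ [v]) = mgamma z \<omega> * mgamma (z + v) (\<omega> @ [v])" if "Re z > 0" for z
    using deriv_barnes_ladder(1)[OF \<omega> that] that \<omega>
    by (simp add: mgamma_eq_exp[OF \<omega>] mgamma_eq_exp[OF \<omega>'] exp_add)
  show "\<forall>\<^sub>F z in cosparse UNIV. mgamma z (\<omega> @ [v]) = mgamma z \<omega> * mgamma (z + v) (\<omega> @ [v])"
    by (rule eq_cosparse[OF _ _ 1])
       (intro meromorphic_intros mgamma_meromorphic[OF \<omega>] mgamma_meromorphic[OF \<omega>']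
          meromorphic_on_shift(1)[OF mgamma_meromorphic[OF \<omega>]] | assumption)+
qed

section \<open>The functional equation of the Riemann zeta function\<close>

text \<open>The derivative of the reflection formula for \<open>rGamma\<close>. Keeping the sine as
  a factor avoids dividing by it.\<close>

lemma Digamma_reflection:
  fixes z :: complex
  assumes "z \<notin> \<int>"
  shows "sin (of_real pi * z) * (Digamma (1 - z) - Digamma z) = of_real pi * cos (of_real pi * z)"
proof -
  have nz: "z \<notin> \<int>\<^sub>\<le>\<^sub>0" "1 - z \<notin> \<int>\<^sub>\<le>\<^sub>0"
    using assms nonpos_Ints_Int[of z] nonpos_Ints_Int[of "1 - z"] Ints_diff[of 1 "1 - z"] by auto
  have d1: "(rGamma has_field_derivative - rGamma z * Digamma z) (at z)"
    by (rule has_field_derivative_rGamma_no_nonpos_int[OF nz(1)])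
  have d2: "((\<lambda>z. rGamma (1 - z)) has_field_derivative - rGamma (1 - z) * Digamma (1 - z) * (0 - 1)) (at z)"
    by (rule DERIV_chain2[where f = rGamma and g = "\<lambda>z. 1 - z", OF has_field_derivative_rGamma_no_nonpos_int[OF nz(2)]])
       (auto intro!: derivative_eq_intros)
  have "((\<lambda>z. rGamma z * rGamma (1 - z)) has_field_derivative
           rGamma z * rGamma (1 - z) * (Digamma (1 - z) - Digamma z)) (at z)"
    using DERIV_mult[OF d1 d2] by (simp add: algebra_simps)
  moreover have "(\<lambda>z. rGamma z * rGamma (1 - z)) = (\<lambda>z::complex. sin (of_real pi * z) / of_real pi)"
    by (intro ext rGamma_reflection_complex)
  ultimately have "((\<lambda>z. sin (of_real pi * z) / of_real pi) has_field_derivative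
           sin (of_real pi * z) / of_real pi * (Digamma (1 - z) - Digamma z)) (at z)"
    by (metis (no_types, lifting))
  moreover have "((\<lambda>z. sin (of_real pi * z) / of_real pi) has_field_derivative cos (of_real pi * z)) (at z)"
    by (rule derivative_eq_intros refl | simp)+
  ultimately have "sin (of_real pi * z) / of_real pi * (Digamma (1 - z) - Digamma z) = cos (of_real pi * z)"
    by (rule DERIV_unique)
  thus ?thesis by (simp add: field_simps)
qed

text \<open>1 / (1 - exp(-t)) without its principal part and constant term at 0, that is, coth(t/2)
  / 2 - 1/t.\<close>

definition bern :: "real \<Rightarrow> real" where
  "bern t = 1 / (1 - exp (- t)) - 1 / t - 1 / 2"

text \<open>Pairing the Digamma series at 1 - z and 1 + z, with z = i t / (2 pi), gives the partial
  fractions. The reflection formula evaluates the same difference, its trigonometric functions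
  becoming hyperbolic.\<close>

lemma bern_sums:
  assumes t: "t > 0"
  shows "(\<lambda>n. 2 * t / (t\<^sup>2 + (2 * pi * real (Suc n))\<^sup>2)) sums bern t"
proof -
  define z where "z = \<i> * of_real (t / (2 * pi))"
  have Imz: "Im z = t / (2 * pi)" "Re z = 0" by (simp_all add: z_def)
  have z0: "z \<noteq> 0" using t by (auto simp: z_def)
  have zi: "z \<notin> \<int>"
  proof
    assume "z \<in> \<int>"
    hence "Im z = 0" by (auto elim!: Ints_cases)
    thus False using t by (simp add: Imz)
  qed
  have n1: "1 - z \<noteq> 0" "1 + z \<noteq> 0" using Imz t by (auto simp: complex_eq_iff)
  have s: "(\<lambda>k. inverse (of_nat (Suc k)) - inverse (w + of_nat k)) sums (Digamma w + euler_mascheroni)"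
    if "w \<noteq> 0" for w :: complex
    using summable_sums[OF summable_Digamma[OF that]] by (simp add: Digamma_def)
  \<comment> \<open>The regularising terms 1 / (k + 1) and Euler's constant cancel in the
    difference.\<close>
  have "(\<lambda>k. (inverse (of_nat (Suc k)) - inverse (1 - z + of_nat k)) - (inverse (of_nat (Suc k)) - inverse (1 + z + of_nat k)))
         sums ((Digamma (1 - z) + euler_mascheroni) - (Digamma (1 + z) + euler_mascheroni))"
    by (intro sums_diff s n1)
  hence 1: "(\<lambda>k. inverse (1 + z + of_nat k) - inverse (1 - z + of_nat k)) sums (Digamma (1 - z) - Digamma (1 + z))"
    by (simp add: algebra_simps)
  have D1: "Digamma (1 + z) = Digamma z + 1 / z"
    using Digamma_plus1[OF z0] by (simp add: add_ac)
  define E where "E = exp (- of_real t :: complex)"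
  have E1: "E = of_real (exp (- t))" by (simp add: E_def exp_of_real[symmetric])
  have E2: "E \<noteq> 1" using t unfolding E1 by (metis exp_less_one_iff less_irrefl neg_less_0_iff_less of_real_eq_1_iff)
  have "\<i> * (of_real pi * z) = - of_real t / 2"
    by (simp add: z_def field_simps)
  have sc: "sin (of_real pi * z) = (exp (- of_real t / 2) - exp (of_real t / 2)) / (2 * \<i>)"
           "cos (of_real pi * z) = (exp (- of_real t / 2) + exp (of_real t / 2)) / 2"
  proof -
    have *: "\<i> * (of_real pi * z) = - of_real t / 2" by fact
    show "sin (of_real pi * z) = (exp (- of_real t / 2) - exp (of_real t / 2)) / (2 * \<i>)"
      unfolding sin_exp_eq * by simp
    show "cos (of_real pi * z) = (exp (- of_real t / 2) + exp (of_real t / 2)) / 2"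
      unfolding cos_exp_eq * by simp
  qed
  have ee: "exp (- of_real t / 2) = exp (of_real t / 2) * E"
    by (simp add: E_def exp_add[symmetric])
  \<comment> \<open>The reflection formula at z after cancelling the common factor exp(t/2).\<close>
  have R: "(E - 1) * (Digamma (1 - z) - Digamma z) = \<i> * of_real pi * (E + 1)"
  proof -
    define e X where "e = exp (complex_of_real t / 2)" and "X = Digamma (1 - z) - Digamma z"
    have "(e * E - e) / (2 * \<i>) * X = of_real pi * ((e * E + e) / 2)"
      using Digamma_reflection[OF zi] unfolding sc ee e_def X_def .
    hence "2 * \<i> * ((e * E - e) / (2 * \<i>) * X) = 2 * \<i> * (of_real pi * ((e * E + e) / 2))" by (rule arg_cong)
    hence "(e * E - e) * X = \<i> * (of_real pi * (e * E + e))" by simp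
    hence "e * ((E - 1) * X) = e * (\<i> * of_real pi * (E + 1))" by (simp add: algebra_simps)
    hence "(E - 1) * X = \<i> * of_real pi * (E + 1)" by (simp add: e_def)
    thus ?thesis by (simp add: X_def)
  qed
  have 2: "Digamma (1 - z) - Digamma (1 + z) = - 2 * of_real pi * \<i> * of_real (bern t)"
  proof -
    have "Digamma (1 - z) - Digamma z = \<i> * of_real pi * (E + 1) / (E - 1)"
      using R E2 by (simp add: field_simps)
    moreover have "1 / z = - \<i> * (2 * of_real pi / of_real t)"
      using t by (simp add: z_def field_simps)
    ultimately have "Digamma (1 - z) - Digamma (1 + z) = \<i> * of_real pi * (E + 1) / (E - 1) + \<i> * (2 * of_real pi / of_real t)"
      unfolding D1 by (simp add: algebra_simps)
    also have "\<dots> = - 2 * of_real pi * \<i> * (1 / (1 - E) - 1 / of_real t - 1 / 2)"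
      using E2 t by (simp add: divide_simps) (simp add: algebra_simps)
    finally show ?thesis by (simp add: bern_def E1)
  qed
  have summand: "inverse (1 + z + of_nat k) - inverse (1 - z + of_nat k) =
       - 2 * of_real pi * \<i> * of_real (2 * t / (t\<^sup>2 + (2 * pi * real (Suc k))\<^sup>2))" for k
  proof -
    define a where "a = complex_of_real (real (Suc k))"
    have a0: "a + z \<noteq> 0" "a - z \<noteq> 0" using Imz t by (auto simp: a_def complex_eq_iff)
    have "inverse (1 + z + of_nat k) - inverse (1 - z + of_nat k) = inverse (a + z) - inverse (a - z)"
      by (simp add: a_def algebra_simps)
    also have "\<dots> = - 2 * z / ((a + z) * (a - z))" using a0 by (simp add: field_simps)
    also have "(a + z) * (a - z) = a\<^sup>2 - z\<^sup>2" by (simp add: algebra_simps power2_eq_square)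
    also have "a\<^sup>2 - z\<^sup>2 = of_real ((t\<^sup>2 + (2 * pi * real (Suc k))\<^sup>2) / (2 * pi)\<^sup>2)"
      by (simp add: a_def z_def power2_eq_square field_simps)
    also have "- 2 * z / of_real ((t\<^sup>2 + (2 * pi * real (Suc k))\<^sup>2) / (2 * pi)\<^sup>2) =
       - 2 * of_real pi * \<i> * of_real (2 * t / (t\<^sup>2 + (2 * pi * real (Suc k))\<^sup>2))"
    proof -
      have "complex_of_real (t\<^sup>2 + (2 * pi * real (Suc k))\<^sup>2) \<noteq> 0"
        using t by (subst of_real_eq_0_iff) (auto simp: sum_power2_eq_zero_iff)
      thus ?thesis by (simp add: z_def power2_eq_square field_simps)
    qed
    finally show ?thesis .
  qed
  have "(\<lambda>k. - 2 * of_real pi * \<i> * of_real (2 * t / (t\<^sup>2 + (2 * pi * real (Suc k))\<^sup>2))) sums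
          (- 2 * of_real pi * \<i> * complex_of_real (bern t))"
    using 1 unfolding 2 summand .
  hence "(\<lambda>k. complex_of_real (2 * t / (t\<^sup>2 + (2 * pi * real (Suc k))\<^sup>2))) sums complex_of_real (bern t)"
    by (subst (asm) sums_mult_iff) auto
  thus ?thesis by (subst (asm) sums_of_real_iff)
qed

lemma bern_nonneg: "t > 0 \<Longrightarrow> bern t \<ge> 0"
  using sums_le[OF _ sums_zero bern_sums] by (simp add: add_nonneg_nonneg)

text \<open>Dropping the square of t from each denominator leaves t times a multiple of the series
  of inverse squares.\<close>

lemma bern_upper: "\<exists>K. \<forall>t>0. bern t \<le> K * t"
proof -
  let ?c = "\<lambda>n. 2 / (2 * pi)\<^sup>2 * (1 / (real (Suc n))\<^sup>2)"
  have "summable ?c"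
    using inverse_squares_sums by (intro summable_mult) (auto simp: sums_iff add_ac)
  hence S: "?c sums suminf ?c" by (rule summable_sums)
  have "bern t \<le> suminf ?c * t" if t: "t > 0" for t
  proof (rule sums_le[OF _ bern_sums[OF t] sums_mult2[OF S, of t]])
    fix n
    have "2 * t / (t\<^sup>2 + (2 * pi * real (Suc n))\<^sup>2) \<le> 2 * t / (2 * pi * real (Suc n))\<^sup>2"
      using t by (intro divide_left_mono mult_pos_pos add_nonneg_pos) auto
    also have "\<dots> = ?c n * t" by (simp add: power_mult_distrib)
    finally show "2 * t / (t\<^sup>2 + (2 * pi * real (Suc n))\<^sup>2) \<le> ?c n * t" .
  qed
  thus ?thesis by blast
qed

lemma borel_measurable_bern [measurable]: "bern \<in> borel_measurable borel"
  unfolding bern_def[abs_def] by measurable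

lemma bprod_single:
  assumes "c > 0" "t > 0"
  shows "bprod [of_real c] t = of_real (1 / c + t / 2 + t * bern (c * t))"
proof -
  have "exp (- (c * t)) \<noteq> 1" using assms by simp
  hence "t / (1 - exp (- (c * t))) = 1 / c + t / 2 + t * bern (c * t)"
    using assms by (simp add: bern_def field_simps)
  moreover have "bprod [of_real c] t = of_real (t / (1 - exp (- (c * t))))"
    by (simp add: bprod_def exp_of_real[symmetric])
  ultimately show ?thesis by simp
qed

text \<open>The Taylor coefficients of t / (1 - exp(-c t)) of order 0 and 1; a remainder of order 2
  reads no others.\<close>

definition single_coeff :: "real \<Rightarrow> nat \<Rightarrow> complex" where
  "single_coeff c j = (if j = 0 then of_real (1 / c) else 1 / 2)"

lemma single_remainder:
  assumes "c > 0" "t > 0"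
  shows "bprod [of_real c] t - (\<Sum>j<2. single_coeff c j * of_real t ^ j) = of_real (t * bern (c * t))"
  unfolding bprod_single[OF assms] by (simp add: single_coeff_def numeral_2_eq_2)

text \<open>With these explicit coefficients the continuation formula for one period can be computed
  term by term, and its remainder is t times a value of \<open>bern\<close>.\<close>

lemma barnes_at_0_single:
  assumes c: "c > 0"
  shows "\<exists>C. barnes_at_0 [complex_of_real c] (single_coeff c) C"
proof -
  obtain K where K: "\<And>t. t > 0 \<Longrightarrow> bern t \<le> K * t" using bern_upper by blast
  have "K \<ge> 0" using K[of 1] bern_nonneg[of 1] by simp
  have "barnes_at_0 [complex_of_real c] (single_coeff c) (K * c)"
    unfolding barnes_at_0_def
  proof
    show "\<forall>w\<in>set [complex_of_real c]. Re w > 0" using c by simp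
    fix t :: real assume t: "t > 0"
    have "t * bern (c * t) \<le> t * (K * (c * t))" using t c K[of "c * t"] by (intro mult_left_mono) auto
    also have "\<dots> = K * c * t powr 2" using t by (simp add: power2_eq_square)
    also have "\<dots> \<le> K * c * (t powr 2 + t powr 3)" using \<open>K \<ge> 0\<close> c by (intro mult_left_mono) auto
    finally show "norm (bprod [complex_of_real c] t - (\<Sum>j<length [complex_of_real c] + 1. single_coeff c j * of_real t ^ j))
        \<le> K * c * (t powr real (length [complex_of_real c] + 1) + t powr real (length [complex_of_real c] + 1 + length [complex_of_real c]))"
      using single_remainder[OF c t] bern_nonneg[of "c * t"] t c by (simp add: numeral_2_eq_2 numeral_3_eq_3 norm_mult)
  qed
  thus ?thesis ..
qed

section \<open>The Riemann zeta function as a Barnes zeta function\<close>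

lemma zeta_series:
  assumes "Re s > 1"
  shows "summable (\<lambda>n. norm (of_nat (Suc n) powr (- s) :: complex))"
    and "infsum (\<lambda>n. (1 + lin n [1]) powr (- s)) (nlists 1) = (\<Sum>n. of_nat (Suc n) powr (- s))"
proof -
  let ?f = "\<lambda>n. (1 + lin n [1]) powr (- s)"
  have sm: "Infinite_Set_Sum.abs_summable_on ?f (nlists 1)"
    using barnes_sum_integral(1)[of "[1]" 1 s] assms by simp
  have bij: "bij_betw (\<lambda>k::nat. [k]) UNIV (nlists 1)"
    by (rule bij_betwI[where g = hd]) (auto simp: nlists_def length_Suc_conv)
  have eq: "?f [k] = of_nat (Suc k) powr (- s)" for k by simp
  have sm': "Infinite_Set_Sum.abs_summable_on (\<lambda>k. of_nat (Suc k) powr (- s) :: complex) UNIV"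
    using sm abs_summable_on_reindex_bij_betw[OF bij, of ?f] unfolding eq by simp
  thus "summable (\<lambda>n. norm (of_nat (Suc n) powr (- s) :: complex))"
    by (simp only: abs_summable_on_nat_iff')
  show "infsum ?f (nlists 1) = (\<Sum>n. of_nat (Suc n) powr (- s))"
    using infsetsum_infsum[OF sm] infsetsum_reindex_bij_betw[OF bij, of ?f] infsetsum_nat'[OF sm']
    unfolding eq by simp
qed

text \<open>Index n of the Barnes sum contributes the base n + 1, hence z = 1. Continuation and
  holomorphy of zeta are thereby inherited.\<close>

lemma rzeta_eq_barnes: "rzeta s = barnes_zeta s 1 [1]"
proof -
  have "mero_cont (\<lambda>s. \<Sum>n. of_nat (Suc n) powr (- s)) {s. Re s > 1} =
    mero_cont (\<lambda>s. infsum (\<lambda>n. (1 + lin n [1]) powr (- s)) (nlists 1)) {s. Re s > 1}"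
    by (intro mero_cont_cong) (simp add: zeta_series(2)[unfolded One_nat_def])
  thus ?thesis by (simp add: rzeta_def barnes_zeta_nlists)
qed

lemma rzeta_nicely_meromorphic: "rzeta nicely_meromorphic_on UNIV"
  using barnes_zeta_continuation(1)[of "[1]" 1] by (simp add: rzeta_eq_barnes[abs_def])

lemma rzeta_meromorphic: "rzeta meromorphic_on UNIV"
  using rzeta_nicely_meromorphic by (simp add: nicely_meromorphic_on_def)

lemma rzeta_eq_suminf:
  assumes "Re s > 1"
  shows "rzeta s = (\<Sum>n. of_nat (Suc n) powr (- s))"
  using barnes_zeta_continuation(2)[of "[1]" 1 s] zeta_series(2)[OF assms] assms
  by (simp add: rzeta_eq_barnes)

section \<open>The Mellin transform of the Bernoulli kernel\<close>

lemma integrable_pos_lborel_of_absolutely: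
  fixes f :: "real \<Rightarrow> real"
  assumes "f absolutely_integrable_on {0<..}" "f \<in> borel_measurable borel"
  shows "integrable pos_lborel f" "(\<integral>t. f t \<partial>pos_lborel) = integral {0<..} f"
proof -
  have "(\<lambda>t. indicator {0<..} t *\<^sub>R f t) \<in> borel_measurable lborel" using assms(2) by measurable
  moreover have "integrable lebesgue (\<lambda>t. indicator {0<..} t *\<^sub>R f t)"
    using assms(1) by (simp add: set_integrable_def)
  ultimately have int: "integrable lborel (\<lambda>t. indicator {0<..} t *\<^sub>R f t)"
    by (subst (asm) integrable_completion)
  thus "integrable pos_lborel f" by (simp add: integrable_pos_lborel_iff)
  have "(LINT t:{0<..}|lborel. f t) = integral {0<..} f"
    by (rule set_borel_integral_eq_integral) (use int in \<open>simp add: set_integrable_def\<close>)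
  thus "(\<integral>t. f t \<partial>pos_lborel) = integral {0<..} f"
    by (simp add: integral_pos_lborel set_lebesgue_integral_def)
qed

lemma Gamma_integral_pos_real:
  assumes a: "a > 0" and x: "x > 0"
  shows "(\<integral>t. t powr (a - 1) * exp (- x * t) \<partial>pos_lborel) = Gamma a * x powr (- a)"
proof -
  have "complex_of_real (\<integral>t. t powr (a - 1) * exp (- x * t) \<partial>pos_lborel) =
        (\<integral>t. complex_of_real (t powr (a - 1) * exp (- x * t)) \<partial>pos_lborel)"
    by (rule integral_of_real[symmetric]) (rule integrable_powr_exp[OF a x])
  also have "\<dots> = (\<integral>t. of_real t powr (of_real a - 1) * exp (- of_real x * of_real t) \<partial>pos_lborel)"
  proof (intro Bochner_Integration.integral_cong refl)
    fix t assume "t \<in> space pos_lborel"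
    thus "complex_of_real (t powr (a - 1) * exp (- x * t)) = of_real t powr (of_real a - 1) * exp (- of_real x * of_real t)"
      using powr_of_real[of t "a - 1"] by (simp add: exp_of_real[symmetric])
  qed
  also have "\<dots> = Gamma (of_real a) * of_real x powr (- of_real a)"
    by (rule Gamma_integral_pos(2)) (use a x in auto)
  also have "\<dots> = of_real (Gamma a * x powr (- a))"
    using powr_of_real[of x "- a"] x by (simp add: Gamma_complex_of_real)
  finally show ?thesis by (simp only: of_real_eq_iff)
qed

text \<open>The Gamma integral after the substitution of the square of t for the variable.\<close>

lemma gaussian_mellin:
  assumes s: "s > -1" and x: "x > 0"
  shows "integrable pos_lborel (\<lambda>t. t powr s * exp (- x * t\<^sup>2))"
    "(\<integral>t. t powr s * exp (- x * t\<^sup>2) \<partial>pos_lborel) = Gamma ((s + 1) / 2) * x powr (- ((s + 1) / 2)) / 2"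
proof -
  let ?f = "\<lambda>v. v powr ((s + 1) / 2 - 1) * exp (- x * v)"
  let ?b = "Gamma ((s + 1) / 2) * x powr (- ((s + 1) / 2))"
  have int: "integrable pos_lborel ?f" by (rule integrable_powr_exp) (use s x in auto)
  have b: "(\<integral>t. ?f t \<partial>pos_lborel) = ?b" by (rule Gamma_integral_pos_real) (use s x in auto)
  have si: "set_integrable lborel {0<..} ?f"
    using int by (simp add: integrable_pos_lborel_iff set_integrable_def)
  have ai: "?f absolutely_integrable_on {0<..}"
    using si unfolding set_integrable_def by (rule integrable_completion[THEN iffD2, rotated]) measurable
  have I: "integral {0<..} ?f = ?b"
    using set_borel_integral_eq_integral(2)[OF si] b by (simp add: integral_pos_lborel set_lebesgue_integral_def)
  have img: "(\<lambda>t::real. t\<^sup>2) ` {0<..} = {0<..}"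
  proof safe
    fix v :: real assume "v > 0"
    thus "v \<in> (\<lambda>t. t\<^sup>2) ` {0<..}" by (intro image_eqI[of _ _ "sqrt v"]) auto
  qed auto
  have "(\<lambda>t. \<bar>2 * t\<bar> * ?f (t\<^sup>2)) absolutely_integrable_on {0<..} \<and> integral {0<..} (\<lambda>t. \<bar>2 * t\<bar> * ?f (t\<^sup>2)) = ?b"
  proof (subst has_absolute_integral_change_of_variables_1'[where g = "\<lambda>t. t\<^sup>2"])
    show "((\<lambda>t. t\<^sup>2) has_field_derivative 2 * t) (at t within {0<..})" if "t \<in> {0<..}" for t :: real
      by (auto intro!: derivative_eq_intros)
    show "inj_on (\<lambda>t::real. t\<^sup>2) {0<..}" by (auto simp: inj_on_def power2_eq_iff)
  qed (use ai I img in auto)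
  moreover have eq: "\<bar>2 * t\<bar> * ?f (t\<^sup>2) = 2 * (t powr s * exp (- x * t\<^sup>2))" if "t \<in> {0<..}" for t
  proof -
    have "(t\<^sup>2) powr ((s + 1) / 2 - 1) = t powr (s - 1)"
    proof -
      have "t\<^sup>2 = t powr 2" "2 * ((s + 1) / 2 - 1) = s - 1" using that by (simp, simp add: field_simps)
      thus ?thesis by (simp only: powr_powr)
    qed
    thus ?thesis using that by (simp add: powr_diff field_simps)
  qed
  moreover have "(\<lambda>t. \<bar>2 * t\<bar> * ?f (t\<^sup>2)) absolutely_integrable_on {0<..} \<longleftrightarrow>
      (\<lambda>t. 2 * (t powr s * exp (- x * t\<^sup>2))) absolutely_integrable_on {0<..}"
    by (rule set_integrable_cong[OF refl refl]) (rule eq)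
  moreover have "integral {0<..} (\<lambda>t. \<bar>2 * t\<bar> * ?f (t\<^sup>2)) = integral {0<..} (\<lambda>t. 2 * (t powr s * exp (- x * t\<^sup>2)))"
    by (rule Henstock_Kurzweil_Integration.integral_cong) (rule eq)
  ultimately have *: "(\<lambda>t. 2 * (t powr s * exp (- x * t\<^sup>2))) absolutely_integrable_on {0<..}"
     "integral {0<..} (\<lambda>t. 2 * (t powr s * exp (- x * t\<^sup>2))) = ?b"
    by metis+
  have m: "(\<lambda>t. 2 * (t powr s * exp (- x * t\<^sup>2))) \<in> borel_measurable borel" by measurable
  from integrable_pos_lborel_of_absolutely[OF *(1) m] *(2)
  show "integrable pos_lborel (\<lambda>t. t powr s * exp (- x * t\<^sup>2))"
    "(\<integral>t. t powr s * exp (- x * t\<^sup>2) \<partial>pos_lborel) = ?b / 2" by simp_all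
qed

lemma nn_integral_pos_eq:
  fixes f :: "real \<Rightarrow> real"
  assumes "integrable pos_lborel f" "\<And>t. t > 0 \<Longrightarrow> f t \<ge> 0"
  shows "(\<integral>\<^sup>+t. ennreal (f t) \<partial>pos_lborel) = ennreal (\<integral>t. f t \<partial>pos_lborel)"
  by (rule nn_integral_eq_integral) (use assms in \<open>auto intro!: AE_I2\<close>)

lemma sigma_finite_pos_lborel: "sigma_finite_measure pos_lborel"
  by (rule sigma_finite_measure_restrict_space[OF lborel.sigma_finite_measure_axioms]) auto

text \<open>Writing \<^term>\<open>1 / (t\<^sup>2 + a\<^sup>2)\<close> as a Laplace integral and exchanging the order of
  integration leaves two Gamma integrals.\<close>
lemma nn_integral_powr_over_quadratic:
  assumes s: "-1 < s" "s < 1" and a: "a > 0"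
  shows "(\<integral>\<^sup>+t. ennreal (2 * t powr s / (t\<^sup>2 + a\<^sup>2)) \<partial>pos_lborel) =
     ennreal (Gamma ((1 + s) / 2) * Gamma ((1 - s) / 2) * a powr (s - 1))"
proof -
  interpret pair_sigma_finite pos_lborel pos_lborel
    by (intro pair_sigma_finite.intro sigma_finite_pos_lborel)
  let ?g = "\<lambda>t x. 2 * t powr s * exp (- (t\<^sup>2 + a\<^sup>2) * x)"
  have "(\<integral>\<^sup>+t. ennreal (2 * t powr s / (t\<^sup>2 + a\<^sup>2)) \<partial>pos_lborel) =
        (\<integral>\<^sup>+t. \<integral>\<^sup>+x. ennreal (?g t x) \<partial>pos_lborel \<partial>pos_lborel)"
  proof (intro nn_integral_cong)
    fix t :: real
    have q: "t\<^sup>2 + a\<^sup>2 > 0" using a by (simp add: add_nonneg_pos)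
    have "integrable pos_lborel (\<lambda>x. x powr (1 - 1) * exp (- (t\<^sup>2 + a\<^sup>2) * x))"
      by (rule integrable_powr_exp) (use q in auto)
    moreover have "integrable pos_lborel (\<lambda>x. x powr (1 - 1) * exp (- (t\<^sup>2 + a\<^sup>2) * x)) \<longleftrightarrow>
         integrable pos_lborel (\<lambda>x. exp (- (t\<^sup>2 + a\<^sup>2) * x))"
      by (rule Bochner_Integration.integrable_cong) auto
    ultimately have i: "integrable pos_lborel (\<lambda>x. exp (- (t\<^sup>2 + a\<^sup>2) * x))" by blast
    have "(\<integral>x. exp (- (t\<^sup>2 + a\<^sup>2) * x) \<partial>pos_lborel) = (\<integral>x. x powr (1 - 1) * exp (- (t\<^sup>2 + a\<^sup>2) * x) \<partial>pos_lborel)"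
      by (rule Bochner_Integration.integral_cong) auto
    also have "\<dots> = 1 / (t\<^sup>2 + a\<^sup>2)"
      by (subst Gamma_integral_pos_real) (use q in \<open>auto simp: powr_minus divide_inverse\<close>)
    finally have I: "(\<integral>x. ?g t x \<partial>pos_lborel) = 2 * t powr s / (t\<^sup>2 + a\<^sup>2)"
      by (subst integral_mult_right_zero) simp
    show "ennreal (2 * t powr s / (t\<^sup>2 + a\<^sup>2)) = (\<integral>\<^sup>+x. ennreal (?g t x) \<partial>pos_lborel)"
      unfolding I[symmetric] by (rule nn_integral_pos_eq[symmetric]) (use i in auto)
  qed
  also have "\<dots> = (\<integral>\<^sup>+x. \<integral>\<^sup>+t. ennreal (?g t x) \<partial>pos_lborel \<partial>pos_lborel)"
  proof (rule Fubini'[symmetric])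
    have "(\<lambda>(t, x). ennreal (?g t x)) \<in> borel_measurable (borel \<Otimes>\<^sub>M borel)" by measurable
    thus "(\<lambda>(t, x). ennreal (?g t x)) \<in> borel_measurable (pos_lborel \<Otimes>\<^sub>M pos_lborel)"
    proof (rule measurable_compose[rotated])
      show "(\<lambda>p. p) \<in> pos_lborel \<Otimes>\<^sub>M pos_lborel \<rightarrow>\<^sub>M borel \<Otimes>\<^sub>M borel"
        by (intro measurable_pair) (auto simp: o_def intro!: measurable_compose[OF measurable_fst] measurable_compose[OF measurable_snd] measurable_restrict_space1)
    qed
  qed
  also have "\<dots> = (\<integral>\<^sup>+x. ennreal (Gamma ((1 + s) / 2) * (x powr ((1 - s) / 2 - 1) * exp (- a\<^sup>2 * x))) \<partial>pos_lborel)"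
  proof (intro nn_integral_cong)
    fix x :: real assume "x \<in> space pos_lborel"
    hence x: "x > 0" by simp
    have eq: "?g t x = (2 * exp (- a\<^sup>2 * x)) * (t powr s * exp (- x * t\<^sup>2))" for t
      by (simp add: exp_add[symmetric] algebra_simps)
    have e: "- ((s + 1) / 2) = (1 - s) / 2 - 1" by (simp add: field_simps)
    have "(\<integral>\<^sup>+t. ennreal (?g t x) \<partial>pos_lborel) = ennreal (\<integral>t. ?g t x \<partial>pos_lborel)"
      unfolding eq using gaussian_mellin(1)[OF s(1) x] by (intro nn_integral_pos_eq) auto
    also have "(\<integral>t. ?g t x \<partial>pos_lborel) = (2 * exp (- a\<^sup>2 * x)) * (Gamma ((s + 1) / 2) * x powr (- ((s + 1) / 2)) / 2)"
      unfolding eq by (subst integral_mult_right_zero) (simp only: gaussian_mellin(2)[OF s(1) x])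
    also have "\<dots> = Gamma ((1 + s) / 2) * (x powr ((1 - s) / 2 - 1) * exp (- a\<^sup>2 * x))"
      unfolding e by (simp add: add.commute)
    finally show "(\<integral>\<^sup>+t. ennreal (?g t x) \<partial>pos_lborel) =
       ennreal (Gamma ((1 + s) / 2) * (x powr ((1 - s) / 2 - 1) * exp (- a\<^sup>2 * x)))" .
  qed
  also have "\<dots> = ennreal (\<integral>x. Gamma ((1 + s) / 2) * (x powr ((1 - s) / 2 - 1) * exp (- a\<^sup>2 * x)) \<partial>pos_lborel)"
    using s a by (intro nn_integral_pos_eq integrable_mult_right integrable_powr_exp)
      (auto intro!: mult_nonneg_nonneg less_imp_le[OF Gamma_real_pos])
  also have "(\<integral>x. Gamma ((1 + s) / 2) * (x powr ((1 - s) / 2 - 1) * exp (- a\<^sup>2 * x)) \<partial>pos_lborel) =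
     Gamma ((1 + s) / 2) * (Gamma ((1 - s) / 2) * (a\<^sup>2) powr (- ((1 - s) / 2)))"
    using s a by (subst integral_mult_right_zero, subst Gamma_integral_pos_real) auto
  also have "(a\<^sup>2) powr (- ((1 - s) / 2)) = a powr (s - 1)"
  proof -
    have "a\<^sup>2 = a powr 2" "2 * (- ((1 - s) / 2)) = s - 1" using a by (simp, simp add: field_simps)
    thus ?thesis by (simp only: powr_powr)
  qed
  finally show ?thesis by (simp only: mult.assoc)
qed

text \<open>Nonnegative terms allow the partial fraction series to be integrated term by term as an
  extended integral. For s < 0 the resulting series converges, so the transform is finite.\<close>

lemma bern_mellin:
  fixes s :: real
  assumes s: "-1 < s" "s < 0"
  defines "c \<equiv> Gamma ((1 + s) / 2) * Gamma ((1 - s) / 2) * (2 * pi) powr (s - 1)"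
  shows "(\<integral>\<^sup>+t. ennreal (t powr (s - 1) * bern t) \<partial>pos_lborel) = ennreal (c * (\<Sum>n. real (Suc n) powr (s - 1)))"
proof -
  have sm: "summable (\<lambda>n. real (Suc n) powr (s - 1))"
    using summable_real_powr_iff[of "s - 1"] s summable_Suc_iff[of "\<lambda>n. real n powr (s - 1)"] by simp
  have c: "c \<ge> 0" using s unfolding c_def by (intro mult_nonneg_nonneg less_imp_le[OF Gamma_real_pos]) auto
  have "(\<integral>\<^sup>+t. ennreal (t powr (s - 1) * bern t) \<partial>pos_lborel) =
        (\<integral>\<^sup>+t. (\<Sum>n. ennreal (2 * t powr s / (t\<^sup>2 + (2 * pi * real (Suc n))\<^sup>2))) \<partial>pos_lborel)"
  proof (intro nn_integral_cong)
    fix t :: real assume "t \<in> space pos_lborel"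
    hence t: "t > 0" by simp
    have "(\<lambda>n. t powr (s - 1) * (2 * t / (t\<^sup>2 + (2 * pi * real (Suc n))\<^sup>2))) sums (t powr (s - 1) * bern t)"
      by (intro sums_mult bern_sums t)
    also have "(\<lambda>n. t powr (s - 1) * (2 * t / (t\<^sup>2 + (2 * pi * real (Suc n))\<^sup>2))) =
               (\<lambda>n. 2 * t powr s / (t\<^sup>2 + (2 * pi * real (Suc n))\<^sup>2))"
      using t by (simp add: powr_diff mult.commute)
    finally have S: "(\<lambda>n. 2 * t powr s / (t\<^sup>2 + (2 * pi * real (Suc n))\<^sup>2)) sums (t powr (s - 1) * bern t)" .
    show "ennreal (t powr (s - 1) * bern t) = (\<Sum>n. ennreal (2 * t powr s / (t\<^sup>2 + (2 * pi * real (Suc n))\<^sup>2)))"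
      using S by (subst suminf_ennreal2) (auto simp: sums_iff add_nonneg_nonneg)
  qed
  also have "\<dots> = (\<Sum>n. \<integral>\<^sup>+t. ennreal (2 * t powr s / (t\<^sup>2 + (2 * pi * real (Suc n))\<^sup>2)) \<partial>pos_lborel)"
    by (intro nn_integral_suminf measurable_restrict_space1) measurable
  also have "\<dots> = (\<Sum>n. ennreal (c * real (Suc n) powr (s - 1)))"
  proof (intro suminf_cong)
    fix n
    have "(\<integral>\<^sup>+t. ennreal (2 * t powr s / (t\<^sup>2 + (2 * pi * real (Suc n))\<^sup>2)) \<partial>pos_lborel) =
       ennreal (Gamma ((1 + s) / 2) * Gamma ((1 - s) / 2) * (2 * pi * real (Suc n)) powr (s - 1))"
      using s by (intro nn_integral_powr_over_quadratic) auto
    also have "(2 * pi * real (Suc n)) powr (s - 1) = (2 * pi) powr (s - 1) * real (Suc n) powr (s - 1)"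
      by (rule powr_mult)
    finally show "(\<integral>\<^sup>+t. ennreal (2 * t powr s / (t\<^sup>2 + (2 * pi * real (Suc n))\<^sup>2)) \<partial>pos_lborel) =
       ennreal (c * real (Suc n) powr (s - 1))" by (simp only: c_def mult.assoc)
  qed
  also have "\<dots> = ennreal (\<Sum>n. c * real (Suc n) powr (s - 1))"
    using c sm by (intro suminf_ennreal2 summable_mult) auto
  also have "(\<Sum>n. c * real (Suc n) powr (s - 1)) = c * (\<Sum>n. real (Suc n) powr (s - 1))"
    using sm by (rule suminf_mult)
  finally show ?thesis .
qed

text \<open>For -1 < s < 0 the boundary terms in the continuation formula for the Hurwitz zeta function
  vanish as z tends to 0 from the right, which leaves the Mellin transform of \<^const>\<open>bern\<close>.\<close>
lemma Gamma_zeta_limit: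
  fixes s :: real
  assumes s: "-1 < s" "s < 0"
  shows "Gamma (of_real s) * rzeta (of_real s) =
     of_real (Gamma ((1 + s) / 2) * Gamma ((1 - s) / 2) * (2 * pi) powr (s - 1) * (\<Sum>n. real (Suc n) powr (s - 1)))"
    (is "_ = of_real ?I")
proof -
  obtain C where "barnes_at_0 [complex_of_real 1] (single_coeff 1) C" using barnes_at_0_single[of 1] by auto
  then interpret barnes_at_0 "[complex_of_real 1]" "single_coeff 1" C .
  let ?s = "complex_of_real s"
  have sI: "?s \<notin> \<int>"
  proof
    assume "?s \<in> \<int>"
    then obtain k where "?s = of_int k" by (auto elim: Ints_cases)
    hence "s = of_int k" by (metis of_real_eq_iff of_real_of_int_eq)
    thus False using s by auto
  qed
  have sn: "?s \<notin> \<int>\<^sub>\<le>\<^sub>0" using sI nonpos_Ints_Int by blast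
  have G0: "Gamma ?s \<noteq> 0" "rGamma ?s = inverse (Gamma ?s)"
    using sn by (simp_all add: Gamma_eq_zero_iff rGamma_inverse_Gamma)
  \<comment> \<open>The continuation formula of order 2 multiplied by Gamma s. Both boundary powers
    of z have positive exponents because s < 0.\<close>
  have bz: "Gamma ?s * barnes_zeta ?s z [1] = Gamma (?s - 1) * z powr (1 - ?s) + Gamma ?s / 2 * z powr (- ?s) + M (?s - 1) z"
    if z: "Re z > 0" for z
  proof -
    \<comment> \<open>This strip contains no integer, so none of the Gamma factors meets a
      pole.\<close>
    let ?D = "{w. -1 < Re w \<and> Re w < 0}"
    have z0: "z \<noteq> 0" using z by auto
    have hM: "(\<lambda>w. M (w - 1) z) holomorphic_on ?D"
      by (rule holomorphic_on_compose_gen[OF _ holomorphic_u[OF z], unfolded o_def]) (auto intro!: holomorphic_intros)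
    have ni: "w - 1 + of_nat j \<notin> \<int>\<^sub>\<le>\<^sub>0" if "w \<in> ?D" for w j
    proof
      assume "w - 1 + of_nat j \<in> \<int>\<^sub>\<le>\<^sub>0"
      then obtain k where "w - 1 + of_nat j = of_int k" by (auto elim: nonpos_Ints_cases)
      hence "w = of_int (k + 1 - int j)" by (simp add: algebra_simps)
      hence "real_of_int (-1) < real_of_int (k + 1 - int j)" "real_of_int (k + 1 - int j) < real_of_int 0"
        using that by simp_all
      hence "-1 < k + 1 - int j" "k + 1 - int j < 0" by (simp_all only: of_int_less_iff)
      thus False by simp
    qed
    have "barnes_zeta ?s z [complex_of_real 1] = Zc ?s z"
    proof (rule barnes_zeta_eqI[OF z, of ?D])
      show "open ?D" by (intro open_Collect_conj open_halfspace_Re_gt open_halfspace_Re_lt)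
      show "(\<lambda>w. Zc w z) holomorphic_on ?D"
        unfolding Zc_def using z0 ni hM
        by (intro holomorphic_intros) auto
    qed (use s in auto)
    also have "\<dots> = rGamma ?s * (Gamma (?s - 1) * z powr (1 - ?s) + Gamma ?s / 2 * z powr (- ?s) + M (?s - 1) z)"
      unfolding Zc_def by (simp add: single_coeff_def algebra_simps)
    finally show ?thesis using G0 by (simp add: field_simps)
  qed
  have Mreal: "M (?s - 1) (of_real x) = of_real (\<integral>t. t powr (s - 1) * bern t * exp (- x * t) \<partial>pos_lborel)"
     "integrable pos_lborel (\<lambda>t. t powr (s - 1) * bern t * exp (- x * t))" if x: "x > 0" for x
  proof -
    let ?f = "\<lambda>t. of_real t powr (?s - 1 - 1) * (bprod [complex_of_real 1] t - (\<Sum>j<length [complex_of_real 1] + 1. single_coeff 1 j * of_real t ^ j)) * exp (- of_real x * of_real t)"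
    have eq: "?f t = of_real (t powr (s - 1) * bern t * exp (- x * t))" if t: "t > 0" for t
    proof -
      have "of_real t powr (?s - 1 - 1) = complex_of_real (t powr (s - 1 - 1))"
        using t powr_of_real[of t "s - 1 - 1"] by simp
      moreover have "t powr (s - 1 - 1) * t = t powr (s - 1)" using t by (simp add: powr_diff power2_eq_square)
      moreover have "bprod [complex_of_real 1] t - (\<Sum>j<length [complex_of_real 1] + 1. single_coeff 1 j * of_real t ^ j) = of_real (t * bern t)"
        using single_remainder[of 1 t] t by (simp add: numeral_2_eq_2)
      ultimately show ?thesis
        by (simp only: exp_of_real of_real_mult[symmetric] of_real_minus[symmetric] mult.assoc[symmetric])
    qed
    have int: "integrable pos_lborel ?f" by (rule integrable) (use s x in auto)
    hence "integrable pos_lborel (\<lambda>t. complex_of_real (t powr (s - 1) * bern t * exp (- x * t)))"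
      by (rule Bochner_Integration.integrable_cong[THEN iffD1, rotated -1]) (rule refl, rule eq, simp)
    thus i: "integrable pos_lborel (\<lambda>t. t powr (s - 1) * bern t * exp (- x * t))"
      by (subst (asm) complex_of_real_integrable_eq)
    show "M (?s - 1) (of_real x) = of_real (\<integral>t. t powr (s - 1) * bern t * exp (- x * t) \<partial>pos_lborel)"
      unfolding M_def by (subst integral_of_real[OF i, symmetric], rule Bochner_Integration.integral_cong[OF refl], rule eq) simp
  qed
  define x where "x = (\<lambda>n. inverse (real (Suc n)))"
  have x: "x n > 0" "x \<longlonglongrightarrow> 0" "decseq x" for n
    unfolding x_def using LIMSEQ_inverse_real_of_nat by (auto simp: decseq_def frac_le field_simps)
  let ?F = "\<lambda>n t. t powr (s - 1) * bern t * exp (- x n * t)"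
  have nn: "(\<integral>\<^sup>+t. ennreal (t powr (s - 1) * bern t) \<partial>pos_lborel) = ennreal ?I"
    by (rule bern_mellin[OF s])
  have I0: "?I \<ge> 0" using s
    by (intro mult_nonneg_nonneg less_imp_le[OF Gamma_real_pos] suminf_nonneg)
       (use summable_real_powr_iff[of "s - 1"] summable_Suc_iff[of "\<lambda>n. real n powr (s - 1)"] in auto)
  have mb: "(\<lambda>t. t powr (s - 1) * bern t) \<in> borel_measurable pos_lborel"
    by (intro measurable_pos_lborel) measurable
  \<comment> \<open>Finiteness of the nonnegative integral makes the limit integrand integrable, and
    it then serves as the dominating function.\<close>
  have hb: "has_bochner_integral pos_lborel (\<lambda>t. t powr (s - 1) * bern t) ?I"
    by (rule has_bochner_integral_nn_integral[OF mb _ I0 nn]) (auto intro!: AE_I2 bern_nonneg mult_nonneg_nonneg)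
  have limM: "(\<lambda>n. M (?s - 1) (of_real (x n))) \<longlonglongrightarrow> of_real ?I"
  proof -
    have "(\<lambda>n. \<integral>t. ?F n t \<partial>pos_lborel) \<longlonglongrightarrow> (\<integral>t. t powr (s - 1) * bern t \<partial>pos_lborel)"
    proof (rule integral_dominated_convergence[where w = "\<lambda>t. t powr (s - 1) * bern t"])
      show "AE t in pos_lborel. (\<lambda>n. ?F n t) \<longlonglongrightarrow> t powr (s - 1) * bern t"
      proof (rule AE_I2)
        fix t
        have "(\<lambda>n. ?F n t) \<longlonglongrightarrow> t powr (s - 1) * bern t * exp (- 0 * t)"
          by (intro tendsto_intros x)
        thus "(\<lambda>n. ?F n t) \<longlonglongrightarrow> t powr (s - 1) * bern t" by simp
      qed
      show "AE t in pos_lborel. norm (?F n t) \<le> t powr (s - 1) * bern t" for n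
      proof (rule AE_I2)
        fix t assume "t \<in> space pos_lborel"
        hence t: "t > 0" by simp
        have "t powr (s - 1) * bern t * exp (- x n * t) \<le> t powr (s - 1) * bern t"
          using x(1)[of n] t bern_nonneg[OF t] by (intro mult_left_le mult_nonneg_nonneg) (auto simp: zero_le_mult_iff)
        thus "norm (?F n t) \<le> t powr (s - 1) * bern t" using bern_nonneg[OF t] by (simp add: abs_mult)
      qed
    qed (use hb mb Mreal(2) x in \<open>auto simp: has_bochner_integral_iff\<close>)
    also have "(\<integral>t. t powr (s - 1) * bern t \<partial>pos_lborel) = ?I" using hb by (simp add: has_bochner_integral_iff)
    finally show ?thesis unfolding Mreal(1)[OF x(1)] by (rule tendsto_of_real)
  qed
  have p0: "(\<lambda>n. of_real (x n) powr (of_real b)) \<longlonglongrightarrow> (0::complex)" if "b > 0" for b :: real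
  proof -
    have "(\<lambda>n. x n powr b) \<longlonglongrightarrow> 0 powr b"
      using that x(1) by (intro tendsto_powr2 x tendsto_const) (auto intro!: always_eventually less_imp_le)
    hence "(\<lambda>n. complex_of_real (x n powr b)) \<longlonglongrightarrow> of_real 0" by (intro tendsto_of_real) simp
    thus ?thesis using x(1) powr_of_real[of "x _" b] by (simp add: less_imp_le)
  qed
  have ball: "?s \<in> ball 0 1" using s by (simp add: dist_norm)
  \<comment> \<open>The zeta value is the one at z = 1, approached through z + 1 as z tends to 0.
    The ladder trades z + 1 for z, where the formula above has a limit.\<close>
  have lad: "barnes_zeta ?s z [1] = z powr (- ?s) + barnes_zeta ?s (z + 1) [1]" if "Re z > 0" for z
    using deriv_barnes_ladder(2)[of "[]" 1 z ?s] that ball by (simp add: barnes_zeta_Nil)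
  have cont: "isCont (\<lambda>z. Gamma ?s * barnes_zeta ?s z [1]) 1"
  proof -
    have "(\<lambda>z. M (?s - 1) z) holomorphic_on {z. Re z > 0}"
      by (rule holomorphic_z) (use s in auto)
    hence "(\<lambda>z. Gamma (?s - 1) * z powr (1 - ?s) + Gamma ?s / 2 * z powr (- ?s) + M (?s - 1) z) holomorphic_on {z. Re z > 0}"
      by (intro holomorphic_intros) (auto simp: complex_nonpos_Reals_iff)
    hence "(\<lambda>z. Gamma ?s * barnes_zeta ?s z [1]) holomorphic_on {z. Re z > 0}"
      by (rule holomorphic_transform) (use bz in auto)
    hence "continuous_on {z. Re z > 0} (\<lambda>z. Gamma ?s * barnes_zeta ?s z [1])"
      by (rule holomorphic_on_imp_continuous_on)
    from this[unfolded continuous_on_eq_continuous_at[OF open_Re_gt]] show ?thesis by (rule bspec) simp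
  qed
  have "(\<lambda>n. of_real (x n) + 1) \<longlonglongrightarrow> (0 + 1 :: complex)"
    by (intro tendsto_intros) (use tendsto_of_real[OF x(2), where ?'a = complex] in simp)
  hence "(\<lambda>n. Gamma ?s * barnes_zeta ?s (of_real (x n) + 1) [1]) \<longlonglongrightarrow> Gamma ?s * barnes_zeta ?s 1 [1]"
    using isCont_tendsto_compose[OF cont] by simp
  moreover have "(\<lambda>n. Gamma ?s * barnes_zeta ?s (of_real (x n) + 1) [1]) \<longlonglongrightarrow> 
      Gamma (?s - 1) * 0 + Gamma ?s / 2 * 0 + of_real ?I - Gamma ?s * 0"
  proof -
    have "Gamma ?s * barnes_zeta ?s (of_real (x n) + 1) [1] =
        Gamma (?s - 1) * of_real (x n) powr of_real (1 - s) + Gamma ?s / 2 * of_real (x n) powr of_real (- s)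
          + M (?s - 1) (of_real (x n)) - Gamma ?s * of_real (x n) powr of_real (- s)" for n
    proof -
      have r: "Re (of_real (x n)) > 0" using x(1)[of n] by simp
      have "Gamma ?s * barnes_zeta ?s (of_real (x n) + 1) [1] =
          Gamma ?s * barnes_zeta ?s (of_real (x n)) [1] - Gamma ?s * of_real (x n) powr (- ?s)"
        unfolding lad[OF r] by (simp only: distrib_left add_diff_cancel_left')
      thus ?thesis unfolding bz[OF r] by (simp only: of_real_diff of_real_1 of_real_minus)
    qed
    thus ?thesis by (simp only:) (intro tendsto_intros p0 limM, use s in auto)
  qed
  ultimately have "Gamma ?s * barnes_zeta ?s 1 [1] = Gamma (?s - 1) * 0 + Gamma ?s / 2 * 0 + of_real ?I - Gamma ?s * 0"
    by (rule LIMSEQ_unique)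
  thus ?thesis unfolding rzeta_eq_barnes by simp
qed

section \<open>The completed zeta function\<close>

text \<open>Without the factor s (s - 1), which is itself invariant under s to 1 - s.\<close>

definition xi :: "complex \<Rightarrow> complex" where
  "xi s = of_real pi powr (- s / 2) * Gamma (s / 2) * rzeta s"

lemma meromorphic_Gamma_half: "(\<lambda>s. Gamma (s / 2)) meromorphic_on (A :: complex set)"
  by (rule meromorphic_on_compose[OF meromorphic_Gamma[of UNIV]]) (auto intro!: analytic_intros)

lemma xi_meromorphic: "xi meromorphic_on UNIV"
proof -
  have "(\<lambda>s. of_real pi powr (- s / 2)) meromorphic_on (UNIV :: complex set)"
  proof (intro analytic_on_imp_meromorphic_on)
    have "of_real pi \<noteq> (0::complex)" by simp
    thus "(\<lambda>s. of_real pi powr (- s / 2) :: complex) analytic_on UNIV"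
      unfolding powr_def by (simp only: if_False) (intro analytic_intros; simp)
  qed
  thus ?thesis unfolding xi_def[abs_def]
    by (intro meromorphic_intros meromorphic_Gamma_half rzeta_meromorphic)
qed

text \<open>The Mellin limit gives Gamma s times zeta s. Legendre's duplication formula exchanges
  Gamma s for Gamma(s/2), and the spare positive factor Gamma((1 + s)/2) is cancelled at the
  end.\<close>

lemma xi_functional_equation_real:
  fixes s :: real
  assumes s: "-1 < s" "s < 0"
  shows "xi (of_real s) = xi (1 - of_real s)"
proof -
  let ?s = "complex_of_real s"
  define G1 G2 Z where "G1 = Gamma ((1 + s) / 2)" and "G2 = Gamma ((1 - s) / 2)" and "Z = (\<Sum>n. real (Suc n) powr (s - 1))"
  have G1: "G1 > 0" unfolding G1_def using s by (intro Gamma_real_pos) auto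
  have z1: "rzeta (1 - ?s) = of_real Z"
  proof -
    have *: "of_nat (Suc n) powr (- (1 - ?s)) = complex_of_real (real (Suc n) powr (s - 1))" for n
      using powr_of_real[of "real (Suc n)" "s - 1"] by simp
    have "rzeta (1 - ?s) = (\<Sum>n. of_nat (Suc n) powr (- (1 - ?s)))"
      by (rule rzeta_eq_suminf) (use s in simp)
    also have "\<dots> = of_real Z"
      unfolding * Z_def using summable_real_powr_iff[of "s - 1"] s summable_Suc_iff[of "\<lambda>n. real n powr (s - 1)"]
      by (intro suminf_of_real[symmetric]) simp
    finally show ?thesis .
  qed
  have GZ: "Gamma ?s * rzeta ?s = of_real (G1 * G2 * (2 * pi) powr (s - 1) * Z)"
    using Gamma_zeta_limit[OF s] by (simp only: G1_def G2_def Z_def)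
  have n1: "?s / 2 \<notin> \<int>\<^sub>\<le>\<^sub>0" "?s / 2 + 1 / 2 \<notin> \<int>\<^sub>\<le>\<^sub>0"
  proof -
    have "?s / 2 = of_real (s / 2)" "?s / 2 + 1 / 2 = of_real (s / 2 + 1 / 2)" by simp_all
    moreover have "s / 2 \<notin> \<int>\<^sub>\<le>\<^sub>0"
    proof
      assume "s / 2 \<in> \<int>\<^sub>\<le>\<^sub>0"
      then obtain k where "s / 2 = of_int k" by (auto elim: nonpos_Ints_cases)
      hence "real_of_int (-1) < of_int k" "of_int k < real_of_int 0" using s by simp_all
      thus False by (simp only: of_int_less_iff)
    qed
    moreover have "s / 2 + 1 / 2 \<notin> \<int>\<^sub>\<le>\<^sub>0" using s nonpos_Ints_nonpos[of "s / 2 + 1 / 2"] by auto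
    ultimately show "?s / 2 \<notin> \<int>\<^sub>\<le>\<^sub>0" "?s / 2 + 1 / 2 \<notin> \<int>\<^sub>\<le>\<^sub>0"
      by (simp_all only: of_real_in_nonpos_Ints_iff not_False_eq_True)
  qed
  have g1: "Gamma (?s / 2 + 1 / 2) = of_real G1"
  proof -
    have "?s / 2 + 1 / 2 = of_real ((1 + s) / 2)" by (simp add: field_simps)
    thus ?thesis by (simp only: Gamma_complex_of_real G1_def)
  qed
  have g2: "Gamma ((1 - ?s) / 2) = of_real G2"
  proof -
    have "(1 - ?s) / 2 = of_real ((1 - s) / 2)" by simp
    thus ?thesis by (simp only: Gamma_complex_of_real G2_def)
  qed
  have dup: "Gamma (?s / 2) * of_real G1 = of_real (2 powr (1 - s) * sqrt pi) * Gamma ?s"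
    using Gamma_legendre_duplication[OF n1] unfolding g1
    by (simp add: powr_def exp_of_real[symmetric])
  have pp: "complex_of_real pi powr (- ?s / 2) = of_real (pi powr (- s / 2))"
       "complex_of_real pi powr (- (1 - ?s) / 2) = of_real (pi powr (- (1 - s) / 2))"
    using powr_of_real[of pi "- s / 2"] powr_of_real[of pi "- (1 - s) / 2"] by simp_all
  have "xi ?s * of_real G1 = of_real (pi powr (- s / 2)) * (Gamma (?s / 2) * of_real G1) * rzeta ?s"
    unfolding xi_def pp by (simp only: mult_ac)
  also have "\<dots> = of_real (pi powr (- s / 2) * (2 powr (1 - s) * sqrt pi)) * (Gamma ?s * rzeta ?s)"
    unfolding dup by (simp only: of_real_mult mult_ac)
  also have "\<dots> = of_real (pi powr (- s / 2) * (2 powr (1 - s) * sqrt pi) * (G1 * G2 * (2 * pi) powr (s - 1) * Z))"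
    unfolding GZ by (simp only: of_real_mult)
  also have "pi powr (- s / 2) * (2 powr (1 - s) * sqrt pi) * (G1 * G2 * (2 * pi) powr (s - 1) * Z) =
       pi powr (- (1 - s) / 2) * G2 * Z * G1"
  proof -
    have "(2 * pi) powr (s - 1) = 2 powr (s - 1) * pi powr (s - 1)" by (rule powr_mult)
    moreover have "2 powr (1 - s) * 2 powr (s - 1) = (1::real)" by (simp add: powr_add[symmetric])
    moreover have "pi powr (- s / 2) * sqrt pi * pi powr (s - 1) = pi powr (- (1 - s) / 2)"
    proof -
      have "sqrt pi = pi powr (1 / 2)" by (simp add: powr_half_sqrt)
      hence "pi powr (- s / 2) * sqrt pi * pi powr (s - 1) = pi powr (- s / 2 + 1 / 2 + (s - 1))"
        by (simp only: powr_add)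
      also have "- s / 2 + 1 / 2 + (s - 1) = - (1 - s) / 2" by (simp add: field_simps)
      finally show ?thesis .
    qed
    ultimately show ?thesis by (simp add: algebra_simps) (metis mult.assoc mult.left_commute mult_1)
  qed
  also have "of_real (pi powr (- (1 - s) / 2) * G2 * Z * G1) = xi (1 - ?s) * of_real G1"
    unfolding xi_def pp g2 z1 by simp
  finally show ?thesis using G1 by simp
qed

text \<open>The interval accumulates at its midpoint -1/2, which is enough for the identity
  theorem.\<close>

lemma xi_functional_equation: "\<forall>\<^sub>F s in cosparse UNIV. xi s = xi (1 - s)"
proof (rule meromorphic_identity[where ?z0.0 = "complex_of_real (-1/2)"])
  show "(\<lambda>s. xi (1 - s)) meromorphic_on UNIV" by (rule meromorphic_on_shift(2)[OF xi_meromorphic])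
  have "(-1/2::real) islimpt {-1<..<0}" by (rule open_imp_islimpt) auto
  hence "complex_of_real (-1/2) islimpt of_real ` {-1<..<0}"
  proof (rule islimpt_isCont_image)
    show "\<forall>\<^sub>F y in at (- 1 / 2). complex_of_real y \<noteq> complex_of_real (- 1 / 2)"
      unfolding of_real_eq_iff eventually_at_filter by simp
  qed auto
  hence "\<exists>\<^sub>F s in at (complex_of_real (-1/2)). s \<in> of_real ` {-1<..<0}"
    by (simp add: islimpt_conv_frequently_at)
  thus "\<exists>\<^sub>F s in at (complex_of_real (-1/2)). xi s = xi (1 - s)"
    by (rule frequently_elim1) (auto intro: xi_functional_equation_real)
qed (use xi_meromorphic in auto)

section \<open>The gamma function with the single period 2\<close>

text \<open>The derivative formula at w = 0 for one period; up to scaling and elementary terms it is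
  Binet's integral for log Gamma. Each summand is visibly convex, as Bohr--Mollerup demands.\<close>

lemma mgamma_2_real:
  fixes x :: real
  assumes x: "x > 0"
  shows "\<exists>g>0. mgamma (of_real x) [2] = of_real g \<and>
    ln g = (x * ln x - x) / 2 - ln x / 2 + (\<integral>t. bern (2 * t) / t * exp (- x * t) \<partial>pos_lborel)"
    and "integrable pos_lborel (\<lambda>t. bern (2 * t) / t * exp (- x * t))"
proof -
  obtain C where "barnes_at_0 [complex_of_real 2] (single_coeff 2) C" using barnes_at_0_single[of 2] by auto
  then interpret barnes_at_0 "[complex_of_real 2]" "single_coeff 2" C .
  let ?f = "\<lambda>t. of_real t powr (- 1 - 1) * (bprod [complex_of_real 2] t - (\<Sum>j<length [complex_of_real 2] + 1. single_coeff 2 j * of_real t ^ j)) * exp (- of_real x * of_real t)"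
  have eq: "?f t = of_real (bern (2 * t) / t * exp (- x * t))" if t: "t > 0" for t
  proof -
    have "of_real t powr (- 1 - 1) = complex_of_real (t powr (- 1 - 1))"
      using t powr_of_real[of t "- 1 - 1"] by simp
    moreover have "t powr (- 1 - 1) * t = inverse t" using t by (simp add: powr_diff powr_minus power2_eq_square)
    moreover have "bprod [complex_of_real 2] t - (\<Sum>j<length [complex_of_real 2] + 1. single_coeff 2 j * of_real t ^ j) = of_real (t * bern (2 * t))"
      using single_remainder[of 2 t] t by (simp add: numeral_2_eq_2)
    ultimately have "?f t = of_real (inverse t * bern (2 * t) * exp (- x * t))"
      by (simp only: exp_of_real of_real_mult[symmetric] of_real_minus[symmetric] mult.assoc[symmetric])
    thus ?thesis by (simp only: divide_inverse mult_ac)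
  qed
  have int: "integrable pos_lborel ?f" by (rule integrable) (use x in auto)
  hence "integrable pos_lborel (\<lambda>t. complex_of_real (bern (2 * t) / t * exp (- x * t)))"
    by (rule Bochner_Integration.integrable_cong[THEN iffD1, rotated -1]) (rule refl, rule eq, simp)
  thus i: "integrable pos_lborel (\<lambda>t. bern (2 * t) / t * exp (- x * t))"
    by (subst (asm) complex_of_real_integrable_eq)
  have M: "M (- 1) (of_real x) = of_real (\<integral>t. bern (2 * t) / t * exp (- x * t) \<partial>pos_lborel)"
    unfolding M_def by (subst integral_of_real[OF i, symmetric], rule Bochner_Integration.integral_cong[OF refl], rule eq) simp
  have r0: "gamma_ratio 0 = (\<lambda>_. 1)" and r1: "gamma_ratio 1 = (\<lambda>w. 1 / (w - 1))"
    by (simp_all add: gamma_ratio_def fun_eq_iff)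
  have d1: "deriv (gamma_ratio 1) 0 = - 1" "gamma_ratio 1 0 = - 1"
    unfolding r1 by (rule DERIV_imp_deriv) (auto intro!: derivative_eq_intros)
  have d0: "deriv (gamma_ratio 0) 0 = 0" "gamma_ratio 0 0 = 1"
    unfolding r0 by simp_all
  let ?L = "(x * ln x - x) / 2 - ln x / 2 + (\<integral>t. bern (2 * t) / t * exp (- x * t) \<partial>pos_lborel)"
  have "deriv (\<lambda>w. barnes_zeta w (of_real x) [complex_of_real 2]) 0 = of_real ?L"
    using barnes_zeta_near_0(3)[of "of_real x"] x d0 d1 M
    by (simp add: single_coeff_def Ln_of_real field_simps)
  moreover have "mgamma (of_real x) [complex_of_real 2] = exp (deriv (\<lambda>w. barnes_zeta w (of_real x) [complex_of_real 2]) 0)"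
    by (rule mgamma_eq_exp) (use x in auto)
  ultimately have "mgamma (of_real x) [complex_of_real 2] = of_real (exp ?L)" by (simp only: exp_of_real)
  hence "mgamma (of_real x) [2] = of_real (exp ?L)" by (simp only: of_real_numeral)
  thus "\<exists>g>0. mgamma (of_real x) [2] = of_real g \<and> ln g = ?L"
    by (intro exI[of _ "exp ?L"] conjI) (simp_all only: exp_gt_zero ln_exp)
qed

text \<open>Each exp(-x t) is convex in x, and integrating against a nonnegative weight preserves
  the inequality.\<close>

lemma convex_on_integral_exp:
  fixes h :: "real \<Rightarrow> real"
  assumes int: "\<And>x. x > 0 \<Longrightarrow> integrable pos_lborel (\<lambda>t. h t * exp (- x * t))"
    and h: "\<And>t. t > 0 \<Longrightarrow> h t \<ge> 0"
  shows "convex_on {0<..} (\<lambda>x. \<integral>t. h t * exp (- x * t) \<partial>pos_lborel)"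
proof (rule convex_onI)
  fix l x y :: real assume l: "0 < l" "l < 1" and xy: "x \<in> {0<..}" "y \<in> {0<..}"
  have pos: "(1 - l) * x + l * y > 0" using l xy by (intro add_pos_pos mult_pos_pos) auto
  have ix: "integrable pos_lborel (\<lambda>t. h t * exp (- x * t))" and iy: "integrable pos_lborel (\<lambda>t. h t * exp (- y * t))"
    using int xy by auto
  have "(\<integral>t. h t * exp (- ((1 - l) * x + l * y) * t) \<partial>pos_lborel) \<le>
        (\<integral>t. (1 - l) * (h t * exp (- x * t)) + l * (h t * exp (- y * t)) \<partial>pos_lborel)"
  proof (rule integral_mono)
    fix t assume "t \<in> space pos_lborel"
    hence t: "t > 0" by simp
    have "exp ((1 - l) * (- x * t) + l * (- y * t)) \<le> (1 - l) * exp (- x * t) + l * exp (- y * t)"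
      using convex_onD[OF exp_convex, of l "- x * t" "- y * t"] l by simp
    hence "h t * exp ((1 - l) * (- x * t) + l * (- y * t)) \<le> h t * ((1 - l) * exp (- x * t) + l * exp (- y * t))"
      using h[OF t] by (rule mult_left_mono)
    thus "h t * exp (- ((1 - l) * x + l * y) * t) \<le> (1 - l) * (h t * exp (- x * t)) + l * (h t * exp (- y * t))"
      by (simp add: algebra_simps)
  qed (use int[OF pos] ix iy in auto)
  also have "\<dots> = (1 - l) * (\<integral>t. h t * exp (- x * t) \<partial>pos_lborel) + l * (\<integral>t. h t * exp (- y * t) \<partial>pos_lborel)"
    using ix iy by simp
  finally show "(\<integral>t. h t * exp (- ((1 - l) *\<^sub>R x + l *\<^sub>R y) * t) \<partial>pos_lborel) \<le>
     (1 - l) * (\<integral>t. h t * exp (- x * t) \<partial>pos_lborel) + l * (\<integral>t. h t * exp (- y * t) \<partial>pos_lborel)" by simp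
qed auto

lemma convex_on_xlnx: "convex_on {0<..} (\<lambda>x::real. x * ln x - x)"
proof (rule f''_ge0_imp_convex[where f' = ln and f'' = inverse])
  show "((\<lambda>x. x * ln x - x) has_real_derivative ln x) (at x)" if "x \<in> {0<..}" for x :: real
    using that by (auto intro!: derivative_eq_intros)
  show "(ln has_real_derivative inverse x) (at x)" if "x \<in> {0<..}" for x :: real
    using that by (intro DERIV_ln) auto
qed auto

lemma convex_on_minus_ln: "convex_on {0<..} (\<lambda>x::real. - ln x)"
proof (rule f''_ge0_imp_convex[where f' = "\<lambda>x. - inverse x" and f'' = "\<lambda>x. inverse (x\<^sup>2)"])
  show "((\<lambda>x. - ln x) has_real_derivative - inverse x) (at x)" if "x \<in> {0<..}" for x :: real
    using that by (intro DERIV_minus DERIV_ln) auto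
  show "((\<lambda>x. - inverse x) has_real_derivative inverse (x\<^sup>2)) (at x)" if "x \<in> {0<..}" for x :: real
    using that by (auto intro!: derivative_eq_intros simp: power2_eq_square)
qed auto

lemma convex_on_transform:
  assumes "convex_on S f" "\<And>x. x \<in> S \<Longrightarrow> g x = f x"
  shows "convex_on S g"
proof (rule convex_onI)
  show S: "convex S" using assms(1) by (rule convex_on_imp_convex)
  fix t x y assume t: "0 < t" "t < (1::real)" and xy: "x \<in> S" "y \<in> S"
  have "(1 - t) *\<^sub>R x + t *\<^sub>R y \<in> S" using S t xy by (intro convexD_alt) auto
  thus "g ((1 - t) *\<^sub>R x + t *\<^sub>R y) \<le> (1 - t) * g x + t * g y"
    using convex_onD[OF assms(1), of t x y] t xy by (simp add: assms(2))
qed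

lemma convex_on_scale_affine:
  fixes l :: "real \<Rightarrow> real"
  assumes "convex_on {0<..} l"
  shows "convex_on {0<..} (\<lambda>x. l (2 * x) + (a * x + b))"
proof (rule convex_onI)
  fix t x y :: real assume t: "0 < t" "t < 1" and xy: "x \<in> {0<..}" "y \<in> {0<..}"
  have "l ((1 - t) *\<^sub>R (2 * x) + t *\<^sub>R (2 * y)) \<le> (1 - t) * l (2 * x) + t * l (2 * y)"
    using t xy by (intro convex_onD[OF assms]) auto
  moreover have "(1 - t) *\<^sub>R (2 * x) + t *\<^sub>R (2 * y) = 2 * ((1 - t) *\<^sub>R x + t *\<^sub>R y)"
    by (simp add: algebra_simps)
  moreover have "a * ((1 - t) *\<^sub>R x + t *\<^sub>R y) + b = (1 - t) * (a * x + b) + t * (a * y + b)"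
    by (simp add: algebra_simps)
  ultimately show "l (2 * ((1 - t) *\<^sub>R x + t *\<^sub>R y)) + (a * ((1 - t) *\<^sub>R x + t *\<^sub>R y) + b) \<le>
      (1 - t) * (l (2 * x) + (a * x + b)) + t * (l (2 * y) + (a * y + b))"
    by (simp only: distrib_left)
qed auto

text \<open>By the Bohr--Mollerup theorem; the constant cancels in \<^term>\<open>Lambda s []\<close>, so it need not be
  determined.\<close>
lemma mgamma_2: "\<exists>c. c \<noteq> 0 \<and> (\<forall>\<^sub>F z in cosparse UNIV. mgamma z [2] = c * exp (z / 2 * of_real (ln 2)) * Gamma (z / 2))"
proof -
  define g where "g = (\<lambda>x. Re (mgamma (of_real x) [2]))"
  have g: "g x > 0" "mgamma (of_real x) [2] = of_real (g x)"
     "ln (g x) = (x * ln x - x) / 2 - ln x / 2 + (\<integral>t. bern (2 * t) / t * exp (- x * t) \<partial>pos_lborel)" if "x > 0" for x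
  proof -
    obtain y where y: "y > 0" "mgamma (of_real x) [2] = of_real y"
      "ln y = (x * ln x - x) / 2 - ln x / 2 + (\<integral>t. bern (2 * t) / t * exp (- x * t) \<partial>pos_lborel)"
      using mgamma_2_real(1)[OF \<open>x > 0\<close>] by blast
    hence "g x = y" by (simp add: g_def)
    thus "g x > 0" "mgamma (of_real x) [2] = of_real (g x)"
     "ln (g x) = (x * ln x - x) / 2 - ln x / 2 + (\<integral>t. bern (2 * t) / t * exp (- x * t) \<partial>pos_lborel)"
      using y by (simp_all only:)
  qed
  let ?l = "\<lambda>x. (x * ln x - x) / 2 - ln x / 2 + (\<integral>t. bern (2 * t) / t * exp (- x * t) \<partial>pos_lborel)"
  have "convex_on {0<..} (\<lambda>x. 1 / 2 * (x * ln x - x) + 1 / 2 * (- ln x) + (\<integral>t. bern (2 * t) / t * exp (- x * t) \<partial>pos_lborel))"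
    by (intro convex_on_add convex_on_cmul convex_on_xlnx convex_on_minus_ln convex_on_integral_exp mgamma_2_real(2))
       (auto intro!: divide_nonneg_pos bern_nonneg)
  hence conv: "convex_on {0<..} ?l" by simp
  \<comment> \<open>The ladder starting from the empty tuple, whose gamma function is 1/x.\<close>
  have lad: "g (x + 2) = x * g x" if x: "x > 0" for x
  proof -
    have "mgamma (of_real x) ([] @ [2]) = mgamma (of_real x) [] * mgamma (of_real x + 2) ([] @ [2])"
      by (rule mgamma_ladder(1)) (use x in auto)
    hence "complex_of_real (g x) = inverse (of_real x) * of_real (g (x + 2))"
      using g(2)[of x] g(2)[of "x + 2"] x by (simp add: mgamma_Nil)
    hence "complex_of_real (g x) = of_real (inverse x * g (x + 2))" by simp
    hence "g x = inverse x * g (x + 2)" by (simp only: of_real_eq_iff)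
    thus ?thesis using x by (simp add: field_simps)
  qed
  \<comment> \<open>Doubling the argument turns step 2 into step 1, the power of 2 removes the
    factor 2 from the recursion, and the last factor makes G 1 = 1.\<close>
  define G where "G = (\<lambda>x. g (2 * x) * 2 powr (- x) * (2 / g 2))"
  have g2: "g 2 > 0" by (rule g(1)) simp
  have GG: "G x = Gamma x" if "x > 0" for x
  proof (rule Gamma_pos_real_unique)
    show "G 1 = 1" using g2 by (simp add: G_def powr_minus)
    show "G (x + 1) = x * G x" if x: "x > 0" for x
    proof -
      have "g (2 * (x + 1)) = 2 * x * g (2 * x)" using lad[of "2 * x"] x by (simp add: algebra_simps)
      moreover have "2 powr (- (x + 1)) = 2 powr (- x) / 2"
        by (simp add: powr_diff powr_minus_divide powr_add)
      ultimately show ?thesis by (simp only: G_def) (simp add: field_simps)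
    qed
    show "G x > 0" if "x > 0" for x
      unfolding G_def using g(1)[of "2 * x"] g2 that by simp
    have "convex_on {0<..} (\<lambda>x. ?l (2 * x) + (- ln 2 * x + ln (2 / g 2)))"
      by (rule convex_on_scale_affine[OF conv])
    moreover have lnG: "(ln \<circ> G) x = ?l (2 * x) + (- ln 2 * x + ln (2 / g 2))" if x: "x \<in> {0<..}" for x
    proof -
      have "ln (G x) = ln (g (2 * x)) + (- ln 2 * x + ln (2 / g 2))"
        unfolding G_def using g(1)[of "2 * x"] g2 x
        by (subst ln_mult_pos, simp, simp, subst ln_mult_pos, simp, simp, subst ln_powr) simp
      moreover have "2 * x > 0" using x by simp
      ultimately show ?thesis using g(3)[of "2 * x"] by (simp only: o_def)
    qed
    ultimately show "convex_on {0<..} (ln \<circ> G)"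
      by (rule convex_on_transform)
  qed fact
  define c where "c = complex_of_real (g 2 / 2)"
  have c: "c \<noteq> 0" using g2 by (simp add: c_def)
  have real: "mgamma (of_real x) [2] = c * exp (of_real x / 2 * of_real (ln 2)) * Gamma (of_real x / 2)" if x: "x > 0" for x
  proof -
    have "g x * 2 powr (- (x / 2)) * (2 / g 2) = Gamma (x / 2)"
      using GG[of "x / 2"] x by (simp add: G_def)
    hence "g x = g 2 / 2 * 2 powr (x / 2) * Gamma (x / 2)"
      using g2 by (simp add: field_simps powr_minus)
    also have "2 powr (x / 2) = exp (x / 2 * ln 2)" by (simp add: powr_def)
    finally have "complex_of_real (g x) = of_real (g 2 / 2 * exp (x / 2 * ln 2) * Gamma (x / 2))" by (rule arg_cong)
    thus ?thesis using g(2)[OF x] by (simp add: c_def Gamma_complex_of_real[symmetric] exp_of_real[symmetric])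
  qed
  have "\<forall>\<^sub>F z in cosparse UNIV. mgamma z [2] = c * exp (z / 2 * of_real (ln 2)) * Gamma (z / 2)"
  proof (rule meromorphic_identity[where ?z0.0 = 1])
    show "(\<lambda>z. mgamma z [2]) meromorphic_on UNIV" by (rule mgamma_meromorphic) simp
    show "(\<lambda>z. c * exp (z / 2 * of_real (ln 2)) * Gamma (z / 2)) meromorphic_on UNIV"
      by (intro meromorphic_on_mult meromorphic_Gamma_half analytic_on_imp_meromorphic_on analytic_intros) auto
    have "(1::real) islimpt {0<..}" by (rule open_imp_islimpt) auto
    hence "complex_of_real 1 islimpt of_real ` {0<..}"
      by (rule islimpt_isCont_image) (auto simp: eventually_at_filter)
    hence "\<exists>\<^sub>F s in at (complex_of_real 1). s \<in> of_real ` {0<..}"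
      by (simp only: islimpt_conv_frequently_at)
    hence "\<exists>\<^sub>F s in at 1. s \<in> complex_of_real ` {0<..}" by simp
    thus "\<exists>\<^sub>F z in at 1. mgamma z [2] = c * exp (z / 2 * of_real (ln 2)) * Gamma (z / 2)"
      by (rule frequently_elim1) (use real in auto)
  qed auto
  with c show ?thesis by blast
qed

section \<open>The product of zeta values\<close>

lemma rzeta_holomorphic: "rzeta holomorphic_on {s. Re s > 1}"
  using barnes_zeta_continuation(3)[of "[1]" 1] by (simp add: rzeta_eq_barnes[abs_def])

text \<open>All terms after the first have base at least 2, so a factor 2 powr (\<sigma> - Re s) can
  be split off. This exponential decay in Re s makes the product over the index tuples
  converge.\<close>

lemma rzeta_minus_1_bound:
  assumes \<sigma>: "\<sigma> > 1"
  shows "\<exists>C\<ge>0. \<forall>s. Re s \<ge> \<sigma> \<longrightarrow> norm (rzeta s - 1) \<le> C * 2 powr (- Re s)"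
proof -
  define C where "C = 2 powr \<sigma> * (\<Sum>n. real (n + 2) powr (- \<sigma>))"
  have sm: "summable (\<lambda>n. real (n + 2) powr (- \<sigma>))"
    using \<sigma> summable_real_powr_iff[of "- \<sigma>"] summable_iff_shift[of "\<lambda>n. real n powr (- \<sigma>)" 2] by simp
  show ?thesis
  proof (intro exI[of _ C] conjI allI impI)
    show "C \<ge> 0" unfolding C_def by (intro mult_nonneg_nonneg suminf_nonneg sm) auto
    fix s assume s: "Re s \<ge> \<sigma>"
    hence s1: "Re s > 1" using \<sigma> by simp
    let ?f = "\<lambda>n. of_nat (Suc n) powr (- s) :: complex"
    have sf: "summable (\<lambda>n. norm (?f n))" by (rule zeta_series(1)[OF s1])
    have "rzeta s = ?f 0 + (\<Sum>n. ?f (Suc n))"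
      using suminf_split_head[OF summable_norm_cancel[OF sf]] rzeta_eq_suminf[OF s1] by simp
    hence "rzeta s - 1 = (\<Sum>n. ?f (Suc n))" by simp
    also have "norm \<dots> \<le> (\<Sum>n. norm (?f (Suc n)))"
      using sf summable_Suc_iff[of "\<lambda>n. norm (?f n)"] by (intro summable_norm) blast
    also have "\<dots> \<le> (\<Sum>n. 2 powr (- (Re s - \<sigma>)) * real (n + 2) powr (- \<sigma>))"
    proof (intro suminf_le)
      show "summable (\<lambda>n. norm (?f (Suc n)))" using sf summable_Suc_iff[of "\<lambda>n. norm (?f n)"] by blast
      show "summable (\<lambda>n. 2 powr (- (Re s - \<sigma>)) * real (n + 2) powr (- \<sigma>))" by (intro summable_mult sm)
      fix n
      have "norm (?f (Suc n)) = real (n + 2) powr (- Re s)"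
        using norm_powr_real_powr[of "of_nat (n + 2)" "- s"] by (simp add: add_ac)
      also have "\<dots> = real (n + 2) powr (- (Re s - \<sigma>)) * real (n + 2) powr (- \<sigma>)"
        by (simp only: powr_add[symmetric]) simp
      also have "\<dots> \<le> 2 powr (- (Re s - \<sigma>)) * real (n + 2) powr (- \<sigma>)"
        using s by (intro mult_right_mono powr_mono2') auto
      finally show "norm (?f (Suc n)) \<le> 2 powr (- (Re s - \<sigma>)) * real (n + 2) powr (- \<sigma>)" .
    qed
    also have "\<dots> = 2 powr (- (Re s - \<sigma>)) * (\<Sum>n. real (n + 2) powr (- \<sigma>))"
      using sm by (rule suminf_mult)
    also have "2 powr (- (Re s - \<sigma>)) = 2 powr (- Re s) * 2 powr \<sigma>" by (simp only: powr_add[symmetric]) simp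
    finally show "norm (rzeta s - 1) \<le> C * 2 powr (- Re s)" by (simp add: C_def mult_ac)
  qed
qed

text \<open>Multiplying in one more factor works because 1 + b is at most exp b.\<close>

lemma norm_prod_diff_1:
  fixes f :: "'a \<Rightarrow> complex"
  assumes "finite A" "\<And>x. x \<in> A \<Longrightarrow> norm (f x - 1) \<le> b x"
  shows "norm (prod f A - 1) \<le> exp (sum b A) - 1"
  using assms
proof (induction A rule: finite_induct)
  case (insert x A)
  have b: "norm (f x - 1) \<le> b x" "norm (prod f A - 1) \<le> exp (sum b A) - 1" using insert by auto
  have b0: "b x \<ge> 0" using b(1) norm_ge_zero order.trans by blast
  have "norm (prod f (insert x A) - 1) = norm ((f x - 1) * (prod f A - 1) + (f x - 1) + (prod f A - 1))"
    using insert by (simp add: algebra_simps)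
  also have "\<dots> \<le> norm (f x - 1) * norm (prod f A - 1) + norm (f x - 1) + norm (prod f A - 1)"
    by (intro order.trans[OF norm_triangle_ineq] add_mono) (auto simp: norm_mult)
  also have "\<dots> \<le> b x * (exp (sum b A) - 1) + b x + (exp (sum b A) - 1)"
    using b b0 by (intro add_mono mult_mono) auto
  also have "\<dots> = (1 + b x) * exp (sum b A) - 1" by (simp add: algebra_simps)
  also have "\<dots> \<le> exp (b x) * exp (sum b A) - 1"
    by (intro diff_right_mono mult_right_mono exp_ge_add_one_self) auto
  finally show ?case using insert by (simp add: exp_add)
qed auto

section \<open>Convergence of the products over boxes\<close>

definition index_box :: "nat \<Rightarrow> nat \<Rightarrow> nat list set" where
  "index_box m N = {n. length n = m \<and> (\<forall>i\<in>set n. i \<le> N)}"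

lemma finite_index_box: "finite (index_box m N)"
proof -
  have "index_box m N = {n. set n \<subseteq> {..N} \<and> length n = m}" by (auto simp: index_box_def)
  thus ?thesis using finite_lists_length_eq[of "{..N}" m] by simp
qed

lemma index_box_subset: "index_box m N \<subseteq> nlists m" "M \<le> N \<Longrightarrow> index_box m M \<subseteq> index_box m N"
  by (auto simp: index_box_def nlists_def intro: order.trans)

lemma finite_subset_index_box:
  assumes "finite F" "F \<subseteq> nlists m"
  shows "\<exists>N. F \<subseteq> index_box m N"
proof -
  define N where "N = Max (insert 0 (\<Union>n\<in>F. set n))"
  have "finite (insert 0 (\<Union>n\<in>F. set n))" using assms by auto
  hence "i \<le> N" if "n \<in> F" "i \<in> set n" for n i
    unfolding N_def using that by (intro Max_ge) auto
  thus ?thesis using assms(2) by (intro exI[of _ N]) (auto simp: index_box_def nlists_def)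
qed

definition box_prod :: "complex list \<Rightarrow> nat \<Rightarrow> complex \<Rightarrow> complex" where
  "box_prod \<omega> N s = (\<Prod>n\<in>index_box (length \<omega>) N. rzeta (s + lin n \<omega>))"

definition Zlim :: "complex list \<Rightarrow> complex \<Rightarrow> complex" where
  "Zlim \<omega> s = lim (\<lambda>N. box_prod \<omega> N s)"

context
  fixes \<omega> :: "complex list"
  assumes \<omega>: "\<forall>w\<in>set \<omega>. Re w > 0"
begin

text \<open>The modulus of 2 to the power -lin n \<omega>, written as an exponential so that its sum
  is the multiple geometric series at t = ln 2.\<close>

definition decay :: "nat list \<Rightarrow> real" where
  "decay n = norm (exp (- lin n \<omega> * of_real (ln 2)))"

lemma decay_altdef: "decay n = 2 powr (- Re (lin n \<omega>))"
  by (simp add: decay_def powr_def)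

lemma decay_nonneg: "decay n \<ge> 0" by (simp add: decay_def)

lemma decay_summable: "decay summable_on nlists (length \<omega>)"
  using geometric_nlists[OF \<omega>, of "ln 2"] by (simp add: abs_summable_equivalent[symmetric] decay_def[abs_def])

lemma sum_decay_le: "finite F \<Longrightarrow> F \<subseteq> nlists (length \<omega>) \<Longrightarrow> sum decay F \<le> infsum decay (nlists (length \<omega>))"
  by (rule finite_sum_le_infsum[OF decay_summable]) (auto simp: decay_nonneg)

lemma decay_tail:
  assumes "\<delta> > 0"
  shows "\<exists>N. \<forall>F. finite F \<longrightarrow> F \<subseteq> nlists (length \<omega>) - index_box (length \<omega>) N \<longrightarrow> sum decay F \<le> \<delta>"
proof -
  let ?A = "nlists (length \<omega>)"
  have "(decay has_sum infsum decay ?A) ?A" using decay_summable by (rule has_sum_infsum)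
  hence "\<forall>\<^sub>F F in finite_subsets_at_top ?A. dist (sum decay F) (infsum decay ?A) < \<delta>"
    unfolding has_sum_def using assms by (rule tendstoD)
  then obtain F0 where F0: "finite F0" "F0 \<subseteq> ?A" "dist (sum decay F0) (infsum decay ?A) < \<delta>"
    unfolding eventually_finite_subsets_at_top by blast
  obtain N where N: "F0 \<subseteq> index_box (length \<omega>) N" using finite_subset_index_box F0 by blast
  have "sum decay F \<le> \<delta>" if F: "finite F" "F \<subseteq> ?A - index_box (length \<omega>) N" for F
  proof -
    have "sum decay F + sum decay F0 = sum decay (F \<union> F0)"
      using F F0 N by (intro sum.union_disjoint[symmetric]) auto
    also have "\<dots> \<le> infsum decay ?A" using F F0 by (intro sum_decay_le) auto
    finally show ?thesis using F0(3) by (simp add: dist_real_def)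
  qed
  thus ?thesis by blast
qed

lemma norm_box_factor:
  assumes C: "\<And>s. Re s \<ge> \<sigma> \<Longrightarrow> norm (rzeta s - 1) \<le> C * 2 powr (- Re s)" and s: "Re s \<ge> \<sigma>"
  shows "norm (rzeta (s + lin n \<omega>) - 1) \<le> C * 2 powr (- Re s) * decay n"
proof -
  have "norm (rzeta (s + lin n \<omega>) - 1) \<le> C * 2 powr (- Re (s + lin n \<omega>))"
    using s Re_lin_nonneg[OF \<omega>, of n] by (intro C) simp
  also have "2 powr (- Re (s + lin n \<omega>)) = 2 powr (- Re s) * decay n"
    unfolding decay_altdef by (simp only: powr_add[symmetric]) simp
  finally show ?thesis by (simp add: mult_ac)
qed

lemma norm_sub_prod:
  assumes C: "\<And>s. Re s \<ge> \<sigma> \<Longrightarrow> norm (rzeta s - 1) \<le> C * 2 powr (- Re s)" and s: "Re s \<ge> \<sigma>" and F: "finite F"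
  shows "norm ((\<Prod>n\<in>F. rzeta (s + lin n \<omega>)) - 1) \<le> exp (C * 2 powr (- Re s) * sum decay F) - 1"
  using norm_prod_diff_1[OF F, of "\<lambda>n. rzeta (s + lin n \<omega>)" "\<lambda>n. C * 2 powr (- Re s) * decay n"]
    norm_box_factor[OF C s] by (simp add: sum_distrib_left)

lemma norm_box_prod:
  assumes C: "\<And>s. Re s \<ge> \<sigma> \<Longrightarrow> norm (rzeta s - 1) \<le> C * 2 powr (- Re s)" "C \<ge> 0" and s: "Re s \<ge> \<sigma>"
  shows "norm (box_prod \<omega> N s - 1) \<le> exp (C * 2 powr (- Re s) * infsum decay (nlists (length \<omega>))) - 1"
proof -
  have "norm (box_prod \<omega> N s - 1) \<le> exp (C * 2 powr (- Re s) * sum decay (index_box (length \<omega>) N)) - 1"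
    unfolding box_prod_def by (rule norm_sub_prod[OF C(1) s finite_index_box])
  also have "\<dots> \<le> exp (C * 2 powr (- Re s) * infsum decay (nlists (length \<omega>))) - 1"
    using C(2) index_box_subset by (intro diff_right_mono iffD2[OF exp_le_cancel_iff] mult_left_mono sum_decay_le finite_index_box) auto
  finally show ?thesis .
qed

text \<open>The larger of two box products is the smaller one times the product over the remaining
  indices. That product is close to 1 by the tail of \<open>decay\<close>, and the box products are
  uniformly bounded.\<close>

lemma box_prod_uniform:
  assumes \<sigma>: "\<sigma> > 1"
  shows "uniform_limit {s. Re s \<ge> \<sigma>} (box_prod \<omega>) (Zlim \<omega>) sequentially"
proof -
  obtain C where C: "C \<ge> 0" "\<And>s. Re s \<ge> \<sigma> \<Longrightarrow> norm (rzeta s - 1) \<le> C * 2 powr (- Re s)"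
    using rzeta_minus_1_bound[OF \<sigma>] by blast
  define S where "S = infsum decay (nlists (length \<omega>))"
  have S: "S \<ge> 0" unfolding S_def by (intro infsum_nonneg) (auto simp: decay_nonneg)
  define K where "K = exp (C * S)"
  have K: "K > 0" by (simp add: K_def)
  have p1: "2 powr (- Re s) \<le> 1" if "Re s \<ge> \<sigma>" for s
    using that \<sigma> powr_mono[of "- Re s" 0 2] by simp
  have "uniformly_Cauchy_on {s. Re s \<ge> \<sigma>} (box_prod \<omega>)"
  proof (rule uniformly_Cauchy_onI')
    fix e :: real assume e: "e > 0"
    \<comment> \<open>Chosen so that exp((C + 1) \<delta>) - 1 is e / (2 K); C + 1 instead of C
      keeps the divisor positive.\<close>
    define \<delta> where "\<delta> = ln (1 + e / (2 * K)) / (C + 1)"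
    have l: "ln (1 + e / (2 * K)) > 0" using e K by (intro ln_gt_zero) simp
    hence \<delta>: "\<delta> > 0" using C(1) by (simp add: \<delta>_def)
    obtain M where M: "\<And>F. finite F \<Longrightarrow> F \<subseteq> nlists (length \<omega>) - index_box (length \<omega>) M \<Longrightarrow> sum decay F \<le> \<delta>"
      using decay_tail[OF \<delta>] by blast
    show "\<exists>M. \<forall>s\<in>{s. Re s \<ge> \<sigma>}. \<forall>m\<ge>M. \<forall>n>m. dist (box_prod \<omega> m s) (box_prod \<omega> n s) < e"
    proof (intro exI[of _ M] ballI allI impI)
      fix s m n assume s: "s \<in> {s. Re s \<ge> \<sigma>}" and mn: "m \<ge> M" "n > m"
      let ?F = "index_box (length \<omega>) n - index_box (length \<omega>) m"
      have F: "finite ?F" "sum decay ?F \<le> \<delta>"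
        using finite_index_box index_box_subset(1)[of "length \<omega>" n] index_box_subset(2)[OF mn(1), of "length \<omega>"] by (auto intro!: M)
      have split: "box_prod \<omega> n s = box_prod \<omega> m s * (\<Prod>k\<in>?F. rzeta (s + lin k \<omega>))"
        unfolding box_prod_def using index_box_subset(2)[of m n "length \<omega>"] mn finite_index_box
        by (subst prod.subset_diff[of "index_box (length \<omega>) m" "index_box (length \<omega>) n"]) (auto simp: mult.commute)
      have Cp: "C * 2 powr (- Re s) \<le> C" using p1[of s] s C(1) by (simp add: mult_left_le)
      have 1: "norm ((\<Prod>k\<in>?F. rzeta (s + lin k \<omega>)) - 1) \<le> e / (2 * K)"
      proof -
        have "norm ((\<Prod>k\<in>?F. rzeta (s + lin k \<omega>)) - 1) \<le> exp (C * 2 powr (- Re s) * sum decay ?F) - 1"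
          by (rule norm_sub_prod[OF C(2) _ F(1)]) (use s in auto)
        also have "C * 2 powr (- Re s) * sum decay ?F \<le> (C + 1) * \<delta>"
          using Cp C(1) F(2) \<delta> by (intro mult_mono) (auto intro!: sum_nonneg simp: decay_nonneg)
        also have "(C + 1) * \<delta> = ln (1 + e / (2 * K))" using C(1) by (simp add: \<delta>_def)
        also have "exp (ln (1 + e / (2 * K))) = 1 + e / (2 * K)"
          using e K by (intro exp_ln) (simp add: add_pos_pos)
        finally show ?thesis by simp
      qed
      have 2: "norm (box_prod \<omega> m s) \<le> K"
      proof -
        have "norm (box_prod \<omega> m s - 1) \<le> exp (C * 2 powr (- Re s) * S) - 1"
          unfolding S_def by (rule norm_box_prod[OF C(2,1)]) (use s in auto)
        also have "\<dots> \<le> K - 1" unfolding K_def using Cp S by (simp add: mult_right_mono)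
        finally show ?thesis using norm_triangle_sub[of "box_prod \<omega> m s" 1] by simp
      qed
      have "dist (box_prod \<omega> m s) (box_prod \<omega> n s) = norm (box_prod \<omega> m s * ((\<Prod>k\<in>?F. rzeta (s + lin k \<omega>)) - 1))"
        unfolding split by (simp add: dist_norm norm_minus_commute algebra_simps)
      also have "\<dots> \<le> K * (e / (2 * K))"
        unfolding norm_mult using 1 2 K by (intro mult_mono) auto
      also have "\<dots> < e" using K e by simp
      finally show "dist (box_prod \<omega> m s) (box_prod \<omega> n s) < e" .
    qed
  qed
  hence "uniformly_convergent_on {s. Re s \<ge> \<sigma>} (box_prod \<omega>)" by (rule Cauchy_uniformly_convergent)
  thus ?thesis unfolding Zlim_def[abs_def] by (simp add: uniformly_convergent_uniform_limit_iff)
qed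

lemma box_prod_tendsto: "Re s > 1 \<Longrightarrow> (\<lambda>N. box_prod \<omega> N s) \<longlonglongrightarrow> Zlim \<omega> s"
  using tendsto_uniform_limitI[OF box_prod_uniform[of "Re s"], of s] by simp

lemma Zlim_holomorphic: "Zlim \<omega> holomorphic_on {s. Re s > 1}"
proof (rule holomorphic_uniform_sequence[of _ "box_prod \<omega>"])
  show "box_prod \<omega> N holomorphic_on {s. Re s > 1}" for N
    unfolding box_prod_def
  proof (intro holomorphic_on_prod)
    fix n
    show "(\<lambda>s. rzeta (s + lin n \<omega>)) holomorphic_on {s. Re s > 1}"
      by (rule holomorphic_on_compose_gen[OF _ rzeta_holomorphic, unfolded o_def])
         (use Re_lin_nonneg[OF \<omega>, of n] in \<open>auto intro!: holomorphic_intros\<close>)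
  qed
  fix s assume s: "s \<in> {s. Re s > 1}"
  define d where "d = (Re s - 1) / 2"
  have d: "d > 0" using s by (simp add: d_def)
  have sub: "cball s d \<subseteq> {z. Re z \<ge> 1 + d}"
  proof
    fix z assume "z \<in> cball s d"
    hence "Re s - Re z \<le> d" using abs_Re_le_cmod[of "s - z"] by (simp add: dist_norm)
    moreover have "Re s = 1 + 2 * d" by (simp add: d_def field_simps)
    ultimately show "z \<in> {z. Re z \<ge> 1 + d}" by simp
  qed
  have "uniform_limit (cball s d) (box_prod \<omega>) (Zlim \<omega>) sequentially"
    by (rule uniform_limit_on_subset[OF box_prod_uniform sub]) (use d in simp)
  thus "\<exists>d>0. cball s d \<subseteq> {s. Re s > 1} \<and> uniform_limit (cball s d) (box_prod \<omega>) (Zlim \<omega>) sequentially"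
    using d sub by (intro exI[of _ d]) force
qed (rule open_Re_gt)

text \<open>Far to the right every box product has distance from 1 below a common bound smaller than
  1, and the limit inherits it.\<close>

lemma Zlim_nonzero: "\<exists>a>1. \<forall>s. Re s > a \<longrightarrow> Zlim \<omega> s \<noteq> 0"
proof -
  obtain C where C: "C \<ge> 0" "\<And>s. Re s \<ge> 2 \<Longrightarrow> norm (rzeta s - 1) \<le> C * 2 powr (- Re s)"
    using rzeta_minus_1_bound[of 2] by auto
  define q where "q = C * infsum decay (nlists (length \<omega>))"
  have q: "q \<ge> 0" unfolding q_def using C by (intro mult_nonneg_nonneg infsum_nonneg) (auto simp: decay_nonneg)
  \<comment> \<open>Beyond a one has 2 powr Re s > 2 q, so the exponent q 2 powr (-Re s) is below
    1/2 and hence below ln 2.\<close>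
  define a where "a = 2 + 2 * q / ln 2"
  have l2: "ln 2 > (0::real)" "ln 2 \<ge> (1/2::real)" using ln2_ge_two_thirds by auto
  show ?thesis
  proof (intro exI[of _ a] conjI allI impI)
    show "a > 1" using q l2 by (simp add: a_def add_pos_nonneg)
    fix s assume s: "Re s > a"
    have a2: "a \<ge> 2" using q l2 by (simp add: a_def)
    have s2: "Re s \<ge> 2" "Re s > 1" using s a2 by auto
    have "a * ln 2 = 2 * ln 2 + 2 * q" using l2 by (simp add: a_def distrib_right)
    hence "2 * q < 1 + a * ln 2" using l2 by simp
    also have "\<dots> \<le> 1 + Re s * ln 2" using s l2 by simp
    also have "\<dots> \<le> exp (Re s * ln 2)" by (rule exp_ge_add_one_self)
    finally have "2 * q < 2 powr Re s" by (simp add: powr_def)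
    hence "q * 2 powr (- Re s) < 1 / 2" by (simp add: powr_minus field_simps)
    hence "exp (q * 2 powr (- Re s)) < exp (ln 2)" using l2 by (subst exp_less_cancel_iff) linarith
    hence e: "exp (q * 2 powr (- Re s)) - 1 < 1" by simp
    have "norm (box_prod \<omega> N s - 1) \<le> exp (q * 2 powr (- Re s)) - 1" for N
      using norm_box_prod[OF C(2,1) s2(1), of N] by (simp add: q_def mult_ac)
    moreover have "(\<lambda>N. norm (box_prod \<omega> N s - 1)) \<longlonglongrightarrow> norm (Zlim \<omega> s - 1)"
      by (intro tendsto_intros box_prod_tendsto s2)
    ultimately have "norm (Zlim \<omega> s - 1) \<le> exp (q * 2 powr (- Re s)) - 1"
      by (intro LIMSEQ_le_const2) auto
    thus "Zlim \<omega> s \<noteq> 0" using e by auto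
  qed
qed

text \<open>This is the face left over by telescoping a box in the direction v. Its argument moves
  right with N, so its deviation from 1 vanishes.\<close>

lemma box_prod_shift_tendsto:
  assumes s: "Re s > 1" and v: "Re v > 0"
  shows "(\<lambda>N. box_prod \<omega> N (s + of_nat (Suc N) * v)) \<longlonglongrightarrow> 1"
proof -
  obtain C where C: "C \<ge> 0" "\<And>z. Re z \<ge> Re s \<Longrightarrow> norm (rzeta z - 1) \<le> C * 2 powr (- Re z)"
    using rzeta_minus_1_bound[OF s] by blast
  let ?S = "infsum decay (nlists (length \<omega>))"
  have "(\<lambda>N. box_prod \<omega> N (s + of_nat (Suc N) * v) - 1) \<longlonglongrightarrow> 0"
  proof (rule Lim_null_comparison)
    show "\<forall>\<^sub>F N in sequentially. norm (box_prod \<omega> N (s + of_nat (Suc N) * v) - 1) \<le>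
       exp (C * (2 powr (- Re s) * (2 powr (- Re v)) ^ Suc N) * ?S) - 1"
    proof (rule always_eventually, rule allI)
      fix N
      have r: "Re (s + of_nat (Suc N) * v) \<ge> Re s" using v by simp
      have "2 powr (- Re (s + of_nat (Suc N) * v)) = 2 powr (- Re s) * 2 powr (real (Suc N) * (- Re v))"
        by (simp only: powr_add[symmetric]) simp
      also have "2 powr (real (Suc N) * (- Re v)) = (2 powr (- Re v)) ^ Suc N"
        using powr_realpow[of "2 powr (- Re v)" "Suc N"] by (simp only: powr_powr mult.commute[of "real (Suc N)"]) simp
      finally show "norm (box_prod \<omega> N (s + of_nat (Suc N) * v) - 1) \<le>
         exp (C * (2 powr (- Re s) * (2 powr (- Re v)) ^ Suc N) * ?S) - 1"
        using norm_box_prod[OF C(2,1) r, of N] by simp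
    qed
    have "2 powr (- Re v) < 1" using v powr_less_mono[of "- Re v" 0 2] by simp
    hence "(\<lambda>N. (2 powr (- Re v)) ^ Suc N) \<longlonglongrightarrow> 0"
      by (intro LIMSEQ_Suc LIMSEQ_realpow_zero) auto
    hence "(\<lambda>N. exp (C * (2 powr (- Re s) * (2 powr (- Re v)) ^ Suc N) * ?S) - 1) \<longlonglongrightarrow> exp (C * (2 powr (- Re s) * 0) * ?S) - 1"
      by (intro tendsto_intros)
    thus "(\<lambda>N. exp (C * (2 powr (- Re s) * (2 powr (- Re v)) ^ Suc N) * ?S) - 1) \<longlonglongrightarrow> 0" by simp
  qed
  thus ?thesis by (simp add: LIM_zero_iff)
qed

end

section \<open>Ladder and continuation of the zeta product\<close>

lemma box_prod_snoc: "box_prod (\<omega> @ [v]) N s = (\<Prod>k\<le>N. box_prod \<omega> N (s + of_nat k * v))"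
proof -
  have bij: "bij_betw (\<lambda>(k, n). n @ [k]) ({..N} \<times> index_box (length \<omega>) N) (index_box (Suc (length \<omega>)) N)"
    by (rule bij_betwI[where g = "\<lambda>n. (last n, butlast n)"])
       (auto simp: index_box_def length_Suc_conv_rev)
  have "box_prod (\<omega> @ [v]) N s = (\<Prod>(k, n)\<in>{..N} \<times> index_box (length \<omega>) N. rzeta (s + lin (n @ [k]) (\<omega> @ [v])))"
    unfolding box_prod_def by (simp add: prod.reindex_bij_betw[OF bij, symmetric] case_prod_unfold)
  also have "\<dots> = (\<Prod>k\<le>N. \<Prod>n\<in>index_box (length \<omega>) N. rzeta (s + lin (n @ [k]) (\<omega> @ [v])))"
    by (simp add: prod.cartesian_product)
  also have "\<dots> = (\<Prod>k\<le>N. box_prod \<omega> N (s + of_nat k * v))"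
    unfolding box_prod_def by (intro prod.cong refl) (auto simp: lin_snoc index_box_def algebra_simps)
  finally show ?thesis .
qed

text \<open>A box and its translate by one step in the last index differ by one face at each end.
  The near face tends to the product for the shorter tuple, the far face to 1.\<close>

lemma Zlim_ladder:
  assumes \<omega>: "\<forall>w\<in>set (\<omega> @ [v]). Re w > 0" and s: "Re s > 1"
  shows "Zlim (\<omega> @ [v]) s = Zlim \<omega> s * Zlim (\<omega> @ [v]) (s + v)"
proof -
  have \<omega>': "\<forall>w\<in>set \<omega>. Re w > 0" and v: "Re v > 0" using \<omega> by auto
  have "box_prod (\<omega> @ [v]) N s * box_prod \<omega> N (s + of_nat (Suc N) * v) =
        box_prod \<omega> N s * box_prod (\<omega> @ [v]) N (s + v)" for N
  proof -
    let ?g = "\<lambda>k. box_prod \<omega> N (s + of_nat k * v)"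
    have "box_prod (\<omega> @ [v]) N s * ?g (Suc N) = (\<Prod>k\<le>Suc N. ?g k)"
      unfolding box_prod_snoc by simp
    also have "\<dots> = ?g 0 * (\<Prod>k\<le>N. ?g (Suc k))" by (rule prod.atMost_Suc_shift)
    also have "(\<Prod>k\<le>N. ?g (Suc k)) = box_prod (\<omega> @ [v]) N (s + v)"
      unfolding box_prod_snoc by (intro prod.cong) (auto simp: algebra_simps)
    finally show ?thesis by simp
  qed
  moreover have "(\<lambda>N. box_prod (\<omega> @ [v]) N s * box_prod \<omega> N (s + of_nat (Suc N) * v)) \<longlonglongrightarrow> Zlim (\<omega> @ [v]) s * 1"
    by (intro tendsto_mult box_prod_tendsto[OF \<omega>] box_prod_shift_tendsto[OF \<omega>'] s v)
  moreover have "(\<lambda>N. box_prod \<omega> N s * box_prod (\<omega> @ [v]) N (s + v)) \<longlonglongrightarrow> Zlim \<omega> s * Zlim (\<omega> @ [v]) (s + v)"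
    using s v by (intro tendsto_mult box_prod_tendsto[OF \<omega>] box_prod_tendsto[OF \<omega>']) auto
  ultimately show ?thesis using LIMSEQ_unique by (metis (no_types, lifting) LIMSEQ_unique mult.right_neutral ext)
qed

lemma Zprod_Zlim: "Zprod s \<omega> = mero_cont (Zlim \<omega>) {s. Re s > 1} s"
  unfolding Zprod_def Zlim_def[abs_def] box_prod_def index_box_def by simp

lemma Zprod_Nil: "Zprod s [] = rzeta s"
proof -
  have "mero_cont (Zlim []) {s. Re s > 1} = rzeta"
    by (rule mero_cont_eqI)
       (auto simp: rzeta_nicely_meromorphic open_Re_gt ex_Re_gt Zlim_def box_prod_def index_box_def cong: conj_cong)
  thus ?thesis by (simp add: Zprod_Zlim)
qed

text \<open>The induction of \<open>mgamma_continuation\<close>, with convergence in Re s > 1 as its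
  starting region and \<open>rzeta\<close> as its base.\<close>

lemma Zprod_continuation:
  assumes "\<forall>w\<in>set \<omega>. Re w > 0"
  shows "(\<lambda>s. Zprod s \<omega>) nicely_meromorphic_on UNIV \<and> (\<forall>s. Re s > 1 \<longrightarrow> Zprod s \<omega> = Zlim \<omega> s)"
  using assms
proof (induction \<omega> rule: rev_induct)
  case Nil
  have "Zlim [] s = rzeta s" for s by (simp add: Zlim_def box_prod_def index_box_def cong: conj_cong)
  thus ?case using rzeta_nicely_meromorphic by (simp add: Zprod_Nil[abs_def])
next
  case (snoc v \<omega>)
  have "\<exists>g. g nicely_meromorphic_on UNIV \<and> (\<forall>s\<in>{s. Re s > 1}. g s = Zlim (\<omega> @ [v]) s)"
  proof (rule meromorphic_ladder)
    show "(\<lambda>s. Zprod s \<omega>) meromorphic_on UNIV" using snoc by (simp add: nicely_meromorphic_on_def)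
    show "Zlim (\<omega> @ [v]) s = Zprod s \<omega> * Zlim (\<omega> @ [v]) (s + v)" if "Re s > 1" for s
      using Zlim_ladder[OF snoc.prems that] snoc that by simp
  qed (use snoc Zlim_holomorphic in auto)
  from mero_cont_props[OF this open_Re_gt Re_gt_nonempty] show ?case
    by (auto simp: Zprod_Zlim[abs_def])
qed

lemma
  assumes \<omega>: "\<forall>w\<in>set \<omega>. Re w > 0"
  shows Zprod_meromorphic: "(\<lambda>s. Zprod s \<omega>) meromorphic_on UNIV"
    and Zprod_eq_Zlim: "Re s > 1 \<Longrightarrow> Zprod s \<omega> = Zlim \<omega> s"
    and Zprod_nonzero: "\<forall>\<^sub>F s in cosparse UNIV. Zprod s \<omega> \<noteq> 0"
proof -
  show 1: "(\<lambda>s. Zprod s \<omega>) meromorphic_on UNIV"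
    using Zprod_continuation[OF \<omega>] by (simp add: nicely_meromorphic_on_def)
  show 2: "Zprod s \<omega> = Zlim \<omega> s" if "Re s > 1" for s
    using Zprod_continuation[OF \<omega>] that by simp
  obtain a where a: "a > 1" "\<And>s. Re s > a \<Longrightarrow> Zlim \<omega> s \<noteq> 0" using Zlim_nonzero[OF \<omega>] by blast
  show "\<forall>\<^sub>F s in cosparse UNIV. Zprod s \<omega> \<noteq> 0"
    by (rule nonzero_cosparse[OF 1 open_Re_gt[of a], of "of_real (a + 1)"]) (use a in \<open>auto simp: 2\<close>)
qed

lemma Zprod_ladder:
  assumes \<omega>: "\<forall>w\<in>set (\<omega> @ [v]). Re w > 0"
  shows "\<forall>\<^sub>F s in cosparse UNIV. Zprod s (\<omega> @ [v]) = Zprod s \<omega> * Zprod (s + v) (\<omega> @ [v])"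
proof (rule eq_cosparse[where a = 1])
  have \<omega>': "\<forall>w\<in>set \<omega>. Re w > 0" using \<omega> by auto
  show "(\<lambda>s. Zprod s (\<omega> @ [v])) meromorphic_on UNIV" by (rule Zprod_meromorphic[OF \<omega>])
  show "(\<lambda>s. Zprod s \<omega> * Zprod (s + v) (\<omega> @ [v])) meromorphic_on UNIV"
    by (intro meromorphic_on_mult Zprod_meromorphic[OF \<omega>'] meromorphic_on_shift(1)[OF Zprod_meromorphic[OF \<omega>]])
  show "Zprod s (\<omega> @ [v]) = Zprod s \<omega> * Zprod (s + v) (\<omega> @ [v])" if "Re s > 1" for s
    using Zlim_ladder[OF \<omega> that] Zprod_eq_Zlim[OF \<omega>, of s] Zprod_eq_Zlim[OF \<omega>, of "s + v"] Zprod_eq_Zlim[OF \<omega>', of s] that \<omega>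
    by simp
qed

section \<open>The ladder relation and the theorem\<close>

definition bern_fps :: "complex \<Rightarrow> complex list \<Rightarrow> complex fps" where
  "bern_fps z \<omega> = fps_exp (- z) * (\<Prod>w\<leftarrow>\<omega>. inverse (fps_shift 1 (1 - fps_exp (- w))))"

lemma mbernoulli_fps: "mbernoulli k z \<omega> / fact k = fps_nth (bern_fps z \<omega>) k"
  by (simp add: mbernoulli_def bern_fps_def)

text \<open>Moving z to z + v multiplies the series by exp(-v x). The difference 1 - exp(-v x) is x
  times the denominator contributed by v, so that denominator cancels and x survives.\<close>

lemma bern_fps_ladder:
  assumes "v \<noteq> 0"
  shows "bern_fps z (\<omega> @ [v]) - bern_fps (z + v) (\<omega> @ [v]) = fps_X * bern_fps z \<omega>"
proof -
  define q where "q = fps_shift 1 (1 - fps_exp (- v))"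
  have q: "1 - fps_exp (- v) = fps_X * q"
  proof (rule fps_ext)
    fix n show "fps_nth (1 - fps_exp (- v)) n = fps_nth (fps_X * q) n"
      by (cases n) (simp_all add: q_def)
  qed
  have "fps_nth q 0 \<noteq> 0" using assms by (simp add: q_def)
  hence iq: "q * inverse q = 1" by (metis inverse_mult_eq_1')
  let ?R = "\<Prod>w\<leftarrow>\<omega>. inverse (fps_shift 1 (1 - fps_exp (- w)))"
  have e: "fps_exp (- (z + v)) = fps_exp (- z) * fps_exp (- v)"
    by (simp add: fps_exp_add_mult[symmetric])
  have "bern_fps z (\<omega> @ [v]) - bern_fps (z + v) (\<omega> @ [v]) = fps_exp (- z) * (1 - fps_exp (- v)) * ?R * inverse q"
    unfolding bern_fps_def e by (simp add: q_def algebra_simps)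
  also have "\<dots> = fps_X * (fps_exp (- z) * ?R) * (q * inverse q)"
    unfolding q by (simp only: mult_ac)
  finally show ?thesis by (simp add: iq bern_fps_def)
qed

text \<open>The surviving factor x lowers the index by one, in step with the loss of one
  period.\<close>

lemma mbernoulli_ladder:
  assumes "v \<noteq> 0"
  shows "mbernoulli (Suc k) z (\<omega> @ [v]) / fact (Suc k) =
          mbernoulli k z \<omega> / fact k + mbernoulli (Suc k) (z + v) (\<omega> @ [v]) / fact (Suc k)"
proof -
  have "fps_nth (bern_fps z (\<omega> @ [v]) - bern_fps (z + v) (\<omega> @ [v])) (Suc k) = fps_nth (bern_fps z \<omega>) k"
    unfolding bern_fps_ladder[OF assms] by simp
  thus ?thesis unfolding mbernoulli_fps by (simp add: algebra_simps)
qed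

section \<open>Ladders of \<open>Zhat\<close> and \<open>Lambda\<close>\<close>

definition Zhat_exponent :: "complex \<Rightarrow> complex list \<Rightarrow> complex" where
  "Zhat_exponent s \<omega> = - mbernoulli (length \<omega>) s \<omega> / fact (length \<omega>) - mbernoulli (length \<omega>) (s - 1) \<omega> / fact (length \<omega>)
      + mbernoulli (length \<omega> + 1) s (2 # \<omega>) / fact (length \<omega> + 1)"

lemma Zhat_altdef:
  "Zhat s \<omega> = exp (Zhat_exponent s \<omega> * Ln (2 * of_real pi)) * inverse (mgamma s \<omega>) * inverse (mgamma (s - 1) \<omega>)
      * mgamma s (2 # \<omega>) * Zprod s \<omega>"
  by (simp add: Zhat_def Zhat_exponent_def Let_def)

text \<open>In all three terms the Bernoulli index equals the number of periods, so each lengthens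
  and shifts in the same way.\<close>

lemma Zhat_exponent_ladder:
  assumes "v \<noteq> 0"
  shows "Zhat_exponent s (\<omega> @ [v]) = Zhat_exponent s \<omega> + Zhat_exponent (s + v) (\<omega> @ [v])"
proof -
  have "s - 1 + v = s + v - 1" by simp
  thus ?thesis
    using mbernoulli_ladder[OF assms, of "length \<omega>" s \<omega>] mbernoulli_ladder[OF assms, of "length \<omega>" "s - 1" \<omega>]
      mbernoulli_ladder[OF assms, of "length \<omega> + 1" s "2 # \<omega>"]
    unfolding Zhat_exponent_def by (simp only: length_append list.size append_Cons Suc_eq_plus1 add_0 minus_divide_left[symmetric]) (simp only: diff_conv_add_uminus minus_add_distrib add_ac)
qed

lemma Zhat_ladder:
  assumes \<omega>: "\<forall>w\<in>set (\<omega> @ [v]). Re w > 0"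
  shows "\<forall>\<^sub>F s in cosparse UNIV. Zhat s (\<omega> @ [v]) = Zhat s \<omega> * Zhat (s + v) (\<omega> @ [v])"
proof -
  have v: "v \<noteq> 0" using \<omega> by auto
  have \<omega>2: "\<forall>w\<in>set ((2 # \<omega>) @ [v]). Re w > 0" using \<omega> by auto
  have "\<forall>\<^sub>F s in cosparse UNIV. mgamma (s - 1) (\<omega> @ [v]) = mgamma (s - 1) \<omega> * mgamma (s - 1 + v) (\<omega> @ [v])"
    by (rule eventually_cosparse_shift(3)[OF mgamma_ladder(2)[OF \<omega>]])
  with mgamma_ladder(2)[OF \<omega>] mgamma_ladder(2)[OF \<omega>2] Zprod_ladder[OF \<omega>] show ?thesis
  proof eventually_elim
    case (elim s)
    have sv: "s - 1 + v = s + v - 1" by simp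
    show ?case
      unfolding Zhat_altdef elim(1,4) elim(2)[unfolded append_Cons] elim(3)[unfolded sv] Zhat_exponent_ladder[OF v, of s \<omega>]
      by (simp add: exp_add ring_distribs sv)
  qed
qed

lemma Zhat_nonzero:
  assumes \<omega>: "\<forall>w\<in>set \<omega>. Re w > 0"
  shows "\<forall>\<^sub>F s in cosparse UNIV. Zhat s \<omega> \<noteq> 0"
proof -
  have \<omega>2: "\<forall>w\<in>set (2 # \<omega>). Re w > 0" using \<omega> by auto
  show ?thesis
    using mgamma_nonzero[OF \<omega>] eventually_cosparse_shift(3)[OF mgamma_nonzero[OF \<omega>], of 1]
      mgamma_nonzero[OF \<omega>2] Zprod_nonzero[OF \<omega>]
    by eventually_elim (simp add: Zhat_altdef)
qed

lemma minus_one_power_cases: "((-1) ^ k :: int) = 1 \<or> ((-1) ^ k :: int) = - 1"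
  by (cases "even k") auto

lemma Lambda_nonzero:
  assumes \<omega>: "\<forall>w\<in>set \<omega>. Re w > 0"
  shows "\<forall>\<^sub>F s in cosparse UNIV. Lambda s \<omega> \<noteq> 0"
  using Zhat_nonzero[OF \<omega>] eventually_cosparse_shift(2)[OF Zhat_nonzero[OF \<omega>], of "1 + sum_list \<omega>"]
  by eventually_elim (simp add: Lambda_def)

lemma Lambda_ladder:
  assumes \<omega>: "\<forall>w\<in>set (\<omega> @ [v]). Re w > 0"
  shows "\<forall>\<^sub>F s in cosparse UNIV. Lambda s (\<omega> @ [v]) = Lambda s \<omega> * Lambda (s + v) (\<omega> @ [v])"
proof -
  have \<omega>': "\<forall>w\<in>set \<omega>. Re w > 0" using \<omega> by auto
  let ?c = "1 + sum_list \<omega>"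
  show ?thesis
    using Zhat_ladder[OF \<omega>] eventually_cosparse_shift(2)[OF Zhat_ladder[OF \<omega>], of ?c]
      eventually_cosparse_shift(2)[OF Zhat_nonzero[OF \<omega>'], of ?c]
  proof eventually_elim
    case (elim s)
    have c: "1 + sum_list (\<omega> @ [v]) - s = ?c - s + v" "1 + sum_list (\<omega> @ [v]) - (s + v) = ?c - s" by simp_all
    define e :: int where "e = (-1) ^ (length \<omega> + 1)"
    have e: "(-1) ^ (length (\<omega> @ [v]) + 1) = - e" "e = 1 \<or> e = -1"
      using minus_one_power_cases[of "length \<omega> + 1"] by (simp_all add: e_def)
    define A D where "A = Zhat (?c - s) \<omega>" and "D = Zhat (?c - s + v) (\<omega> @ [v])"
    have A: "A \<noteq> 0" using elim(3) by (simp add: A_def)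
    have B: "Zhat (?c - s) (\<omega> @ [v]) = A * D" using elim(2) by (simp add: A_def D_def)
    \<comment> \<open>The reflected ladder gives the factor A * D at c - s. Raised to -e, its A
      cancels the A powi e coming from the shorter tuple, which requires A to be nonzero.\<close>
    have "D powi (- e) = A powi e * (A * D) powi (- e)"
      using e(2) A by auto
    thus ?case
      unfolding Lambda_def c e(1) B elim(1) e_def[symmetric] A_def[symmetric] D_def[symmetric] by simp
  qed
qed

text \<open>\<open>Zhat s []\<close> is a constant times s (s - 1) \<open>xi s\<close>, hence
  symmetric under s to 1 - s, and \<open>Lambda s []\<close> is a quotient of equal nonzero
  values.\<close>

lemma Lambda_Nil: "\<forall>\<^sub>F s in cosparse UNIV. Lambda s [] = 1"
proof -
  obtain c where c: "c \<noteq> 0"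
    "\<forall>\<^sub>F z in cosparse UNIV. mgamma z [2] = c * exp (z / 2 * of_real (ln 2)) * Gamma (z / 2)"
    using mgamma_2 by blast
  have b0: "mbernoulli 0 s [] = 1" for s by (simp add: mbernoulli_def)
  have b1: "mbernoulli 1 s [2] = (1 - s) / 2" for s
  proof -
    \<comment> \<open>The series starts 2 - 2 x, so its inverse starts 1/2 + x/2.\<close>
    define q :: "complex fps" where "q = fps_shift 1 (1 - fps_exp (- 2))"
    have q01: "fps_nth q 0 = 2" "fps_nth q 1 = - 2" by (simp_all add: q_def numeral_2_eq_2)
    have "inverse q * q = 1" using q01 by (intro inverse_mult_eq_1) simp
    hence "fps_nth (inverse q * q) 1 = 0" by simp
    hence i1: "fps_nth (inverse q) 1 = 1 / 2" using q01 by (simp add: fps_mult_nth)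
    have i0: "fps_nth (inverse q) 0 = 1 / 2" using q01 by simp
    show ?thesis unfolding mbernoulli_def using i0 i1 by (simp add: fps_mult_nth q_def field_simps)
  qed
  have E: "Zhat_exponent s [] = - 3 / 2 - s / 2" for s
    using b1[of s] by (simp add: Zhat_exponent_def b0 field_simps)
  have Ln: "Ln (2 * of_real pi) = of_real (ln 2) + of_real (ln pi)"
  proof -
    have "Ln (2 * of_real pi) = Ln (of_real (2 * pi))" by simp
    also have "\<dots> = of_real (ln (2 * pi))" by (rule Ln_of_real) simp
    finally show ?thesis by (simp add: ln_mult)
  qed
  define k where "k = exp (- 3 / 2 * (of_real (ln 2) + of_real (ln pi))) * c"
  have Z: "\<forall>\<^sub>F s in cosparse UNIV. Zhat s [] = k * (s * (s - 1)) * xi s"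
    using c(2)
  proof eventually_elim
    case (elim s)
    have p: "complex_of_real pi powr (- s / 2) = exp (- s / 2 * of_real (ln pi))"
      by (simp add: powr_def Ln_of_real)
    \<comment> \<open>The power of 2 depending on s in the exponent cancels against the one from
      \<open>mgamma s [2]\<close>; pi to the power -s/2 remains for \<open>xi\<close>.\<close>
    have "exp ((- 3 / 2 - s / 2) * (of_real (ln 2) + of_real (ln pi))) * exp (s / 2 * of_real (ln 2)) =
       exp (- 3 / 2 * (of_real (ln 2) + of_real (ln pi))) * exp (- s / 2 * of_real (ln pi))"
      unfolding exp_add[symmetric] by (simp add: algebra_simps)
    moreover have "Zhat s [] = (exp ((- 3 / 2 - s / 2) * (of_real (ln 2) + of_real (ln pi))) * exp (s / 2 * of_real (ln 2)))
         * (s * (s - 1)) * c * Gamma (s / 2) * rzeta s"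
      unfolding Zhat_altdef E Ln elim by (simp add: mgamma_Nil Zprod_Nil mult_ac)
    ultimately show ?case unfolding k_def xi_def p by (simp only: mult_ac)
  qed
  have "\<forall>\<^sub>F s in cosparse UNIV. Zhat s [] \<noteq> 0" by (rule Zhat_nonzero) simp
  with Z eventually_cosparse_shift(2)[OF Z, of 1] xi_functional_equation show ?thesis
  proof eventually_elim
    case (elim s)
    have "Zhat (1 - s) [] = Zhat s []"
      unfolding elim(1,2) elim(3)[symmetric] by (simp add: algebra_simps)
    thus ?case using elim(4) by (simp add: Lambda_def)
  qed
qed

text \<open>Pair K with insert m K, where m is the new index. The two factors carry opposite
  exponents, and the ladder reduces them to the factor of K for the shorter tuple. The empty set
  accounts for the leading factor of the functional equation.\<close>

lemma Lambda_product:
  assumes "\<forall>w\<in>set \<omega>. Re w > 0"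
  shows "\<forall>\<^sub>F s in cosparse UNIV.
    (\<Prod>K\<in>Pow {..<length \<omega>}. Lambda (s + (\<Sum>k\<in>K. \<omega> ! k)) \<omega> powi ((-1) ^ card K)) = 1"
  using assms
proof (induction \<omega> rule: rev_induct)
  case Nil
  show ?case using Lambda_Nil by eventually_elim simp
next
  case (snoc v \<omega>)
  let ?m = "length \<omega>"
  let ?\<omega> = "\<omega> @ [v]"
  have "\<forall>\<^sub>F s in cosparse UNIV. \<forall>K\<in>Pow {..<?m}. Lambda (s + (\<Sum>k\<in>K. \<omega> ! k)) ?\<omega> =
           Lambda (s + (\<Sum>k\<in>K. \<omega> ! k)) \<omega> * Lambda (s + (\<Sum>k\<in>K. \<omega> ! k) + v) ?\<omega>"
    by (intro eventually_ball_finite ballI eventually_cosparse_shift(1)[OF Lambda_ladder[OF snoc.prems]]) simp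
  moreover have "\<forall>\<^sub>F s in cosparse UNIV. \<forall>K\<in>Pow {..<?m}. Lambda (s + (\<Sum>k\<in>K. \<omega> ! k) + v) ?\<omega> \<noteq> 0"
  proof (intro eventually_ball_finite ballI)
    fix K
    show "\<forall>\<^sub>F s in cosparse UNIV. Lambda (s + (\<Sum>k\<in>K. \<omega> ! k) + v) ?\<omega> \<noteq> 0"
      using eventually_cosparse_shift(1)[OF Lambda_nonzero[OF snoc.prems], of "(\<Sum>k\<in>K. \<omega> ! k) + v"]
      by (simp add: add.assoc)
  qed simp
  moreover have "\<forall>\<^sub>F s in cosparse UNIV.
    (\<Prod>K\<in>Pow {..<?m}. Lambda (s + (\<Sum>k\<in>K. \<omega> ! k)) \<omega> powi ((-1) ^ card K)) = 1"
    using snoc by simp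
  ultimately show ?case
  proof eventually_elim
    case (elim s)
    let ?f = "\<lambda>K. Lambda (s + (\<Sum>k\<in>K. ?\<omega> ! k)) ?\<omega> powi ((-1) ^ card K)"
    have sumK: "(\<Sum>k\<in>K. ?\<omega> ! k) = (\<Sum>k\<in>K. \<omega> ! k)" if "K \<subseteq> {..<?m}" for K
      using that by (intro sum.cong) (auto simp: nth_append)
    have "(\<Prod>K\<in>Pow {..<length ?\<omega>}. ?f K) = (\<Prod>K\<in>Pow {..<?m} \<union> insert ?m ` Pow {..<?m}. ?f K)"
      by (simp add: lessThan_Suc Pow_insert)
    also have "\<dots> = (\<Prod>K\<in>Pow {..<?m}. ?f K) * (\<Prod>K\<in>insert ?m ` Pow {..<?m}. ?f K)"
      by (rule prod.union_disjoint) auto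
    also have "(\<Prod>K\<in>insert ?m ` Pow {..<?m}. ?f K) = (\<Prod>K\<in>Pow {..<?m}. ?f (insert ?m K))"
    proof (rule prod.reindex[unfolded o_def])
      show "inj_on (insert ?m) (Pow {..<?m})"
        by (rule inj_on_inverseI[where g = "\<lambda>K. K - {?m}"]) auto
    qed
    also have "(\<Prod>K\<in>Pow {..<?m}. ?f K) * (\<Prod>K\<in>Pow {..<?m}. ?f (insert ?m K)) =
               (\<Prod>K\<in>Pow {..<?m}. ?f K * ?f (insert ?m K))"
      by (rule prod.distrib[symmetric])
    also have "\<dots> = (\<Prod>K\<in>Pow {..<?m}. Lambda (s + (\<Sum>k\<in>K. \<omega> ! k)) \<omega> powi ((-1) ^ card K))"
    proof (intro prod.cong refl)
      fix K assume K: "K \<in> Pow {..<?m}"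
      hence fin: "finite K" "?m \<notin> K" by (auto intro: finite_subset)
      define L M where "L = Lambda (s + (\<Sum>k\<in>K. \<omega> ! k)) \<omega>" and "M = Lambda (s + (\<Sum>k\<in>K. \<omega> ! k) + v) ?\<omega>"
      have M: "M \<noteq> 0" and LM: "Lambda (s + (\<Sum>k\<in>K. \<omega> ! k)) ?\<omega> = L * M"
        using elim(1,2) K by (auto simp: L_def M_def)
      have "(\<Sum>k\<in>insert ?m K. ?\<omega> ! k) = v + (\<Sum>k\<in>K. \<omega> ! k)"
        using fin sumK[of K] K by simp
      hence "?f (insert ?m K) = M powi (- ((-1) ^ card K))"
        using fin by (simp add: M_def algebra_simps)
      moreover have "?f K = (L * M) powi ((-1) ^ card K)" using sumK[of K] K LM by simp
      moreover have "(L * M) powi ((-1) ^ card K) * M powi (- ((-1) ^ card K)) = L powi ((-1) ^ card K)"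
        using M minus_one_power_cases[of "card K"] by auto
      ultimately show "?f K * ?f (insert ?m K) = Lambda (s + (\<Sum>k\<in>K. \<omega> ! k)) \<omega> powi ((-1) ^ card K)"
        by (simp add: L_def)
    qed
    finally show ?case using elim(3) by simp
  qed
qed

theorem theorem3p3p4:
  fixes \<omega> :: "complex list" and r :: nat
  assumes "r \<ge> 1" and "length \<omega> = r" and "\<forall>w\<in>set \<omega>. Re w > 0"
  shows "eventually (\<lambda>s. Lambda s \<omega> = Lambda s (butlast \<omega>) * Lambda (s + last \<omega>) \<omega>) (cosparse UNIV) \<and>
         eventually (\<lambda>s. Lambda s \<omega> *
           (\<Prod>j\<in>{1..r}. \<Prod>K\<in>{K. K \<subseteq> {..<r} \<and> card K = j}.
              Lambda (s + (\<Sum>k\<in>K. \<omega> ! k)) \<omega> powi ((-1) ^ j)) = 1) (cosparse UNIV)"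
proof
  have ne: "butlast \<omega> @ [last \<omega>] = \<omega>" using assms by (intro append_butlast_last_id) auto
  show "eventually (\<lambda>s. Lambda s \<omega> = Lambda s (butlast \<omega>) * Lambda (s + last \<omega>) \<omega>) (cosparse UNIV)"
    using Lambda_ladder[of "butlast \<omega>" "last \<omega>"] assms(3) unfolding ne by blast
  \<comment> \<open>Subsets are grouped by cardinality. Cardinality 0 contributes only the empty
    set, the factor written separately in front.\<close>
  have eq: "Lambda s \<omega> * (\<Prod>j\<in>{1..r}. \<Prod>K\<in>{K. K \<subseteq> {..<r} \<and> card K = j}. Lambda (s + (\<Sum>k\<in>K. \<omega> ! k)) \<omega> powi ((-1) ^ j)) =
     (\<Prod>K\<in>Pow {..<length \<omega>}. Lambda (s + (\<Sum>k\<in>K. \<omega> ! k)) \<omega> powi ((-1) ^ card K))" for s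
  proof -
    let ?f = "\<lambda>K. Lambda (s + (\<Sum>k\<in>K. \<omega> ! k)) \<omega> powi ((-1) ^ card K)"
    have "(\<Prod>K\<in>Pow {..<r}. ?f K) = (\<Prod>j\<in>{0..r}. \<Prod>K\<in>{K \<in> Pow {..<r}. card K = j}. ?f K)"
      by (rule prod.group[symmetric]) (auto dest: card_mono[rotated])
    also have "\<dots> = (\<Prod>K\<in>{K \<in> Pow {..<r}. card K = 0}. ?f K) * (\<Prod>j\<in>{1..r}. \<Prod>K\<in>{K \<in> Pow {..<r}. card K = j}. ?f K)"
      by (subst prod.atLeast_Suc_atMost) auto
    also have "{K \<in> Pow {..<r}. card K = 0} = {{}}"
      by (auto dest: finite_subset)
    also have "(\<Prod>K\<in>{{}}. ?f K) = Lambda s \<omega>" by simp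
    also have "(\<Prod>j\<in>{1..r}. \<Prod>K\<in>{K \<in> Pow {..<r}. card K = j}. ?f K) =
       (\<Prod>j\<in>{1..r}. \<Prod>K\<in>{K. K \<subseteq> {..<r} \<and> card K = j}. Lambda (s + (\<Sum>k\<in>K. \<omega> ! k)) \<omega> powi ((-1) ^ j))"
      by (intro prod.cong) auto
    finally show ?thesis using assms(2) by simp
  qed
  show "eventually (\<lambda>s. Lambda s \<omega> *
           (\<Prod>j\<in>{1..r}. \<Prod>K\<in>{K. K \<subseteq> {..<r} \<and> card K = j}.
              Lambda (s + (\<Sum>k\<in>K. \<omega> ! k)) \<omega> powi ((-1) ^ j)) = 1) (cosparse UNIV)"
    unfolding eq by (rule Lambda_product[OF assms(3)])
qed

end
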